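(* A pair $(A,B)$ of Newton polygons does not have a root of high multiplicity if and only if, up to monomial change of variables or transposition, $(A,B)$ is one of the following: (0) the trivial case: $A=\{(0,0)\}$ and $B$ is arbitrary; (1) $A=\{(0,0),(1,0)\}$ and $B$ is contained in $3$ horizontal segments, or $A=\{(0,0),(1,0),(2,0)\}$ and $B$ is contained in $2$ horizontal segments; (2) $A=B$ (possibly up to a shift) are of full dimension, and they are one of $\{(0,0),(1,0),(0,1),(1,1)\}$, $\{(0,0),(1,0),(0,1),(2,0)\}$; (3) $A$ is the standard simplex and $B$ is a subset of the $2$-simplex.
   Context: A Newton polygon is here identified with its set of lattice points, a nonempty finite convex subset of $\mathbb{Z}^2$; a finite $X\subset\mathbb{Z}^2$ is convex if $X=\mathbb{Z}^2\cap\bar X$ for some convex $\bar X\subset\mathbb{R}^2$. For a finite $A\subset\mathbb{Z}^2$, $\mathbb{C}^A$ is the space of Laurent polynomials $\sum_{a\in A}c_az^a$ in two variables, $c_a\in\mathbb{C}$. A system supported at $(A,B)$ is $f=g=0$ with $f\in\mathbb{C}^A$, $g\in\mathbb{C}^B$. The pair $(A,B)$ has a root of high multiplicity if there exists a system supported at $(A,B)$ that has a root of multiplicity higher than $2$, where a root of multiplicity $m$ is an isolated solution $p\in(\mathbb{C}^* )^2$ with local intersection multiplicity $\dim_{\mathbb{C}}\mathcal{O}_p/(f,g)=m$ ($\mathcal{O}_p$ is the local ring at $p$). A finite convex subset $X\subset\mathbb{Z}^2$ is contained in $n$ horizontal segments if there exist $n$ distinct horizontal lines $l_1,\dots,l_n$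 such that $X=\bigcup_i (X\cap l_i)$ and $X\cap l_i\ne\varnothing$ for all $i$. The standard simplex is $\{(0,0),(1,0),(0,1)\}$; the $2$-simplex is $\mathrm{conv}\{(0,0),(2,0),(0,2)\}\cap\mathbb{Z}^2$. A (invertible) monomial change of variables acts on $(A,B)$ by applying one and the same element of $GL_2(\mathbb{Z})$ to both $A$ and $B$; transposition interchanges $A$ and $B$. The property of having a root of high multiplicity is invariant under translations of $A$ and of $B$ by (possibly different) vectors of $\mathbb{Z}^2$, and the sets are considered up to such shifts.
   Formalization: Pairs on parallel lines with at least 4 points each are excluded: they have no isolated solutions, so no root of high multiplicity, yet are not listed. In (1), "contained in 3 (or 2) horizontal segments" is read as at most 3 (or 2); "exactly" would leave out valid pairs. *)

theory Defs
  imports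
    "HOL-Analysis.Analysis"
    "HOL-Library.Poly_Mapping"
    "HOL-Computational_Algebra.Fraction_Field"
    "HOL-Computational_Algebra.Polynomial"
begin

subsection \<open>Lattice polygons\<close>

definition lattice_points :: "(real \<times> real) set \<Rightarrow> (int \<times> int) set" where
  "lattice_points K = {(i, j). (real_of_int i, real_of_int j) \<in> K}"

definition newton_polygon :: "(int \<times> int) set \<Rightarrow> bool" where
  "newton_polygon X \<longleftrightarrow> X \<noteq> {} \<and> finite X \<and> (\<exists>K. convex K \<and> X = lattice_points K)"

definition horizontal_line :: "int \<Rightarrow> (int \<times> int) set" where
  "horizontal_line l = {(i, j). j = l}"

text \<open>Lines meeting a set of lattice points have integral height, so a set of heights is enough.
  The number \<open>n\<close> is the exact number of horizontal lines met by \<open>X\<close>.\<close>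

definition in_horizontal_segments :: "nat \<Rightarrow> (int \<times> int) set \<Rightarrow> bool" where
  "in_horizontal_segments n X \<longleftrightarrow>
     (\<exists>L. finite L \<and> card L = n \<and> X = (\<Union>l\<in>L. X \<inter> horizontal_line l) \<and>
          (\<forall>l\<in>L. X \<inter> horizontal_line l \<noteq> {}))"

definition standard_simplex :: "(int \<times> int) set" where
  "standard_simplex = {(0, 0), (1, 0), (0, 1)}"

definition two_simplex :: "(int \<times> int) set" where
  "two_simplex = lattice_points (convex hull {(0, 0), (2, 0), (0, 2)})"

text \<open>Both sets lie on lines with the same direction \<open>(d, e)\<close>.\<close>

definition on_parallel_lines :: "(int \<times> int) set \<Rightarrow> (int \<times> int) set \<Rightarrow> bool" where
  "on_parallel_lines A B \<longleftrightarrow>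
     (\<exists>d e. (d, e) \<noteq> (0, 0) \<and>
        (\<forall>X\<in>{A, B}. \<forall>(i, j)\<in>X. \<forall>(k, l)\<in>X. (k - i) * e = (l - j) * d))"

definition lattice_map :: "int^2^2 \<Rightarrow> int \<times> int \<Rightarrow> int \<times> int" where
  "lattice_map M = (\<lambda>(i, j). (M $ 1 $ 1 * i + M $ 1 $ 2 * j, M $ 2 $ 1 * i + M $ 2 $ 2 * j))"

text \<open>One matrix of \<open>GL\<^sub>2(\<int>)\<close> acts on both sets, while the two translations are independent.\<close>

definition same_up_to_monomial_change ::
  "(int \<times> int) set \<Rightarrow> (int \<times> int) set \<Rightarrow> (int \<times> int) set \<Rightarrow> (int \<times> int) set \<Rightarrow> bool" where
  "same_up_to_monomial_change A B A' B' \<longleftrightarrow>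
     (\<exists>M u v. invertible M \<and>
        A' = (\<lambda>a. lattice_map M a + u) ` A \<and> B' = (\<lambda>b. lattice_map M b + v) ` B)"

definition same_up_to_change_or_transposition ::
  "(int \<times> int) set \<Rightarrow> (int \<times> int) set \<Rightarrow> (int \<times> int) set \<Rightarrow> (int \<times> int) set \<Rightarrow> bool" where
  "same_up_to_change_or_transposition A B A' B' \<longleftrightarrow>
     same_up_to_monomial_change A B A' B' \<or> same_up_to_monomial_change B A A' B'"


subsection \<open>Laurent polynomials\<close>

text \<open>The keys of the finitely supported map are the exponents of the monomials.\<close>

type_synonym laurent = "(int \<times> int) \<Rightarrow>\<^sub>0 complex"

definition laurent_space :: "(int \<times> int) set \<Rightarrow> laurent set" where
  "laurent_space A = {f. Poly_Mapping.keys f \<subseteq> A}"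

definition laurent_eval :: "laurent \<Rightarrow> complex \<times> complex \<Rightarrow> complex" where
  "laurent_eval f p =
     (\<Sum>a\<in>Poly_Mapping.keys f. Poly_Mapping.lookup f a * fst p powi fst a * snd p powi snd a)"

definition torus :: "(complex \<times> complex) set" where
  "torus = (UNIV - {0}) \<times> (UNIV - {0})"

definition solutions :: "laurent \<Rightarrow> laurent \<Rightarrow> (complex \<times> complex) set" where
  "solutions f g = {p \<in> torus. laurent_eval f p = 0 \<and> laurent_eval g p = 0}"


subsection \<open>The local ring at a point and intersection multiplicity\<close>

text \<open>\<open>\<complex>(x, y)\<close> is the fraction field of \<open>\<complex>[x][y]\<close>: the coefficients of the outer polynomial
  are polynomials in \<open>x\<close>, and its variable is \<open>y\<close>.\<close>

type_synonym ratfun = "complex poly poly fract"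

definition rat_const :: "complex \<Rightarrow> ratfun" where
  "rat_const c = Fract [:[:c:]:] 1"

definition rat_x :: ratfun where
  "rat_x = Fract [:[:0, 1:]:] 1"

definition rat_y :: ratfun where
  "rat_y = Fract [:0, 1:] 1"

definition laurent_ratfun :: "laurent \<Rightarrow> ratfun" where
  "laurent_ratfun f =
     (\<Sum>a\<in>Poly_Mapping.keys f.
        rat_const (Poly_Mapping.lookup f a) * rat_x powi fst a * rat_y powi snd a)"

definition poly2 :: "complex poly poly \<Rightarrow> complex \<times> complex \<Rightarrow> complex" where
  "poly2 q p = poly (poly q [:snd p:]) (fst p)"

text \<open>The rational functions regular at \<open>p\<close>. For \<open>p\<close> in the torus, localising the polynomial
  ring or the Laurent polynomial ring at \<open>p\<close> gives the same subring of \<open>\<complex>(x, y)\<close>.\<close>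

definition local_ring :: "complex \<times> complex \<Rightarrow> ratfun set" where
  "local_ring p = {Fract r s | r s. poly2 s p \<noteq> 0}"

definition local_ideal :: "complex \<times> complex \<Rightarrow> laurent \<Rightarrow> laurent \<Rightarrow> ratfun set" where
  "local_ideal p f g =
     {u * laurent_ratfun f + v * laurent_ratfun g | u v. u \<in> local_ring p \<and> v \<in> local_ring p}"

text \<open>\<open>dim\<^sub>\<complex> (V / W) = n\<close>: the classes modulo \<open>W\<close> of some \<open>n\<close> elements of \<open>V\<close> form a basis.\<close>

definition quotient_has_dim :: "ratfun set \<Rightarrow> ratfun set \<Rightarrow> nat \<Rightarrow> bool" where
  "quotient_has_dim V W n \<longleftrightarrow>
     (\<exists>B\<subseteq>V. finite B \<and> card B = n \<and>
        (\<forall>v\<in>V. \<exists>!c. c \<in> B \<rightarrow>\<^sub>E UNIV \<and> v - (\<Sum>b\<in>B. rat_const (c b) * b) \<in> W))"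

definition root_of_multiplicity ::
  "laurent \<Rightarrow> laurent \<Rightarrow> complex \<times> complex \<Rightarrow> nat \<Rightarrow> bool" where
  "root_of_multiplicity f g p m \<longleftrightarrow>
     p isolated_in solutions f g \<and> quotient_has_dim (local_ring p) (local_ideal p f g) m"

definition has_root_of_high_multiplicity :: "(int \<times> int) set \<Rightarrow> (int \<times> int) set \<Rightarrow> bool" where
  "has_root_of_high_multiplicity A B \<longleftrightarrow>
     (\<exists>f\<in>laurent_space A. \<exists>g\<in>laurent_space B. \<exists>p m. root_of_multiplicity f g p m \<and> m > 2)"

end

theory Submission
  imports Defs "HOL-Computational_Algebra.Computational_Algebra" "HOL-Library.Landau_Symbols"
begin

text \<open>The multiplicity of a root \<open>p\<close> is the dimension of the local ring modulo the ideal
  \<open>(f, g)\<close>. Both directions rest on one principle: if \<open>f = 0\<close> is smooth at \<open>p\<close>, the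
  multiplicity is the order of vanishing of \<open>g\<close> along the arc \<open>f = 0\<close>.

  The pairs of the list have no root of multiplicity above 2. If \<open>A\<close> is a point, the equation
  supported at \<open>B\<close> would have to define the root alone, but a principal ideal generated by a
  non-unit has infinite codimension (\<open>principal_ideal_infinite_codim\<close>). A line meets a conic
  along a polynomial of degree at most 2 (\<open>line_conic\<close>). If both polygons are the square, or
  both are the wide triangle, a linear combination of the two equations has its support in the
  standard simplex, and the system becomes a line and a conic. If one equation involves \<open>x\<close>
  alone, the other one restricts to a polynomial in \<open>y\<close> with as many terms as there are rows,
  and a nonzero root of a polynomial has smaller multiplicity than the number of its terms
  (\<open>order_less_number_of_terms\<close>, \<open>rows_no_high_multiplicity\<close>).

  Conversely, systems with a root of multiplicity at least 3 at \<open>(1, 1)\<close> are constructed for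
  every other pair. The certificate is \<open>bad_by_arc\<close>: an arc along which \<open>f\<close> and \<open>g\<close> vanish to
  high order, and three functions that vanish to distinct lower orders. It is applied to four
  kinds of systems: \<open>x = 1\<close> with four rows, \<open>(x - 1)\<^sup>2 = 0\<close> with three rows,
  \<open>(x - 1)\<^sup>3 = 0\<close> with two rows, and a line with a trinomial. The first three settle all
  pairs in which one set is collinear.

  The line and the trinomial are the heart of the matter. A trinomial supported at a triangle
  with edge vectors \<open>u\<close> and \<open>v\<close> has contact of order 3 with the line \<open>y = 1 + \<mu> (x - 1)\<close>
  at \<open>(1, 1)\<close> if and only if \<open>\<mu>\<close> is a root of the cubic \<open>\<theta>(u) \<theta>(v) (\<theta>(u) - \<theta>(v)) - det(u, v) \<mu>
  (1 - \<mu>)\<close>, where \<open>\<theta>(w) = w\<^sub>1 + \<mu> w\<^sub>2\<close>. The values \<open>0\<close>, \<open>1\<close> and \<open>\<infinity>\<close> of \<open>\<mu>\<close>, for which the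
  line loses a monomial, are roots only if the triangle has an edge parallel to an edge of the
  standard simplex. In such cases the lattice points on the edges of the triangle give another
  triangle, or four points in line, and one obtains \<open>bad_not_fitting\<close>: the standard simplex and
  a two-dimensional polygon have a root of high multiplicity unless the polygon fits into the
  2-simplex after a translation.

  Every two-dimensional polygon contains a unimodular triangle. So, in the absence of roots of
  high multiplicity, each of two such polygons fits into the double of every unimodular triangle
  of the other one. If one of them has three points, this is the last case of the list.
  Otherwise both contain, up to a change of the frame, the unit square or the wide triangle, and
  their unimodular triangles pin down the partner (\<open>partner_of_unit_square\<close>,
  \<open>partner_of_wide_triangle\<close>).\<close>

section \<open>The local ring and its residue field\<close>

lemma poly2_simps [simp]:
  "poly2 0 p = 0" "poly2 1 p = 1" "poly2 (q + r) p = poly2 q p + poly2 r p"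
  "poly2 (q - r) p = poly2 q p - poly2 r p" "poly2 (- q) p = - poly2 q p"
  "poly2 (q * r) p = poly2 q p * poly2 r p"
  "poly2 (pCons a q) p = poly a (fst p) + snd p * poly2 q p"
  by (simp_all add: poly2_def)

lemma poly2_nonzero_imp: "poly2 s p \<noteq> 0 \<Longrightarrow> s \<noteq> 0"
  by auto

lemma continuous_poly2: "continuous_on UNIV (poly2 q)"
proof (induction q)
  case (pCons a q)
  have "continuous_on UNIV (\<lambda>p. poly a (fst p) + snd p * poly2 q p)"
    by (intro continuous_intros pCons.IH)
  then show ?case by simp
qed (auto simp: poly2_def)

definition rval :: "complex \<times> complex \<Rightarrow> ratfun \<Rightarrow> complex" where
  "rval p h = (THE c. \<exists>r s. h = Fract r s \<and> poly2 s p \<noteq> 0 \<and> c = poly2 r p / poly2 s p)"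

lemma rval_Fract:
  assumes "poly2 s p \<noteq> 0"
  shows "rval p (Fract r s) = poly2 r p / poly2 s p"
  unfolding rval_def
proof (rule the_equality)
  fix c assume "\<exists>r' s'. Fract r s = Fract r' s' \<and> poly2 s' p \<noteq> 0 \<and> c = poly2 r' p / poly2 s' p"
  then obtain r' s' where *: "Fract r s = Fract r' s'" "poly2 s' p \<noteq> 0" "c = poly2 r' p / poly2 s' p"
    by blast
  have "r * s' = r' * s"
    using * assms poly2_nonzero_imp by (subst (asm) eq_fract) auto
  then have "poly2 r p * poly2 s' p = poly2 r' p * poly2 s p"
    by (metis poly2_simps(6))
  then show "c = poly2 r p / poly2 s p" using *(2,3) assms frac_eq_eq by metis
qed (use assms in blast)

lemma local_ringE:
  assumes "h \<in> local_ring p"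
  obtains r s where "h = Fract r s" "poly2 s p \<noteq> 0" "s \<noteq> 0" "rval p h = poly2 r p / poly2 s p"
  using assms rval_Fract poly2_nonzero_imp unfolding local_ring_def by blast

lemma local_ring_Fract: "poly2 s p \<noteq> 0 \<Longrightarrow> Fract r s \<in> local_ring p"
  unfolding local_ring_def by blast

lemma local_ring_add:
  assumes "g \<in> local_ring p" "h \<in> local_ring p"
  shows "g + h \<in> local_ring p" "rval p (g + h) = rval p g + rval p h"
proof -
  obtain r s r' s' where *: "g = Fract r s" "poly2 s p \<noteq> 0" "s \<noteq> 0" "h = Fract r' s'" "poly2 s' p \<noteq> 0"
      "s' \<noteq> 0"
    "rval p g = poly2 r p / poly2 s p" "rval p h = poly2 r' p / poly2 s' p"
    using assms by (metis local_ringE)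
  then have eq: "g + h = Fract (r * s' + r' * s) (s * s')" by simp
  show "g + h \<in> local_ring p" unfolding eq using * by (intro local_ring_Fract) simp
  show "rval p (g + h) = rval p g + rval p h" unfolding eq using *
      by (subst rval_Fract) (auto simp: field_simps)
qed

lemma local_ring_mult:
  assumes "g \<in> local_ring p" "h \<in> local_ring p"
  shows "g * h \<in> local_ring p" "rval p (g * h) = rval p g * rval p h"
proof -
  obtain r s r' s' where *: "g = Fract r s" "poly2 s p \<noteq> 0" "s \<noteq> 0" "h = Fract r' s'" "poly2 s' p \<noteq> 0"
      "s' \<noteq> 0"
    "rval p g = poly2 r p / poly2 s p" "rval p h = poly2 r' p / poly2 s' p"
    using assms by (metis local_ringE)
  then have eq: "g * h = Fract (r * r') (s * s')" by simp
  show "g * h \<in> local_ring p" unfolding eq using * by (intro local_ring_Fract) simp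
  show "rval p (g * h) = rval p g * rval p h" unfolding eq using * by (subst rval_Fract) auto
qed

lemma local_ring_const [simp]: "rat_const c \<in> local_ring p" "rval p (rat_const c) = c"
  unfolding rat_const_def by (auto intro: local_ring_Fract simp: rval_Fract)

lemma local_ring_x [simp]: "rat_x \<in> local_ring p" "rval p rat_x = fst p"
  unfolding rat_x_def by (auto intro: local_ring_Fract simp: rval_Fract)

lemma local_ring_y [simp]: "rat_y \<in> local_ring p" "rval p rat_y = snd p"
  unfolding rat_y_def by (auto intro: local_ring_Fract simp: rval_Fract)

lemma rat_const_simps [simp]:
  "rat_const 0 = 0" "rat_const 1 = 1" "rat_const (a + b) = rat_const a + rat_const b"
  "rat_const (a * b) = rat_const a * rat_const b" "rat_const (- a) = - rat_const a"
  "rat_const (a - b) = rat_const a - rat_const b"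
  unfolding rat_const_def by (simp_all add: Zero_fract_def One_fract_def pCons_one)

lemma rat_const_sum: "rat_const (sum f S) = (\<Sum>i\<in>S. rat_const (f i))"
  by (induction S rule: infinite_finite_induct) auto

lemma rat_const_power: "rat_const (a ^ n) = rat_const a ^ n"
  by (induction n) auto

lemma rat_const_inverse: "rat_const (inverse c) = inverse (rat_const c)"
proof (cases "c = 0")
  case False
  then have "rat_const c * rat_const (inverse c) = 1"
    by (metis rat_const_simps(2,4) right_inverse)
  then show ?thesis using False by (metis inverse_unique)
qed simp

lemma local_ring_01 [simp]: "0 \<in> local_ring p" "1 \<in> local_ring p" "rval p 0 = 0" "rval p 1 = 1"
  by (metis local_ring_const rat_const_simps(1,2))+

lemma local_ring_uminus:
  assumes "g \<in> local_ring p"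
  shows "- g \<in> local_ring p" "rval p (- g) = - rval p g"
  using local_ring_mult[OF local_ring_const(1)[of "-1"] assms] local_ring_const(2)[of p "-1"]
      by simp_all

lemma local_ring_diff:
  assumes "g \<in> local_ring p" "h \<in> local_ring p"
  shows "g - h \<in> local_ring p" "rval p (g - h) = rval p g - rval p h"
  using local_ring_add[OF assms(1) local_ring_uminus(1)[OF assms(2)]] local_ring_uminus[OF assms(2)]
      by simp_all

lemma local_ring_power:
  assumes "g \<in> local_ring p"
  shows "g ^ n \<in> local_ring p \<and> rval p (g ^ n) = rval p g ^ n"
  by (induction n) (auto simp: local_ring_mult assms)

lemma local_ring_sum:
  assumes "\<And>i. i \<in> S \<Longrightarrow> f i \<in> local_ring p"
  shows "sum f S \<in> local_ring p \<and> rval p (sum f S) = (\<Sum>i\<in>S. rval p (f i))"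
  using assms by (induction S rule: infinite_finite_induct) (auto simp: local_ring_add)

lemmas local_ring_intros = local_ring_add(1) local_ring_mult(1) local_ring_uminus(1) local_ring_diff(1)
  local_ring_power[THEN conjunct1] local_ring_sum[THEN conjunct1]
lemmas rval_simps = local_ring_add(2) local_ring_mult(2) local_ring_uminus(2) local_ring_diff(2)
  local_ring_power[THEN conjunct2] local_ring_sum[THEN conjunct2]

lemma local_ring_inverse:
  assumes "g \<in> local_ring p" "rval p g \<noteq> 0"
  shows "inverse g \<in> local_ring p" "rval p (inverse g) = inverse (rval p g)" "g \<noteq> 0"
proof -
  obtain r s where *: "g = Fract r s" "poly2 s p \<noteq> 0" "s \<noteq> 0" "rval p g = poly2 r p / poly2 s p"
    using assms local_ringE by metis
  then have r: "poly2 r p \<noteq> 0" "r \<noteq> 0" using assms by auto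
  show "inverse g \<in> local_ring p" using * r by (auto intro: local_ring_Fract)
  show "rval p (inverse g) = inverse (rval p g)" using * r by (simp add: rval_Fract)
  show "g \<noteq> 0" using assms by auto
qed

lemma local_ring_powi:
  assumes "g \<in> local_ring p" "rval p g \<noteq> 0"
  shows "g powi n \<in> local_ring p" "rval p (g powi n) = rval p g powi n"
  using assms local_ring_inverse[OF assms] local_ring_power[of g p "nat n"] local_ring_power[of "inverse
      g" p "nat (-n)"]
  unfolding power_int_def by (auto simp: power_inverse)

text \<open>A numerator that vanishes at \<open>p\<close> is divided with remainder by \<open>y - y\<^sub>0\<close>; the remainder
  depends on \<open>x\<close> only and is divisible by \<open>x - x\<^sub>0\<close>.\<close>

lemma local_ring_max_ideal:
  assumes "h \<in> local_ring p" "rval p h = 0"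
  shows "\<exists>h1\<in>local_ring p. \<exists>h2\<in>local_ring p.
    h = (rat_x - rat_const (fst p)) * h1 + (rat_y - rat_const (snd p)) * h2"
proof -
  obtain x y where p: "p = (x, y)" by (cases p)
  obtain r s where *: "h = Fract r s" "poly2 s p \<noteq> 0" "s \<noteq> 0" "rval p h = poly2 r p / poly2 s p"
    using assms local_ringE by metis
  then have r: "poly2 r p = 0" using assms by auto
  define u where "u = poly r [:y:]"
  have "poly u x = 0" using r by (simp add: u_def poly2_def p)
  then obtain t where t: "u = [:-x, 1:] * t" by (metis dvdE poly_eq_0_iff_dvd)
  have "poly (r - [:u:]) [:y:] = 0" by (simp add: u_def)
  then obtain w where w: "r - [:u:] = [:-[:y:], 1:] * w" by (metis dvdE poly_eq_0_iff_dvd)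
  have r_eq: "r = [:[:-x, 1:]:] * [:t:] + [:-[:y:], 1:] * w" using w t by (simp add: algebra_simps)
  have e1: "rat_x - rat_const (fst p) = Fract [:[:-x, 1:]:] 1" unfolding rat_x_def rat_const_def p
      by simp
  have e2: "rat_y - rat_const (snd p) = Fract [:-[:y:], 1:] 1" unfolding rat_y_def rat_const_def p
      by simp
  have "h = (rat_x - rat_const (fst p)) * Fract [:t:] s + (rat_y - rat_const (snd p)) * Fract w s"
    unfolding *(1) r_eq e1 e2 using *(3) by (simp add: eq_fract algebra_simps)
  then show ?thesis using * local_ring_Fract by blast
qed

text \<open>The two functions \<open>s\<close> and \<open>t\<close> generate the maximal ideal of the local ring at \<open>p\<close>.\<close>

definition local_params :: "complex \<times> complex \<Rightarrow> ratfun \<Rightarrow> ratfun \<Rightarrow> bool" where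
  "local_params p s t \<longleftrightarrow> s \<in> local_ring p \<and> t \<in> local_ring p \<and> rval p s = 0 \<and> rval p t = 0 \<and>
     (\<forall>h\<in>local_ring p. rval p h = 0 \<longrightarrow> (\<exists>h1\<in>local_ring p. \<exists>h2\<in>local_ring p. h = s * h1 + t * h2))"

section \<open>Laurent monomials\<close>

definition lmon :: "int \<times> int \<Rightarrow> ratfun" where
  "lmon a = rat_x powi fst a * rat_y powi snd a"

definition lmonv :: "complex \<times> complex \<Rightarrow> int \<times> int \<Rightarrow> complex" where
  "lmonv p a = fst p powi fst a * snd p powi snd a"

lemma rat_xy_nonzero [simp]: "rat_x \<noteq> 0" "rat_y \<noteq> 0"
proof -
  show "rat_x \<noteq> 0"
  proof
    assume "rat_x = 0"
    then have "rval (1, 1) rat_x = 0" by (simp only: local_ring_01)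
    then show False by simp
  qed
  show "rat_y \<noteq> 0"
  proof
    assume "rat_y = 0"
    then have "rval (1, 1) rat_y = 0" by (simp only: local_ring_01)
    then show False by simp
  qed
qed

lemma lmon_local:
  assumes "p \<in> torus"
  shows "lmon a \<in> local_ring p" "rval p (lmon a) = lmonv p a" "lmonv p a \<noteq> 0"
proof -
  have nz: "fst p \<noteq> 0" "snd p \<noteq> 0" using assms unfolding torus_def by auto
  have x: "rat_x powi fst a \<in> local_ring p" "rval p (rat_x powi fst a) = fst p powi fst a"
    using local_ring_powi[OF local_ring_x(1)] nz by auto
  have y: "rat_y powi snd a \<in> local_ring p" "rval p (rat_y powi snd a) = snd p powi snd a"
    using local_ring_powi[OF local_ring_y(1)] nz by auto
  show "lmon a \<in> local_ring p" "rval p (lmon a) = lmonv p a" "lmonv p a \<noteq> 0"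
    unfolding lmon_def lmonv_def using x y nz by (auto simp: local_ring_mult)
qed

lemma laurent_sums:
  assumes "finite S" "f \<in> laurent_space S"
  shows "laurent_ratfun f = (\<Sum>a\<in>S. rat_const (Poly_Mapping.lookup f a) * lmon a)"
    "laurent_eval f p = (\<Sum>a\<in>S. Poly_Mapping.lookup f a * lmonv p a)"
  using assms unfolding laurent_ratfun_def laurent_eval_def laurent_space_def lmon_def lmonv_def
  by (auto intro!: sum.mono_neutral_cong_left simp: mult.assoc in_keys_iff)

lemma laurent_local:
  assumes "p \<in> torus"
  shows "laurent_ratfun f \<in> local_ring p" "rval p (laurent_ratfun f) = laurent_eval f p"
proof -
  have f: "f \<in> laurent_space (Poly_Mapping.keys f)" by (simp add: laurent_space_def)
  note * = laurent_sums[OF _ f, simplified]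
  show "laurent_ratfun f \<in> local_ring p"
    unfolding * by (intro local_ring_intros) (auto intro!: local_ring_mult lmon_local assms)
  show "rval p (laurent_ratfun f) = laurent_eval f p"
    unfolding * by (subst rval_simps) (auto simp: rval_simps lmon_local assms intro!: local_ring_mult)
qed

text \<open>The map \<open>\<phi>\<close> will be the parametrisation of a polygon by a frame, so that the coefficients
  can be prescribed in the coordinates of the frame.\<close>

lemma laurent_with_coeffs:
  assumes "finite S" "inj_on \<phi> S"
  shows "\<exists>f\<in>laurent_space (\<phi> ` S). \<forall>a\<in>S. Poly_Mapping.lookup f (\<phi> a) = c a"
proof -
  define F where "F = (\<lambda>k. if k \<in> \<phi> ` S then c (inv_into S \<phi> k) else 0)"
  have fin: "finite {k. F k \<noteq> 0}"
    by (rule finite_subset[of _ "\<phi> ` S"]) (auto simp: F_def assms)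
  have l: "Poly_Mapping.lookup (Abs_poly_mapping F) = F" using fin by simp
  have "Abs_poly_mapping F \<in> laurent_space (\<phi> ` S)"
    unfolding laurent_space_def mem_Collect_eq
  proof
    fix k assume "k \<in> Poly_Mapping.keys (Abs_poly_mapping F)"
    then have "F k \<noteq> 0" by (metis in_keys_iff l)
    then show "k \<in> \<phi> ` S" by (auto simp: F_def split: if_splits)
  qed
  moreover have "\<forall>a\<in>S. F (\<phi> a) = c a" by (auto simp: F_def assms)
  ultimately show ?thesis using l by metis
qed

section \<open>Dimension of a quotient\<close>

text \<open>Closure under the constants only: the ambient field \<open>\<complex>(x, y)\<close> is regarded as a complex
  vector space.\<close>

definition csubspace :: "ratfun set \<Rightarrow> bool" where
  "csubspace W \<longleftrightarrow> 0 \<in> W \<and> (\<forall>a\<in>W. \<forall>b\<in>W. a + b \<in> W) \<and> (\<forall>c. \<forall>a\<in>W. rat_const c * a \<in> W)"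

lemma csubspaceD:
  assumes "csubspace W"
  shows "0 \<in> W" "a \<in> W \<Longrightarrow> b \<in> W \<Longrightarrow> a + b \<in> W" "a \<in> W \<Longrightarrow> rat_const c * a \<in> W"
  using assms unfolding csubspace_def by blast+

lemma csubspace_sum:
  assumes "csubspace W" "\<And>i. i \<in> S \<Longrightarrow> f i \<in> W"
  shows "sum f S \<in> W"
  using assms by (induction S rule: infinite_finite_induct) (auto simp: csubspace_def)

lemma csubspace_diff:
  assumes "csubspace W" "a \<in> W" "b \<in> W"
  shows "a - b \<in> W"
proof -
  have "rat_const (-1) * b \<in> W" using assms unfolding csubspace_def by blast
  then have "a + rat_const (-1) * b \<in> W" using assms unfolding csubspace_def by blast
  then show ?thesis by simp
qed

text \<open>Gaussian elimination: one unknown with a nonzero coefficient in the first equation is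
  expressed by the others.\<close>

lemma homogeneous_system_solvable:
  fixes c :: "'i \<Rightarrow> 's \<Rightarrow> complex"
  assumes "finite S" "finite I" "card S < card I"
  shows "\<exists>d. (\<exists>i\<in>I. d i \<noteq> 0) \<and> (\<forall>s\<in>S. (\<Sum>i\<in>I. d i * c i s) = 0)"
  using assms
proof (induction S arbitrary: I c rule: finite_induct)
  case empty
  then obtain i where "i \<in> I" by fastforce
  then show ?case by (intro exI[of _ "\<lambda>_. 1"]) auto
next
  case (insert s S)
  show ?case
  proof (cases "\<forall>i\<in>I. c i s = 0")
    case True
    have "card S < card I" using insert by simp
    from insert.IH[OF insert.prems(1) this, of c] obtain d
      where "\<exists>i\<in>I. d i \<noteq> 0" "\<forall>s\<in>S. (\<Sum>i\<in>I. d i * c i s) = 0" by blast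
    then show ?thesis using True by (intro exI[of _ d]) auto
  next
    case False
    then obtain i0 where i0: "i0 \<in> I" "c i0 s \<noteq> 0" by blast
    let ?J = "I - {i0}"
    have "finite ?J" "card S < card ?J" using insert i0 by auto
    from insert.IH[OF this, of "\<lambda>i t. c i t - c i s / c i0 s * c i0 t"] obtain d
      where d: "\<exists>i\<in>?J. d i \<noteq> 0"
        "\<forall>t\<in>S. (\<Sum>i\<in>?J. d i * (c i t - c i s / c i0 s * c i0 t)) = 0" by blast
    define e where "e = (\<lambda>i. if i = i0 then - (\<Sum>i\<in>?J. d i * c i s) / c i0 s else d i)"
    have split: "(\<Sum>i\<in>I. e i * c i t) = - (\<Sum>i\<in>?J. d i * c i s) / c i0 s * c i0 t + (\<Sum>i\<in>?J. d i * c i t)"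
        for t
    proof -
      have "(\<Sum>i\<in>I. e i * c i t) = e i0 * c i0 t + (\<Sum>i\<in>?J. e i * c i t)"
        using i0 insert.prems(1) by (simp add: sum.remove)
      also have "(\<Sum>i\<in>?J. e i * c i t) = (\<Sum>i\<in>?J. d i * c i t)"
        by (intro sum.cong) (auto simp: e_def)
      finally show ?thesis by (simp add: e_def)
    qed
    have "(\<Sum>i\<in>I. e i * c i t) = 0" if "t \<in> insert s S" for t
    proof (cases "t = s")
      case True then show ?thesis unfolding split using i0 by simp
    next
      case False
      then have "(\<Sum>i\<in>?J. d i * (c i t - c i s / c i0 s * c i0 t)) = 0" using that d by auto
      moreover have "(\<Sum>i\<in>?J. d i * (c i t - c i s / c i0 s * c i0 t))
        = (\<Sum>i\<in>?J. d i * c i t) - (\<Sum>i\<in>?J. d i * c i s) / c i0 s * c i0 t"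
        by (simp add: sum_subtractf sum_distrib_right sum_divide_distrib right_diff_distrib mult.assoc)
      ultimately show ?thesis unfolding split by simp
    qed
    moreover have "\<exists>i\<in>I. e i \<noteq> 0" using d(1) by (auto simp: e_def)
    ultimately show ?thesis by blast
  qed
qed

lemma dependent_mod:
  assumes W: "csubspace W" and S: "finite S" and I: "finite I" and less: "card S < card I"
    and span: "\<And>i. i \<in> I \<Longrightarrow> \<exists>c. v i - (\<Sum>s\<in>S. rat_const (c s) * s) \<in> W"
  shows "\<exists>d. (\<exists>i\<in>I. d i \<noteq> 0) \<and> (\<Sum>i\<in>I. rat_const (d i) * v i) \<in> W"
proof -
  from span obtain c where c: "\<And>i. i \<in> I \<Longrightarrow> v i - (\<Sum>s\<in>S. rat_const (c i s) * s) \<in> W" by metis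
  from homogeneous_system_solvable[OF S I less, of c] obtain d
    where d: "\<exists>i\<in>I. d i \<noteq> 0" "\<And>s. s \<in> S \<Longrightarrow> (\<Sum>i\<in>I. d i * c i s) = 0" by blast
  have "(\<Sum>i\<in>I. rat_const (d i) * (v i - (\<Sum>s\<in>S. rat_const (c i s) * s))) \<in> W"
    using W c by (intro csubspace_sum) (auto simp: csubspace_def)
  moreover have "(\<Sum>i\<in>I. rat_const (d i) * (v i - (\<Sum>s\<in>S. rat_const (c i s) * s)))
     = (\<Sum>i\<in>I. rat_const (d i) * v i) - (\<Sum>i\<in>I. \<Sum>s\<in>S. rat_const (d i * c i s) * s)"
    by (simp only: right_diff_distrib sum_subtractf sum_distrib_left mult.assoc rat_const_simps(4))
  moreover have "(\<Sum>i\<in>I. \<Sum>s\<in>S. rat_const (d i * c i s) * s) = (\<Sum>s\<in>S. rat_const (\<Sum>i\<in>I. d i * c i s) * s)"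
    by (subst sum.swap) (simp only: rat_const_sum sum_distrib_right)
  moreover have "(\<Sum>s\<in>S. rat_const (\<Sum>i\<in>I. d i * c i s) * s) = 0"
    by (intro sum.neutral ballI) (simp only: d(2) rat_const_simps mult_zero_left)
  ultimately show ?thesis using d(1) by (intro exI[of _ d]) simp
qed

text \<open>The classes of the elements of \<open>B\<close> form a basis of \<open>V / W\<close>; unlike unique coordinates,
  spanning and independence can be checked separately.\<close>

definition basis_mod :: "ratfun set \<Rightarrow> ratfun set \<Rightarrow> ratfun set \<Rightarrow> bool" where
  "basis_mod V W B \<longleftrightarrow> B \<subseteq> V \<and> finite B \<and>
     (\<forall>v\<in>V. \<exists>c. v - (\<Sum>b\<in>B. rat_const (c b) * b) \<in> W) \<and>
     (\<forall>d. (\<Sum>b\<in>B. rat_const (d b) * b) \<in> W \<longrightarrow> (\<forall>b\<in>B. d b = 0))"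

lemma basis_modD:
  assumes "basis_mod V W B"
  shows "B \<subseteq> V" "finite B" "v \<in> V \<Longrightarrow> \<exists>c. v - (\<Sum>b\<in>B. rat_const (c b) * b) \<in> W"
    "(\<Sum>b\<in>B. rat_const (d b) * b) \<in> W \<Longrightarrow> b \<in> B \<Longrightarrow> d b = 0"
  using assms unfolding basis_mod_def by blast+

lemma unique_coordinates_iff_basis_mod:
  assumes W: "csubspace W" and V: "0 \<in> V" and B: "B \<subseteq> V" "finite B"
  shows "(\<forall>v\<in>V. \<exists>!c. c \<in> B \<rightarrow>\<^sub>E UNIV \<and> v - (\<Sum>b\<in>B. rat_const (c b) * b) \<in> W) \<longleftrightarrow> basis_mod V W B"
    (is "(\<forall>v\<in>V. \<exists>!c. ?P v c) \<longleftrightarrow> _")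
proof
  assume uniq: "\<forall>v\<in>V. \<exists>!c. ?P v c"
  have "\<exists>c. v - (\<Sum>b\<in>B. rat_const (c b) * b) \<in> W" if "v \<in> V" for v
  proof -
    have "\<exists>c. ?P v c" by (rule ex1_implies_ex[OF bspec[OF uniq that]])
    then show ?thesis by (elim exE conjE) (rule exI)
  qed
  moreover have "d b = 0" if d: "(\<Sum>b\<in>B. rat_const (d b) * b) \<in> W" and b: "b \<in> B" for d b
  proof -
    let ?c = "restrict (\<lambda>_. 0) B" and ?d = "restrict (\<lambda>b. - d b) B"
    have P: "?P 0 ?c" "?P 0 ?d" using W d by (simp_all add: csubspace_def sum_negf)
    note ex1 = bspec[OF uniq V]
    have "?c = ?d" by (rule trans[OF sym[OF the1_equality[of "?P 0"
        ?c, OF ex1 P(1)]] the1_equality[of "?P 0" ?d, OF ex1 P(2)]])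
    then have "?c b = ?d b" by (rule fun_cong)
    then show ?thesis using b by simp
  qed
  ultimately show "basis_mod V W B" unfolding basis_mod_def using B by simp
next
  assume basis: "basis_mod V W B"
  show "\<forall>v\<in>V. \<exists>!c. ?P v c"
  proof
    fix v assume "v \<in> V"
    then obtain c where c: "v - (\<Sum>s\<in>B. rat_const (c s) * s) \<in> W" using basis_modD(3)[OF basis] by blast
    show "\<exists>!c. ?P v c"
    proof (rule ex1I[of _ "restrict c B"])
      show "?P v (restrict c B)" using c by simp
      fix c' assume c': "?P v c'"
      have "(v - (\<Sum>b\<in>B. rat_const (c b) * b)) - (v - (\<Sum>b\<in>B. rat_const (c' b) * b)) \<in> W"
        by (rule csubspace_diff[OF W c]) (rule conjunct2[OF c'])
      then have "(\<Sum>b\<in>B. rat_const (c' b - c b) * b) \<in> W"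
        by (simp add: left_diff_distrib sum_subtractf)
      then have eq: "\<forall>b\<in>B. c' b - c b = 0" using basis_modD(4)[OF basis, of "\<lambda>b. c' b - c b"] by blast
      show "c' = restrict c B"
      proof
        fix b show "c' b = restrict c B b"
        proof (cases "b \<in> B")
          case True then show ?thesis using bspec[OF eq True] by simp
        next
          case False then show ?thesis using PiE_arb[OF conjunct1[OF c'] False] by simp
        qed
      qed
    qed
  qed
qed

lemma quotient_has_dim_iff_basis:
  assumes "csubspace W" "0 \<in> V"
  shows "quotient_has_dim V W m \<longleftrightarrow> (\<exists>B. basis_mod V W B \<and> card B = m)"
  unfolding quotient_has_dim_def
proof (intro iffI; elim exE conjE)
  fix B assume "B \<subseteq> V" "finite B" "card B = m"
    "\<forall>v\<in>V. \<exists>!c. c \<in> B \<rightarrow>\<^sub>E UNIV \<and> v - (\<Sum>b\<in>B. rat_const (c b) * b) \<in> W"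
  then show "\<exists>B. basis_mod V W B \<and> card B = m"
    by (intro exI[of _ B] conjI iffD1[OF unique_coordinates_iff_basis_mod[OF assms]])
next
  fix B assume B: "basis_mod V W B" "card B = m"
  have "B \<subseteq> V" "finite B" by (rule basis_modD[OF B(1)])+
  with B show "\<exists>B\<subseteq>V. finite B \<and> card B = m \<and>
     (\<forall>v\<in>V. \<exists>!c. c \<in> B \<rightarrow>\<^sub>E UNIV \<and> v - (\<Sum>b\<in>B. rat_const (c b) * b) \<in> W)"
    by (intro exI[of _ B] conjI iffD2[OF unique_coordinates_iff_basis_mod[OF assms]])
qed

lemma quotient_dim_le:
  assumes dim: "quotient_has_dim V W m" and W: "csubspace W" and V: "0 \<in> V" and S: "finite S"
    and span: "\<And>v. v \<in> V \<Longrightarrow> \<exists>c. v - (\<Sum>s\<in>S. rat_const (c s) * s) \<in> W"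
  shows "m \<le> card S"
proof (rule ccontr)
  assume less: "\<not> m \<le> card S"
  obtain B where B: "basis_mod V W B" "card B = m"
    using dim quotient_has_dim_iff_basis[OF W V] by blast
  note BV = basis_modD(2)[OF B(1)] subsetD[OF basis_modD(1)[OF B(1)]]
  have "\<exists>d. (\<exists>b\<in>B. d b \<noteq> 0) \<and> (\<Sum>b\<in>B. rat_const (d b) * b) \<in> W"
    by (rule dependent_mod[OF W S BV(1)]) (use less B(2) in simp, rule span, rule BV(2))
  then obtain d b where d: "b \<in> B" "d b \<noteq> 0" "(\<Sum>b\<in>B. rat_const (d b) * b) \<in> W" by blast
  from basis_modD(4)[OF B(1) d(3,1)] d(2) show False by simp
qed

lemma quotient_dim_ge:
  assumes dim: "quotient_has_dim V W m" and W: "csubspace W" and V: "0 \<in> V"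
    and h: "\<And>i. i < k \<Longrightarrow> h i \<in> V"
    and indep: "\<And>d i. (\<Sum>i<k. rat_const (d i) * h i) \<in> W \<Longrightarrow> i < k \<Longrightarrow> d i = 0"
  shows "k \<le> m"
proof (rule ccontr)
  assume less: "\<not> k \<le> m"
  obtain B where B: "basis_mod V W B" "card B = m"
    using dim quotient_has_dim_iff_basis[OF W V] by blast
  have "\<exists>d. (\<exists>i\<in>{..<k}. d i \<noteq> 0) \<and> (\<Sum>i<k. rat_const (d i) * h i) \<in> W"
  proof (rule dependent_mod[OF W])
    show "finite B" by (rule basis_modD(2)[OF B(1)])
    fix i assume "i \<in> {..<k}"
    then have "h i \<in> V" using h by simp
    then show "\<exists>c. h i - (\<Sum>s\<in>B. rat_const (c s) * s) \<in> W" by (rule basis_modD(3)[OF B(1)])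
  qed (use B less in auto)
  then obtain d i where d: "i \<in> {..<k}" "d i \<noteq> 0" "(\<Sum>i<k. rat_const (d i) * h i) \<in> W" by blast
  then show False using indep[OF d(3)] by auto
qed

text \<open>A spanning set with the least number of elements is independent, since a nontrivial
  relation would make one of its elements redundant.\<close>

lemma quotient_dim_exists:
  assumes W: "csubspace W" and V: "0 \<in> V" and S: "finite S" "S \<subseteq> V"
    and span: "\<And>v. v \<in> V \<Longrightarrow> \<exists>c. v - (\<Sum>s\<in>S. rat_const (c s) * s) \<in> W"
  shows "\<exists>m. quotient_has_dim V W m"
proof -
  define spanning where "spanning = (\<lambda>S. finite S \<and> S \<subseteq> V \<and>
    (\<forall>v\<in>V. \<exists>c. v - (\<Sum>s\<in>S. rat_const (c s) * s) \<in> W))"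
  have "spanning S" unfolding spanning_def by (intro conjI ballI S span)
  then have B: "spanning (arg_min card spanning)" and min: "\<And>T. spanning T
      \<Longrightarrow> card (arg_min card spanning) \<le> card T"
    using arg_min_nat_lemma[of spanning S card] by (simp_all del: split_paired_All)
  define B where "B = arg_min card spanning"
  note B = B[folded B_def] and min = min[folded B_def]
  note spanB = B[unfolded spanning_def]
  have fin: "finite B" "B \<subseteq> V" using spanB by simp_all
  have "d b = 0" if d: "(\<Sum>b\<in>B. rat_const (d b) * b) \<in> W" and b: "b \<in> B" for d b
  proof (rule ccontr)
    assume db: "d b \<noteq> 0"
    have "\<exists>c. v - (\<Sum>s\<in>B - {b}. rat_const (c s) * s) \<in> W" if vV: "v \<in> V" for v
    proof -
      obtain c where c: "v - (\<Sum>s\<in>B. rat_const (c s) * s) \<in> W"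
        using bspec[OF conjunct2[OF conjunct2[OF spanB]] vV] by (rule exE)
      define e where "e = (\<lambda>s. c s - c b / d b * d s)"
      have "rat_const (c b / d b) * (\<Sum>s\<in>B. rat_const (d s) * s) \<in> W"
        by (rule csubspaceD(3)[OF W d])
      then have "v - (\<Sum>s\<in>B. rat_const (c s) * s) + rat_const (c b / d b) * (\<Sum>s\<in>B. rat_const (d s) * s)
          \<in> W"
        by (rule csubspaceD(2)[OF W c])
      also have "v - (\<Sum>s\<in>B. rat_const (c s) * s) + rat_const (c b / d b) * (\<Sum>s\<in>B. rat_const (d s) * s)
        = v - (\<Sum>s\<in>B. rat_const (e s) * s)"
      proof -
        have "rat_const (c b / d b) * (\<Sum>s\<in>B. rat_const (d s) * s)
            = (\<Sum>s\<in>B. rat_const (c b / d b * d s) * s)"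
          by (simp only: sum_distrib_left rat_const_simps(4) mult.assoc)
        moreover have "(\<Sum>s\<in>B. rat_const (e s) * s) =
          (\<Sum>s\<in>B. rat_const (c s) * s) - (\<Sum>s\<in>B. rat_const (c b / d b * d s) * s)"
          by (simp only: e_def rat_const_simps(6) left_diff_distrib sum_subtractf)
        ultimately show ?thesis by simp
      qed
      also have "(\<Sum>s\<in>B. rat_const (e s) * s) = (\<Sum>s\<in>B - {b}. rat_const (e s) * s)"
      proof -
        have "e b = 0" using db by (simp add: e_def)
        then show ?thesis using sum.remove[OF fin(1) b, of "\<lambda>s. rat_const (e s) * s"] by simp
      qed
      finally show ?thesis by (intro exI[of _ e])
    qed
    moreover have "finite (B - {b})" "B - {b} \<subseteq> V" using fin by auto
    ultimately have "spanning (B - {b})" unfolding spanning_def by (intro conjI ballI)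
    from min[OF this] show False using card_Diff1_less[OF fin(1) b] by linarith
  qed
  then have "basis_mod V W B" unfolding basis_mod_def
    by (intro conjI allI impI ballI fin bspec[OF conjunct2[OF conjunct2[OF spanB]]])
  then have "quotient_has_dim V W (card B)" unfolding quotient_has_dim_iff_basis[OF W V]
      by - (rule exI[of _ B], simp)
  then show ?thesis by (rule exI)
qed

section \<open>Ideals of the local ring\<close>

definition is_ideal :: "complex \<times> complex \<Rightarrow> ratfun set \<Rightarrow> bool" where
  "is_ideal p W \<longleftrightarrow> 0 \<in> W \<and> (\<forall>a\<in>W. \<forall>b\<in>W. a + b \<in> W) \<and> (\<forall>h\<in>local_ring p. \<forall>a\<in>W. h * a \<in> W)"

lemma is_idealD:
  assumes "is_ideal p W"
  shows "0 \<in> W" "a \<in> W \<Longrightarrow> b \<in> W \<Longrightarrow> a + b \<in> W" "h \<in> local_ring p \<Longrightarrow> a \<in> W \<Longrightarrow> h * a \<in> W"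
    "h \<in> local_ring p \<Longrightarrow> a \<in> W \<Longrightarrow> a * h \<in> W"
  using assms unfolding is_ideal_def by (auto simp: mult.commute)

lemma is_ideal_csubspace: "is_ideal p W \<Longrightarrow> csubspace W"
  unfolding is_ideal_def csubspace_def using local_ring_const by blast

lemma is_ideal_diff: "is_ideal p W \<Longrightarrow> a \<in> W \<Longrightarrow> b \<in> W \<Longrightarrow> a - b \<in> W"
  using csubspace_diff is_ideal_csubspace by blast

lemma is_ideal_sum: "is_ideal p W \<Longrightarrow> (\<And>i. i \<in> S \<Longrightarrow> f i \<in> W) \<Longrightarrow> sum f S \<in> W"
  using csubspace_sum is_ideal_csubspace by blast

lemma is_ideal_unit:
  assumes "is_ideal p W" "u * a \<in> W" "u \<in> local_ring p" "rval p u \<noteq> 0"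
  shows "a \<in> W"
proof -
  have "inverse u * (u * a) \<in> W" using assms local_ring_inverse is_idealD(3) by blast
  then show ?thesis using local_ring_inverse(3)[OF assms(3,4)] by (simp flip: mult.assoc)
qed

lemma is_ideal_local_ideal: "is_ideal p (local_ideal p f g)"
  unfolding is_ideal_def
proof (intro conjI ballI)
  show "0 \<in> local_ideal p f g" unfolding local_ideal_def
    unfolding mem_Collect_eq by (rule exI[of _ 0], rule exI[of _ 0]) simp
next
  fix a b assume "a \<in> local_ideal p f g" "b \<in> local_ideal p f g"
  then obtain u v u' v' where "a = u * laurent_ratfun f + v * laurent_ratfun g"
    "b = u' * laurent_ratfun f + v' * laurent_ratfun g"
    "u \<in> local_ring p" "v \<in> local_ring p" "u' \<in> local_ring p" "v' \<in> local_ring p"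
    unfolding local_ideal_def by blast
  then show "a + b \<in> local_ideal p f g" unfolding local_ideal_def
    unfolding mem_Collect_eq by (intro exI[of _ "u + u'"] exI[of _ "v
        + v'"]) (simp add: local_ring_add algebra_simps)
next
  fix h a assume h: "h \<in> local_ring p" and "a \<in> local_ideal p f g"
  then obtain u v where "a = u * laurent_ratfun f + v * laurent_ratfun g"
    "u \<in> local_ring p" "v \<in> local_ring p"
    unfolding local_ideal_def by blast
  then show "h * a \<in> local_ideal p f g" unfolding local_ideal_def using h
    unfolding mem_Collect_eq by (intro exI[of _ "h * u"] exI[of _ "h * v"]) (simp add: local_ring_mult
        algebra_simps)
qed

lemma local_ideal_gens: "laurent_ratfun f \<in> local_ideal p f g" "laurent_ratfun g \<in> local_ideal p f g"
proof -
  have "laurent_ratfun f = 1 * laurent_ratfun f + 0 * laurent_ratfun g"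
    "laurent_ratfun g = 0 * laurent_ratfun f + 1 * laurent_ratfun g" by simp_all
  then show "laurent_ratfun f \<in> local_ideal p f g" "laurent_ratfun g \<in> local_ideal p f g"
    unfolding local_ideal_def mem_Collect_eq using local_ring_01(1,2) by blast+
qed

lemma is_ideal_principal: "h \<in> local_ring p \<Longrightarrow> is_ideal p {h * u |u. u \<in> local_ring p}"
  unfolding is_ideal_def
  apply (intro conjI ballI; clarsimp)
  subgoal using local_ring_01(1) by fastforce
  subgoal for u u' by (rule exI[of _ "u + u'"]) (auto simp: local_ring_add algebra_simps)
  subgoal for k u by (rule exI[of _ "k * u"]) (auto simp: local_ring_mult algebra_simps)
  done

lemma local_ideal_least:
  assumes "is_ideal p I" "laurent_ratfun f \<in> I" "laurent_ratfun g \<in> I"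
  shows "local_ideal p f g \<subseteq> I"
  unfolding local_ideal_def using assms is_idealD by blast

lemma local_ideal_commute: "local_ideal p f g = local_ideal p g f"
proof -
  have "local_ideal p f g \<subseteq> local_ideal p g f" for f g
    by (intro local_ideal_least is_ideal_local_ideal local_ideal_gens)
  then show ?thesis by blast
qed

section \<open>Univariate polynomials evaluated at a rational function\<close>

definition peval :: "complex poly \<Rightarrow> ratfun \<Rightarrow> ratfun" where
  "peval G h = poly (map_poly rat_const G) h"

lemma peval_pCons [simp]: "peval (pCons a G) h = rat_const a + h * peval G h"
  unfolding peval_def by (simp add: map_poly_pCons)

lemma peval_0 [simp]: "peval 0 h = 0"
  unfolding peval_def by simp

lemma peval_add: "peval (F + G) h = peval F h + peval G h"
proof (induction F arbitrary: G)
  case (pCons a F)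
  show ?case by (cases G) (simp, simp only: add_pCons peval_pCons pCons.IH rat_const_simps, simp add:
      algebra_simps)
qed simp

lemma peval_smult: "peval (smult c G) h = rat_const c * peval G h"
  by (induction G) (auto simp: algebra_simps)

lemma peval_mult: "peval (F * G) h = peval F h * peval G h"
  by (induction F) (auto simp: peval_add peval_smult algebra_simps)

lemma peval_1 [simp]: "peval 1 h = 1"
  by (simp add: one_pCons del: pCons_one)

lemma peval_power: "peval (F ^ n) h = peval F h ^ n"
  by (induction n) (auto simp: peval_mult)

lemma peval_sum: "peval (sum F S) h = (\<Sum>i\<in>S. peval (F i) h)"
  by (induction S rule: infinite_finite_induct) (auto simp: peval_add)

lemma peval_local:
  assumes "h \<in> local_ring p"
  shows "peval G h \<in> local_ring p \<and> rval p (peval G h) = poly G (rval p h)"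
  by (induction G) (auto simp: local_ring_add local_ring_mult assms)

text \<open>The cofactor of the power of \<open>X - a\<close> in \<open>G\<close> does not vanish at \<open>a\<close>, hence its value at
  \<open>h\<close> is a unit of the local ring.\<close>

lemma power_order_in_ideal:
  assumes "is_ideal p W" "h \<in> local_ring p" "G \<noteq> 0" "peval G h \<in> W"
  shows "(h - rat_const (rval p h)) ^ order (rval p h) G \<in> W"
proof -
  define a where "a = rval p h"
  obtain H where H: "G = [:-a, 1:] ^ order a G * H" "\<not> [:-a, 1:] dvd H"
    using order_decomp[OF assms(3)] by blast
  have "poly H a \<noteq> 0" using H(2) poly_eq_0_iff_dvd by blast
  moreover have "peval H h * (h - rat_const a) ^ order a G \<in> W"
  proof -
    have "peval G h = peval ([:-a, 1:] ^ order a G * H) h" using H(1) by simp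
    then show ?thesis using assms(4) by (simp add: peval_mult peval_power mult.commute)
  qed
  ultimately show ?thesis
    using is_ideal_unit[OF assms(1), of "peval H h"] peval_local[OF assms(2), of H]
        by (auto simp: a_def)
qed

text \<open>A linear relation between powers of a non-unit is a polynomial in it, that is, one of its
  powers times a unit. So the powers are independent modulo an ideal that contains none of
  them.\<close>

lemma power_in_ideal_of_finite_dim:
  assumes "quotient_has_dim (local_ring p) W m" "is_ideal p W" "h \<in> local_ring p" "rval p h = 0"
  shows "\<exists>k. h ^ k \<in> W"
proof (rule ccontr)
  assume none: "\<nexists>k. h ^ k \<in> W"
  have "Suc m \<le> m"
  proof (rule quotient_dim_ge[OF assms(1) is_ideal_csubspace[OF assms(2)] local_ring_01(1)])
    fix i show "h ^ i \<in> local_ring p" using local_ring_power assms by blast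
  next
    fix d i assume d: "(\<Sum>i<Suc m. rat_const (d i) * h ^ i) \<in> W" and i: "i < Suc m"
    define G where "G = (\<Sum>i<Suc m. monom (d i) i)"
    have "peval G h \<in> W" using d by (simp add: G_def peval_sum monom_altdef peval_smult peval_power
        peval_add)
    then have "G = 0" using power_order_in_ideal[OF assms(2,3), of G] none assms(4) by auto
    moreover have "coeff G i = d i" using i
      by (simp only: G_def coeff_sum coeff_monom) (simp add: sum.delta)
    ultimately show "d i = 0" by simp
  qed
  then show False by simp
qed

section \<open>Principal ideals have infinite codimension\<close>

lemma Fract_1_power: "Fract a 1 ^ n = Fract (a ^ n) (1 :: 'a :: idom)"
  by (induction n) (auto simp: One_fract_def)

text \<open>If the codimension were finite, powers of \<open>x - x\<^sub>0\<close> and of \<open>y - y\<^sub>0\<close> would be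
  multiples of \<open>h\<close>. Clearing denominators turns this into a question about the numerator \<open>r\<close> of
  \<open>h\<close> in the factorial ring \<open>\<complex>[x, y]\<close>: the first relation forces the prime \<open>x - x\<^sub>0\<close> to
  divide \<open>r\<close>, and the second one forbids it.\<close>

lemma principal_ideal_infinite_codim:
  assumes h: "h \<in> local_ring p" "rval p h = 0"
    and W: "is_ideal p W" "W \<subseteq> {h * u |u. u \<in> local_ring p}"
  shows "\<not> quotient_has_dim (local_ring p) W m"
proof
  assume dim: "quotient_has_dim (local_ring p) W m"
  obtain x y where p: "p = (x, y)" by (cases p)
  let ?P = "[:[:-x, 1:]:] :: complex poly poly" and ?Q = "[:-[:y:], 1:] :: complex poly poly"
  have e1: "rat_x - rat_const (fst p) = Fract ?P 1" unfolding rat_x_def rat_const_def p by simp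
  have e2: "rat_y - rat_const (snd p) = Fract ?Q 1" unfolding rat_y_def rat_const_def p by simp
  have loc: "Fract ?P 1 \<in> local_ring p" "rval p (Fract ?P 1) = 0"
     "Fract ?Q 1 \<in> local_ring p" "rval p (Fract ?Q 1) = 0"
    by (auto intro: local_ring_Fract simp: rval_Fract p)
  obtain r s where rs: "h = Fract r s" "poly2 s p \<noteq> 0" "s \<noteq> 0" "rval p h = poly2 r p / poly2 s p"
    using h local_ringE by metis
  then have r0: "poly2 r p = 0" using h by simp
  have clear: "\<exists>S T. poly2 S p \<noteq> 0 \<and> F ^ k * S = r * T" if "Fract F 1 ^ k \<in> W" for F k
  proof -
    have "Fract F 1 ^ k \<in> {h * u |u. u \<in> local_ring p}" using W(2) that by (rule subsetD)
    then obtain u where u: "u \<in> local_ring p" "Fract F 1 ^ k = h * u" by blast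
    obtain T S where TS: "u = Fract T S" "poly2 S p \<noteq> 0" "S \<noteq> 0" using u local_ringE by metis
    have "Fract (F ^ k) 1 = Fract (r * T) (s * S)" using u TS rs by (simp add: Fract_1_power)
    then have "F ^ k * (s * S) = r * T" using rs TS by (simp add: eq_fract)
    then show ?thesis using rs TS by (intro exI[of _ "s * S"] exI[of _ T]) simp
  qed
  obtain k l where "Fract ?P 1 ^ k \<in> W" "Fract ?Q 1 ^ l \<in> W"
    using power_in_ideal_of_finite_dim[OF dim W(1)] loc by blast
  then obtain S T S' T' where S: "poly2 S p \<noteq> 0" "?P ^ k * S = r * T"
    and S': "poly2 S' p \<noteq> 0" "?Q ^ l * S' = r * T'"
    using clear by blast
  have prime: "prime_elem ?P" by (simp add: prime_elem_const_poly_iff prime_elem_linear_field_poly)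
  have P0: "poly2 (?P * w) p = 0" for w unfolding poly2_simps(6) by (simp add: p)
  show False
  proof (cases "?P dvd r")
    case True
    then have "?P dvd ?Q ^ l * S'" unfolding S'(2) by (rule dvd_mult2)
    then consider "?P dvd ?Q" | "?P dvd S'"
      using prime prime_elem_dvd_multD prime_elem_dvd_power by blast
    then show False
    proof cases
      case 1
      then have "[:-x, 1:] dvd coeff ?Q 1" by (subst (asm) const_poly_dvd_iff) blast
      then have "is_unit [:-x, 1:]" by simp
      then show False by (simp add: is_unit_poly_iff)
    next
      case 2 then show False using S' P0 by (metis dvdE)
    qed
  next
    case False
    have "?P ^ k dvd T"
    proof (cases "k = 0")
      case pos: False
      have "?P ^ k dvd r * T" unfolding S(2)[symmetric] by simp
      then show ?thesis using prime_power_dvd_multD[OF prime] pos False by blast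
    qed simp
    then obtain T'' where "T = ?P ^ k * T''" by (rule dvdE)
    then have "?P ^ k * S = ?P ^ k * (r * T'')" using S by (simp add: mult_ac)
    then have "S = r * T''" by (subst (asm) mult_cancel_left) simp
    then show False using S r0 by simp
  qed
qed

section \<open>Bounding the dimension\<close>

text \<open>Families instead of sets of generators, because monomials in the local parameters with
  distinct exponents are not assumed to be distinct elements.\<close>

definition family_span :: "'i set \<Rightarrow> ('i \<Rightarrow> ratfun) \<Rightarrow> ratfun set \<Rightarrow> ratfun set" where
  "family_span I v W = {h. \<exists>c. h - (\<Sum>i\<in>I. rat_const (c i) * v i) \<in> W}"

lemma family_spanI: "h - (\<Sum>i\<in>I. rat_const (c i) * v i) \<in> W \<Longrightarrow> h \<in> family_span I v W"
  unfolding family_span_def mem_Collect_eq by (rule exI[of _ c])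

lemma family_spanE:
  assumes "h \<in> family_span I v W"
  obtains c where "h - (\<Sum>i\<in>I. rat_const (c i) * v i) \<in> W"
  using assms unfolding family_span_def mem_Collect_eq by (rule exE)

lemma family_span_subspace: "h \<in> W \<Longrightarrow> h \<in> family_span I v W"
  by (rule family_spanI[where c = "\<lambda>_. 0"]) simp

lemma family_span_member:
  assumes "csubspace W" "finite I" "i \<in> I"
  shows "v i \<in> family_span I v W"
proof (rule family_spanI[where c = "\<lambda>j. if j = i then 1 else 0"])
  have "(\<Sum>j\<in>I. rat_const (if j = i then 1 else 0) * v j) = (\<Sum>j\<in>I. if j = i then v j else 0)"
    by (intro sum.cong) auto
  also have "\<dots> = v i" using assms by simp
  finally show "v i - (\<Sum>j\<in>I. rat_const (if j = i then 1 else 0) * v j) \<in> W"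
    using csubspaceD(1)[OF assms(1)] by simp
qed

lemma family_span_add:
  assumes "csubspace W" "g \<in> family_span I v W" "h \<in> family_span I v W"
  shows "g + h \<in> family_span I v W"
proof -
  obtain c where c: "g - (\<Sum>i\<in>I. rat_const (c i) * v i) \<in> W" by (rule family_spanE[OF assms(2)])
  obtain d where d: "h - (\<Sum>i\<in>I. rat_const (d i) * v i) \<in> W" by (rule family_spanE[OF assms(3)])
  have "(\<Sum>i\<in>I. rat_const (c i + d i) * v i) = (\<Sum>i\<in>I. rat_const (c i) * v i)
      + (\<Sum>i\<in>I. rat_const (d i) * v i)"
    by (simp add: distrib_right sum.distrib)
  then have "g + h - (\<Sum>i\<in>I. rat_const (c i + d i) * v i) \<in> W"
    using csubspaceD(2)[OF assms(1) c d] by (simp add: algebra_simps)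
  then show ?thesis by (rule family_spanI)
qed

lemma family_span_scale:
  assumes "csubspace W" "g \<in> family_span I v W"
  shows "rat_const a * g \<in> family_span I v W"
proof -
  obtain c where c: "g - (\<Sum>i\<in>I. rat_const (c i) * v i) \<in> W" by (rule family_spanE[OF assms(2)])
  have "(\<Sum>i\<in>I. rat_const (a * c i) * v i) = rat_const a * (\<Sum>i\<in>I. rat_const (c i) * v i)"
    by (simp add: sum_distrib_left mult.assoc)
  then have "rat_const a * g - (\<Sum>i\<in>I. rat_const (a * c i) * v i) \<in> W"
    using csubspaceD(3)[OF assms(1) c, of a] by (simp add: right_diff_distrib)
  then show ?thesis by (rule family_spanI)
qed

lemma family_span_image:
  assumes "finite I" "h \<in> family_span I v W"
  shows "\<exists>c. h - (\<Sum>s\<in>v ` I. rat_const (c s) * s) \<in> W"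
proof -
  obtain c where c: "h - (\<Sum>i\<in>I. rat_const (c i) * v i) \<in> W" by (rule family_spanE[OF assms(2)])
  define c' where "c' = (\<lambda>s. \<Sum>i | i \<in> I \<and> v i = s. c i)"
  have "(\<Sum>i\<in>I. rat_const (c i) * v i) = (\<Sum>s\<in>v ` I. \<Sum>i | i \<in> I \<and> v i = s. rat_const (c i) * v i)"
    by (rule sum.image_gen[OF assms(1)])
  also have "\<dots> = (\<Sum>s\<in>v ` I. rat_const (c' s) * s)"
    unfolding c'_def rat_const_sum sum_distrib_right by (intro sum.cong refl) auto
  finally show ?thesis using c by (intro exI[of _ c']) simp
qed

text \<open>If the maximal ideal is generated by \<open>\<tau>\<close> modulo \<open>W\<close>, then the expansion of a function in
  powers of \<open>\<tau>\<close> can be stopped at a power that lies in \<open>W\<close>.\<close>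

lemma dim_le_of_curvilinear:
  assumes W: "is_ideal p W" and \<tau>: "\<tau> \<in> local_ring p" "\<tau> ^ r \<in> W"
    and gen: "\<And>h. h \<in> local_ring p \<Longrightarrow> rval p h = 0 \<Longrightarrow> \<exists>h1\<in>local_ring p. \<exists>w\<in>W. h = \<tau> * h1 + w"
    and dim: "quotient_has_dim (local_ring p) W m"
  shows "m \<le> r"
proof -
  let ?v = "\<lambda>i. \<tau> ^ i" and ?I = "{..<r}"
  note sub = is_ideal_csubspace[OF W]
  have *: "\<tau> ^ (r - k) * h \<in> family_span ?I ?v W" if "h \<in> local_ring p" "k \<le> r" for k h
    using that
  proof (induction k arbitrary: h)
    case 0
    then show ?case using is_idealD(4)[OF W _ \<tau>(2)] by (auto intro: family_span_subspace)
  next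
    case (Suc k)
    let ?i = "r - Suc k"
    define c where "c = rval p h"
    have "h - rat_const c \<in> local_ring p" "rval p (h - rat_const c) = 0"
      using Suc by (simp_all add: local_ring_diff c_def)
    from gen[OF this] obtain h1 w where h1: "h1 \<in> local_ring p" "w \<in> W" "h - rat_const c = \<tau> * h1 + w"
        by blast
    then have h: "h = rat_const c + \<tau> * h1 + w" by (simp add: algebra_simps)
    have "\<tau> * \<tau> ^ (r - Suc k) = \<tau> ^ (r - k)" using Suc.prems(2)
      by (simp flip: power_Suc add: Suc_diff_Suc)
    then have eq: "\<tau> ^ ?i * h = rat_const c * \<tau> ^ ?i + (\<tau> ^ (r - k) * h1 + \<tau> ^ ?i * w)"
      unfolding h by (simp add: algebra_simps)
    have "\<tau> ^ ?i \<in> family_span ?I ?v W" using Suc.prems(2) by (intro family_span_member sub) auto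
    moreover have "\<tau> ^ (r - k) * h1 \<in> family_span ?I ?v W" using Suc h1 by simp
    moreover have "\<tau> ^ ?i * w \<in> family_span ?I ?v W"
      using is_idealD(3)[OF W _ h1(2)] local_ring_power \<tau>(1) by (blast intro: family_span_subspace)
    ultimately show ?case unfolding eq by (intro family_span_add family_span_scale sub)
  qed
  have "h \<in> family_span ?I ?v W" if "h \<in> local_ring p" for h
    using *[OF that, of r] by simp
  then have "m \<le> card (?v ` ?I)"
    by (intro quotient_dim_le[OF dim sub] family_span_image) simp_all
  also have "\<dots> \<le> r" using card_image_le[of ?I ?v] by simp
  finally show ?thesis .
qed

text \<open>Expansion in powers of two local parameters, stopped as soon as one of the exponents
  reaches \<open>N\<close>.\<close>

lemma finite_dim_of_nilpotent_params:
  assumes W: "is_ideal p W" and st: "local_params p s t" and N: "s ^ N \<in> W" "t ^ N \<in> W"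
  shows "\<exists>m. quotient_has_dim (local_ring p) W m"
proof -
  let ?v = "\<lambda>(i, j). s ^ i * t ^ j" and ?I = "{..<N} \<times> {..<N}"
  note sub = is_ideal_csubspace[OF W]
  have st': "s \<in> local_ring p" "t \<in> local_ring p" using st by (simp_all add: local_params_def)
  have pow: "s ^ i * t ^ j \<in> local_ring p" for i j
    using st' local_ring_power local_ring_mult(1) by blast
  have big: "s ^ i * t ^ j \<in> W" if "i \<ge> N \<or> j \<ge> N" for i j
    using that
  proof
    assume "i \<ge> N"
    then have "s ^ i * t ^ j = (s ^ (i - N) * t ^ j) * s ^ N" by (simp add: mult_ac flip: power_add)
    then show ?thesis using is_idealD(3)[OF W pow N(1)] by metis
  next
    assume "j \<ge> N"
    then have "s ^ i * t ^ j = (s ^ i * t ^ (j - N)) * t ^ N" by (simp add: mult_ac flip: power_add)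
    then show ?thesis using is_idealD(3)[OF W pow N(2)] by metis
  qed
  have *: "s ^ i * t ^ j * h \<in> family_span ?I ?v W" if "h \<in> local_ring p" "2 * N \<le> i + j + n"
      for i j n h
    using that
  proof (induction n arbitrary: i j h)
    case 0
    then have "s ^ i * t ^ j \<in> W" by (intro big) auto
    then show ?case using is_idealD(4)[OF W] 0 by (blast intro: family_span_subspace)
  next
    case (Suc n)
    show ?case
    proof (cases "i \<ge> N \<or> j \<ge> N")
      case True
      then show ?thesis using is_idealD(4)[OF W _ big] Suc by (blast intro: family_span_subspace)
    next
      case False
      define c where "c = rval p h"
      have "h - rat_const c \<in> local_ring p" "rval p (h - rat_const c) = 0"
        using Suc by (simp_all add: local_ring_diff c_def)
      then obtain h1 h2 where h12: "h1 \<in> local_ring p" "h2 \<in> local_ring p"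
          "h - rat_const c = s * h1 + t * h2"
        using st unfolding local_params_def by blast
      then have h: "h = rat_const c + s * h1 + t * h2" by (simp add: algebra_simps)
      have eq: "s ^ i * t ^ j * h = rat_const c * (s ^ i * t ^ j) + (s ^ Suc i * t ^ j * h1
          + s ^ i * t ^ Suc j * h2)"
        unfolding h by (simp add: algebra_simps)
      have "s ^ i * t ^ j \<in> family_span ?I ?v W"
        using family_span_member[OF sub, of ?I "(i, j)" ?v] False by simp
      moreover have "s ^ Suc i * t ^ j * h1 \<in> family_span ?I ?v W"
          "s ^ i * t ^ Suc j * h2 \<in> family_span ?I ?v W"
        using Suc.prems by (auto intro!: Suc.IH h12 simp del: power_Suc)
      ultimately show ?thesis unfolding eq by (intro family_span_add family_span_scale sub)
    qed
  qed
  have "h \<in> family_span ?I ?v W" if "h \<in> local_ring p" for h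
    using *[OF that, of 0 0 "2 * N"] by simp
  then have "\<exists>c. h - (\<Sum>s\<in>?v ` ?I. rat_const (c s) * s) \<in> W" if "h \<in> local_ring p" for h
    using that by (intro family_span_image) simp_all
  moreover have "finite (?v ` ?I)" "?v ` ?I \<subseteq> local_ring p" using pow by auto
  ultimately show ?thesis by (intro quotient_dim_exists[OF sub local_ring_01(1), of "?v ` ?I"])
qed

section \<open>Values near the point\<close>

text \<open>The denominator of \<open>h\<close> does not vanish near \<open>p\<close>, so that one representation serves all
  points of a neighbourhood.\<close>

lemma local_ring_nbhd:
  assumes "h \<in> local_ring p"
  obtains U where "open U" "p \<in> U" "\<And>q. q \<in> U \<Longrightarrow> h \<in> local_ring q" "continuous_on U (\<lambda>q. rval q h)"
proof -
  obtain r s where rs: "h = Fract r s" "poly2 s p \<noteq> 0" using assms local_ringE by metis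
  let ?U = "{q. poly2 s q \<noteq> 0}"
  have U: "?U = UNIV - poly2 s -` {0}" by auto
  have "open ?U" unfolding U using continuous_closed_vimage[of "{0}" "poly2 s"] continuous_poly2[of s]
    by (auto simp: continuous_on_eq_continuous_at intro!: open_Diff)
  moreover have "continuous_on ?U (\<lambda>q. poly2 r q / poly2 s q)"
    by (intro continuous_intros continuous_on_subset[OF continuous_poly2]) auto
  then have "continuous_on ?U (\<lambda>q. rval q h)"
    by (rule continuous_on_eq) (simp add: rs rval_Fract)
  ultimately show ?thesis using rs that[of ?U] local_ring_Fract by blast
qed

lemma local_ring_ev_near:
  assumes "h \<in> local_ring p"
  shows "eventually (\<lambda>q. h \<in> local_ring q) (nhds p)" "((\<lambda>q. rval q h) \<longlongrightarrow> rval p h) (nhds p)"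
proof -
  obtain U where U: "open U" "p \<in> U" "\<And>q. q \<in> U \<Longrightarrow> h \<in> local_ring q" "continuous_on U (\<lambda>q. rval q h)"
    using local_ring_nbhd[OF assms] by blast
  show "eventually (\<lambda>q. h \<in> local_ring q) (nhds p)" using U eventually_nhds by blast
  have "isCont (\<lambda>q. rval q h) p" using U continuous_on_eq_continuous_at by blast
  then show "((\<lambda>q. rval q h) \<longlongrightarrow> rval p h) (nhds p)"
    by (simp add: isCont_def tendsto_nhds_iff)
qed

text \<open>In the binomial expansion of \<open>(s h\<^sub>1 + t h\<^sub>2)\<close> to the power \<open>2 N\<close>, each term contains
  one of the two parameters to a power of at least \<open>N\<close>.\<close>

lemma nilpotent_of_params:
  assumes W: "is_ideal p W" and st: "local_params p s t" and N: "s ^ N \<in> W" "t ^ N \<in> W"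
    and a: "a \<in> local_ring p" "rval p a = 0"
  shows "a ^ (2 * N) \<in> W"
proof -
  obtain h1 h2 where h: "h1 \<in> local_ring p" "h2 \<in> local_ring p" "a = s * h1 + t * h2"
    using st a unfolding local_params_def by blast
  have loc: "s \<in> local_ring p" "t \<in> local_ring p" using st by (simp_all add: local_params_def)
  have "of_nat (2 * N choose k) * (s * h1) ^ k * (t * h2) ^ (2 * N - k) \<in> W" for k
  proof -
    have c: "of_nat n \<in> local_ring p" for n by (induction n) (auto simp: local_ring_add)
    show ?thesis
    proof (cases "N \<le> k")
      case True
      then have "s ^ k = s ^ (k - N) * s ^ N" by (simp flip: power_add)
      then have "of_nat (2 * N choose k) * (s * h1) ^ k * (t * h2) ^ (2 * N - k)
        = (of_nat (2 * N choose k) * s ^ (k - N) * h1 ^ k * (t * h2) ^ (2 * N - k)) * s ^ N"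
        by (simp only: power_mult_distrib mult_ac)
      moreover have "of_nat (2 * N choose k) * s ^ (k - N) * h1 ^ k * (t * h2) ^ (2 * N - k)
          \<in> local_ring p"
        by (intro local_ring_intros c loc h)
      ultimately show ?thesis using is_idealD(3)[OF W _ N(1)] by metis
    next
      case False
      then have "2 * N - k = (N - k) + N" by simp
      then have "t ^ (2 * N - k) = t ^ (N - k) * t ^ N" by (simp only: power_add)
      then have "of_nat (2 * N choose k) * (s * h1) ^ k * (t * h2) ^ (2 * N - k)
        = (of_nat (2 * N choose k) * (s * h1) ^ k * t ^ (N - k) * h2 ^ (2 * N - k)) * t ^ N"
        by (simp only: power_mult_distrib mult_ac)
      moreover have "of_nat (2 * N choose k) * (s * h1) ^ k * t ^ (N - k) * h2 ^ (2 * N - k)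
          \<in> local_ring p"
        by (intro local_ring_intros c loc h)
      ultimately show ?thesis using is_idealD(3)[OF W _ N(2)] by metis
    qed
  qed
  then show ?thesis unfolding h(3) binomial_ring by (intro is_ideal_sum[OF W])
qed

lemma open_torus: "open torus"
  unfolding torus_def by (intro open_Times open_delete) auto

text \<open>The coefficients of a member of the ideal of \<open>f\<close> and \<open>g\<close> at \<open>p\<close> are regular near \<open>p\<close> as
  well, so it vanishes at every solution near \<open>p\<close>.\<close>

lemma local_ideal_vanish:
  assumes "w \<in> local_ideal p f g" "p \<in> torus"
  shows "eventually (\<lambda>q. w \<in> local_ring q \<and> (q \<in> solutions f g \<longrightarrow> rval q w = 0)) (nhds p)"
proof -
  obtain u v where uv: "w = u * laurent_ratfun f + v * laurent_ratfun g" "u \<in> local_ring p"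
      "v \<in> local_ring p"
    using assms unfolding local_ideal_def by blast
  have "eventually (\<lambda>q. q \<in> torus) (nhds p)" using open_torus assms eventually_nhds by blast
  with local_ring_ev_near(1)[OF uv(2)] local_ring_ev_near(1)[OF uv(3)] show ?thesis
  proof eventually_elim
    case (elim q)
    then show ?case unfolding uv(1) solutions_def
      by (simp add: local_ring_add local_ring_mult laurent_local)
  qed
qed

text \<open>Powers of \<open>x - x\<^sub>0\<close> and \<open>y - y\<^sub>0\<close> lie in the ideal, and they vanish at all solutions
  near \<open>p\<close>.\<close>

lemma isolated_of_nilpotent_params:
  assumes p: "p \<in> solutions f g" and st: "local_params p s t"
    and N: "s ^ N \<in> local_ideal p f g" "t ^ N \<in> local_ideal p f g"
  shows "p isolated_in solutions f g"
proof -
  let ?W = "local_ideal p f g"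
  have pt: "p \<in> torus" using p by (simp add: solutions_def)
  let ?s = "rat_x - rat_const (fst p)" and ?t = "rat_y - rat_const (snd p)"
  note nil = nilpotent_of_params[OF is_ideal_local_ideal st N]
  have "?s ^ (2 * N) \<in> ?W" "?t ^ (2 * N) \<in> ?W" by (intro nil; simp add: local_ring_diff)+
  from local_ideal_vanish[OF this(1) pt] local_ideal_vanish[OF this(2) pt]
  have "eventually (\<lambda>q. q \<in> solutions f g \<longrightarrow> q = p) (nhds p)"
  proof eventually_elim
    case (elim q)
    show ?case
    proof
      assume "q \<in> solutions f g"
      then have "rval q (?s ^ (2 * N)) = 0" "rval q (?t ^ (2 * N)) = 0" using elim by auto
      then have "fst q - fst p = 0" "snd q - snd p = 0"
        by (auto simp: local_ring_power[THEN conjunct2] local_ring_diff)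
      then show "q = p" by (simp add: prod_eq_iff)
    qed
  qed
  then obtain T where "open T" "p \<in> T" "\<forall>q\<in>T. q \<in> solutions f g \<longrightarrow> q = p"
    unfolding eventually_nhds by blast
  then show ?thesis unfolding isolated_in_def using p by blast
qed

text \<open>Functions that vanish to distinct orders along an arc, all of them smaller than the orders
  of \<open>f\<close> and \<open>g\<close>, are independent modulo the ideal of \<open>f\<close> and \<open>g\<close>.\<close>

lemma has_root_by_arc:
  fixes q :: "complex \<Rightarrow> complex \<times> complex" and h :: "nat \<Rightarrow> ratfun"
  assumes f: "f \<in> laurent_space A" and g: "g \<in> laurent_space B"
    and p: "p \<in> solutions f g" and st: "local_params p s t"
    and N: "s ^ N \<in> local_ideal p f g" "t ^ N \<in> local_ideal p f g"
    and q: "(q \<longlongrightarrow> p) (at 0)"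
    and fO: "(\<lambda>z. laurent_eval f (q z)) \<in> O[at 0](\<lambda>z. z ^ k)"
    and gO: "(\<lambda>z. laurent_eval g (q z)) \<in> O[at 0](\<lambda>z. z ^ k)"
    and h: "\<And>i. i < 3 \<Longrightarrow> h i \<in> local_ring p"
    and H: "\<And>i. i < 3 \<Longrightarrow> eventually (\<lambda>z. rval (q z) (h i) = H i z) (at 0)"
    and indep: "\<And>d i. (\<lambda>z. \<Sum>i<3. d i * H i z) \<in> O[at 0](\<lambda>z. z ^ k) \<Longrightarrow> i < 3 \<Longrightarrow> d i = 0"
  shows "has_root_of_high_multiplicity A B"
proof -
  let ?W = "local_ideal p f g"
  have pt: "p \<in> torus" using p by (simp add: solutions_def)
  obtain m where m: "quotient_has_dim (local_ring p) ?W m"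
    using finite_dim_of_nilpotent_params[OF is_ideal_local_ideal st N] by blast
  have near: "eventually (\<lambda>z. P (q z)) (at 0)" if "eventually P (nhds p)" for P
    using q that unfolding filterlim_iff by blast
  have "3 \<le> m"
  proof (rule quotient_dim_ge[OF m is_ideal_csubspace[OF is_ideal_local_ideal] local_ring_01(1) h])
    fix d i assume W: "(\<Sum>i<3. rat_const (d i) * h i) \<in> ?W" and i: "i < (3::nat)"
    obtain u v where uv: "(\<Sum>i<3. rat_const (d i) * h i) = u * laurent_ratfun f + v * laurent_ratfun g"
      "u \<in> local_ring p" "v \<in> local_ring p"
      using W unfolding local_ideal_def by blast
    have "eventually (\<lambda>q. \<forall>i\<in>{..<3}. h i \<in> local_ring q) (nhds p)"
      using h by (intro eventually_ball_finite) (auto intro: local_ring_ev_near(1))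
    note h' = near[OF this]
    have H': "eventually (\<lambda>z. \<forall>i\<in>{..<3}. rval (q z) (h i) = H i z) (at 0)"
      using H by (intro eventually_ball_finite) auto
    have "eventually (\<lambda>q. q \<in> torus) (nhds p)" using open_torus pt eventually_nhds by blast
    from h' H' near[OF this] near[OF local_ring_ev_near(1)[OF uv(2)]] near[OF local_ring_ev_near(1)[OF
        uv(3)]]
    have ev: "eventually (\<lambda>z. rval (q z) u * laurent_eval f (q z) + rval (q z) v * laurent_eval g (q z)
       = (\<Sum>i<3. d i * H i z)) (at 0)"
    proof eventually_elim
      case (elim z)
      have "rval (q z) (\<Sum>i<3. rat_const (d i) * h i) = (\<Sum>i<3. rval (q z) (rat_const (d i) * h i))"
        using elim(1) by (intro local_ring_sum[THEN conjunct2] local_ring_mult(1)) auto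
      also have "\<dots> = (\<Sum>i<3. d i * H i z)"
        using elim(1,2) by (intro sum.cong) (auto simp: local_ring_mult)
      finally show ?case unfolding uv(1) using elim
        by (simp add: local_ring_add local_ring_mult laurent_local)
    qed
    have bdd: "(\<lambda>z. rval (q z) u) \<in> O[at 0](\<lambda>_. 1)" if "u \<in> local_ring p" for u
      using filterlim_compose[OF local_ring_ev_near(2)[OF that] q]
      by (intro bigoI_tendsto[where c = "rval p u"]) auto
    have "(\<lambda>z. rval (q z) u * laurent_eval f (q z) + rval (q z) v * laurent_eval g (q z))
        \<in> O[at 0](\<lambda>z. z ^ k)"
      using landau_o.big.mult[OF bdd[OF uv(2)] fO] landau_o.big.mult[OF bdd[OF uv(3)] gO]
      by (intro sum_in_bigo) simp_all
    then have "(\<lambda>z. \<Sum>i<3. d i * H i z) \<in> O[at 0](\<lambda>z. z ^ k)"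
      using landau_o.big.in_cong[OF ev] by blast
    then show "d i = 0" using indep i by blast
  qed
  then show ?thesis
    unfolding has_root_of_high_multiplicity_def root_of_multiplicity_def
    using f g m isolated_of_nilpotent_params[OF p st N]
        by (intro bexI[of _ f] bexI[of _ g] exI[of _ p] exI[of _ m]) auto
qed

section \<open>Lattice frames\<close>

text \<open>The lattice point with coordinates \<open>x\<close> in the frame with origin \<open>u\<close> and basis \<open>(e, e')\<close>.\<close>

definition aff :: "int \<times> int \<Rightarrow> int \<times> int \<Rightarrow> int \<times> int \<Rightarrow> int \<times> int \<Rightarrow> int \<times> int" where
  "aff e e' u x = (fst u + fst x * fst e + snd x * fst e', snd u + fst x * snd e + snd x * snd e')"

definition cross :: "int \<times> int \<Rightarrow> int \<times> int \<Rightarrow> int" where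
  "cross v w = fst v * snd w - snd v * fst w"

definition unimodular :: "int \<times> int \<Rightarrow> int \<times> int \<Rightarrow> bool" where
  "unimodular e e' \<longleftrightarrow> cross e e' = 1 \<or> cross e e' = -1"

lemma inj_aff:
  assumes "unimodular e e'"
  shows "inj (aff e e' u)"
proof (rule injI)
  fix x y assume eq: "aff e e' u x = aff e e' u y"
  let ?i = "fst x - fst y" and ?j = "snd x - snd y"
  have e1: "?i * fst e + ?j * fst e' = 0" and e2: "?i * snd e + ?j * snd e' = 0"
    using eq unfolding aff_def prod_eq_iff by (auto simp: algebra_simps)
  have "?i * cross e e' = (?i * fst e + ?j * fst e') * snd e' - (?i * snd e + ?j * snd e') * fst e'"
    by (simp add: cross_def algebra_simps)
  then have i: "?i * cross e e' = 0" using e1 e2 by simp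
  have "?j * cross e e' = (?i * snd e + ?j * snd e') * fst e - (?i * fst e + ?j * fst e') * snd e"
    by (simp add: cross_def algebra_simps)
  then have j: "?j * cross e e' = 0" using e1 e2 by simp
  have "cross e e' \<noteq> 0" using assms by (auto simp: unimodular_def)
  then show "x = y" using i j by (simp add: prod_eq_iff)
qed

text \<open>The exponents that express the coordinates \<open>x\<close> and \<open>y\<close> as monomials in the coordinates of
  the frame.\<close>

definition dual_basis :: "int \<times> int \<Rightarrow> int \<times> int \<Rightarrow> (int \<times> int) \<times> (int \<times> int)" where
  "dual_basis e e' = ((cross e e' * snd e', - cross e e' * snd e), (- cross e e' * fst e', cross e e' *
      fst e))"

lemma dual_basis_props:
  assumes "unimodular e e'" "dual_basis e e' = ((\<alpha>, \<beta>), (\<gamma>, \<delta>))"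
  shows "fst e * \<alpha> + fst e' * \<beta> = 1" "snd e * \<alpha> + snd e' * \<beta> = 0"
    "fst e * \<gamma> + fst e' * \<delta> = 0" "snd e * \<gamma> + snd e' * \<delta> = 1"
    "\<alpha> * fst e + \<gamma> * snd e = 1" "\<beta> * fst e + \<delta> * snd e = 0"
    "\<alpha> * fst e' + \<gamma> * snd e' = 0" "\<beta> * fst e' + \<delta> * snd e' = 1"
proof -
  have sq: "cross e e' * cross e e' = 1" using assms(1) by (auto simp: unimodular_def)
  have d: "\<alpha> = cross e e' * snd e'" "\<beta> = - cross e e' * snd e" "\<gamma> = - cross e e' * fst e'"
      "\<delta> = cross e e' * fst e"
    using assms(2) by (auto simp: dual_basis_def)
  have "fst e * \<alpha> + fst e' * \<beta> = cross e e' * cross e e'"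
      "snd e * \<gamma> + snd e' * \<delta> = cross e e' * cross e e'"
     "\<alpha> * fst e + \<gamma> * snd e = cross e e' * cross e e'"
         "\<beta> * fst e' + \<delta> * snd e' = cross e e' * cross e e'"
    unfolding d by (simp_all add: cross_def algebra_simps)
  then show "fst e * \<alpha> + fst e' * \<beta> = 1" "snd e * \<gamma> + snd e' * \<delta> = 1"
     "\<alpha> * fst e + \<gamma> * snd e = 1" "\<beta> * fst e' + \<delta> * snd e' = 1"
    unfolding sq .
  show "snd e * \<alpha> + snd e' * \<beta> = 0" "fst e * \<gamma> + fst e' * \<delta> = 0"
    "\<beta> * fst e + \<delta> * snd e = 0" "\<alpha> * fst e' + \<gamma> * snd e' = 0"
    unfolding d by (simp_all add: algebra_simps)
qed

lemma two_powers:
  fixes X Y :: "'a :: field"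
  assumes "X \<noteq> 0" "Y \<noteq> 0"
  shows "(X powi a * Y powi b) powi m * (X powi c * Y powi d) powi n = X powi (a * m
      + c * n) * Y powi (b * m + d * n)"
  using assms by (simp add: power_int_add power_int_mult power_int_mult_distrib)

lemma lmon_aff: "lmon (aff e e' u x) = lmon u * (lmon e powi fst x * lmon e' powi snd x)"
proof -
  have "lmon e powi fst x * lmon e' powi snd x =
     rat_x powi (fst e * fst x + fst e' * snd x) * rat_y powi (snd e * fst x + snd e' * snd x)"
    unfolding lmon_def by (rule two_powers) auto
  then show ?thesis unfolding lmon_def aff_def by (simp add: power_int_add mult_ac)
qed

lemma lmonv_aff:
  assumes "q \<in> torus"
  shows "lmonv q (aff e e' u x) = lmonv q u * (lmonv q e powi fst x * lmonv q e' powi snd x)"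
proof -
  have nz: "fst q \<noteq> 0" "snd q \<noteq> 0" using assms unfolding torus_def by auto
  then have "lmonv q e powi fst x * lmonv q e' powi snd x =
     fst q powi (fst e * fst x + fst e' * snd x) * snd q powi (snd e * fst x + snd e' * snd x)"
    unfolding lmonv_def by (rule two_powers)
  then show ?thesis unfolding lmonv_def aff_def using nz by (simp add: power_int_add mult_ac)
qed

lemma frame_coords:
  assumes "unimodular e e'" "dual_basis e e' = ((\<alpha>, \<beta>), (\<gamma>, \<delta>))"
  shows "rat_x = lmon e powi \<alpha> * lmon e' powi \<beta>" "rat_y = lmon e powi \<gamma> * lmon e' powi \<delta>"
  using lmon_aff[of e e' 0 "(\<alpha>, \<beta>)"] lmon_aff[of e e' 0 "(\<gamma>, \<delta>)"] dual_basis_props(1-4)[OF assms]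
  by (simp_all add: aff_def lmon_def mult.commute)

text \<open>For positive exponents \<open>u - u\<^sub>0\<close> divides \<open>u\<^sup>j - u\<^sub>0\<^sup>j\<close>, and negative exponents reduce
  to positive ones as \<open>u\<close> is a unit.\<close>

lemma unit_power_int_diff:
  assumes "u \<in> local_ring p" "rval p u \<noteq> 0"
  shows "\<exists>k\<in>local_ring p. u powi n - rat_const (rval p u powi n) = (u - rat_const (rval p u)) * k"
proof -
  define u0 where "u0 = rat_const (rval p u)"
  have u0: "u0 \<in> local_ring p" "rval p u0 = rval p u" by (simp_all add: u0_def)
  have cp: "rat_const (rval p u powi n) = u0 powi n" for n
    by (simp add: power_int_def u0_def rat_const_power rat_const_inverse)
  have nat: "\<exists>k\<in>local_ring p. u ^ j - u0 ^ j = (u - u0) * k" for j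
  proof (induction j)
    case (Suc j)
    then obtain k where k: "k \<in> local_ring p" "u ^ j - u0 ^ j = (u - u0) * k" by blast
    have "u ^ Suc j - u0 ^ Suc j = u * (u ^ j - u0 ^ j) + (u - u0) * u0 ^ j"
        by (simp add: algebra_simps)
    also have "\<dots> = (u - u0) * (u * k + u0 ^ j)" unfolding k(2) by (simp add: algebra_simps)
    finally show ?case
      by (rule bexI) (intro local_ring_intros assms u0 k)
  qed (auto intro: bexI[of _ 0])
  show ?thesis
  proof (cases "n \<ge> 0")
    case True
    then show ?thesis using nat[of "nat n"] unfolding cp unfolding u0_def[symmetric]
        by (simp add: power_int_def)
  next
    case False
    define j where "j = nat (- n)"
    obtain k where k: "k \<in> local_ring p" "u ^ j - u0 ^ j = (u - u0) * k" using nat by blast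
    have inv: "inverse u \<in> local_ring p" "inverse u0 \<in> local_ring p" "u \<noteq> 0" "u0 \<noteq> 0"
      using local_ring_inverse[OF assms] local_ring_inverse[OF u0(1)] u0(2) assms(2) by auto
    have "u powi n - u0 powi n = inverse u ^ j - inverse u0 ^ j"
      using False by (simp add: power_int_def j_def power_inverse)
    also have "\<dots> = (u - u0) * (- k * inverse u ^ j * inverse u0 ^ j)"
    proof -
      have "(u - u0) * (- k * inverse u ^ j * inverse u0 ^ j)
          = - (u ^ j - u0 ^ j) * inverse u ^ j * inverse u0 ^ j"
        unfolding k(2) by (simp add: mult_ac)
      also have "\<dots> = inverse u ^ j - inverse u0 ^ j" using inv
        by (simp add: field_simps)
      finally show ?thesis by simp
    qed
    finally show ?thesis unfolding cp unfolding u0_def[symmetric]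
      by (intro bexI[of _ "- k * inverse u ^ j * inverse u0 ^ j"]) (auto intro!: local_ring_intros inv
          k)
  qed
qed

lemma is_ideal_two_gens:
  assumes "s \<in> local_ring p" "t \<in> local_ring p"
  shows "is_ideal p {s * h1 + t * h2 |h1 h2. h1 \<in> local_ring p \<and> h2 \<in> local_ring p}"
      (is "is_ideal p ?J")
  unfolding is_ideal_def
proof (intro conjI ballI)
  show "0 \<in> ?J" unfolding mem_Collect_eq by (rule exI[of _ 0], rule exI[of _ 0]) simp
next
  fix a b assume "a \<in> ?J" "b \<in> ?J"
  then obtain u v u' v' where "a = s * u + t * v" "b = s * u' + t * v'"
    "u \<in> local_ring p" "v \<in> local_ring p" "u' \<in> local_ring p" "v' \<in> local_ring p" by blast
  then show "a + b \<in> ?J" unfolding mem_Collect_eq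
    by (intro exI[of _ "u + u'"] exI[of _ "v + v'"]) (simp add: local_ring_add algebra_simps)
next
  fix h a assume h: "h \<in> local_ring p" and "a \<in> ?J"
  then obtain u v where "a = s * u + t * v" "u \<in> local_ring p" "v \<in> local_ring p" by blast
  then show "h * a \<in> ?J" unfolding mem_Collect_eq using h
    by (intro exI[of _ "h * u"] exI[of _ "h * v"]) (simp add: local_ring_mult algebra_simps)
qed

text \<open>The coordinates \<open>x\<close> and \<open>y\<close> are Laurent monomials in the two monomials of a unimodular
  frame. Hence \<open>x - x\<^sub>0\<close> and \<open>y - y\<^sub>0\<close> lie in the ideal that the frame generates.\<close>

lemma local_params_frame:
  assumes uni: "unimodular e e'" and p: "p \<in> torus"
  shows "local_params p (lmon e - rat_const (lmonv p e)) (lmon e' - rat_const (lmonv p e'))"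
proof -
  obtain \<alpha> \<beta> \<gamma> \<delta> where db: "dual_basis e e' = ((\<alpha>, \<beta>), (\<gamma>, \<delta>))" by (metis surj_pair)
  define X where "X = lmon e" define Y where "Y = lmon e'"
  define s where "s = X - rat_const (rval p X)" define t where "t = Y - rat_const (rval p Y)"
  have X: "X \<in> local_ring p" "rval p X \<noteq> 0" and Y: "Y \<in> local_ring p" "rval p Y \<noteq> 0"
    using lmon_local[OF p] by (simp_all add: X_def Y_def)
  have st: "s \<in> local_ring p" "t \<in> local_ring p" "rval p s = 0" "rval p t = 0"
    using X Y by (simp_all add: s_def t_def local_ring_diff)
  let ?J = "{s * h1 + t * h2 |h1 h2. h1 \<in> local_ring p \<and> h2 \<in> local_ring p}"
  note J = is_ideal_two_gens[OF st(1,2)]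
  have mem: "X powi i * Y powi j - rat_const (rval p (X powi i * Y powi j)) \<in> ?J" for i j
  proof -
    obtain k where k: "k \<in> local_ring p" "X powi i - rat_const (rval p X powi i) = s * k"
      using unit_power_int_diff[OF X] unfolding s_def by blast
    obtain l where l: "l \<in> local_ring p" "Y powi j - rat_const (rval p Y powi j) = t * l"
      using unit_power_int_diff[OF Y] unfolding t_def by blast
    have "X powi i * Y powi j - rat_const (rval p X powi i * rval p Y powi j)
       = (X powi i - rat_const (rval p X powi i)) * Y powi j
           + rat_const (rval p X powi i) * (Y powi j - rat_const (rval p Y powi j))"
      by (simp add: algebra_simps)
    also have "\<dots> = s * (k * Y powi j) + t * (rat_const (rval p X powi i) * l)"
      unfolding k l by (simp add: mult_ac)
    finally have *: "X powi i * Y powi j - rat_const (rval p X powi i * rval p Y powi j) = \<dots>" .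
    have "rval p (X powi i * Y powi j) = rval p X powi i * rval p Y powi j"
      using local_ring_powi X Y local_ring_mult by metis
    moreover have "k * Y powi j \<in> local_ring p" "rat_const (rval p X powi i) * l \<in> local_ring p"
      using k l local_ring_powi[OF Y] by (simp_all add: local_ring_mult)
    ultimately show ?thesis using * by auto
  qed
  have "rat_x - rat_const (fst p) \<in> ?J" "rat_y - rat_const (snd p) \<in> ?J"
    using mem[of \<alpha> \<beta>] mem[of \<gamma> \<delta>] unfolding X_def Y_def frame_coords[OF uni db, symmetric] by simp_all
  note xy = this
  have "h \<in> ?J" if hh: "h \<in> local_ring p" "rval p h = 0" for h
  proof -
    obtain h1 h2 where h: "h1 \<in> local_ring p" "h2 \<in> local_ring p"
      "h = (rat_x - rat_const (fst p)) * h1 + (rat_y - rat_const (snd p)) * h2"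
      using local_ring_max_ideal[OF hh] by blast
    show ?thesis unfolding h(3) by (rule is_idealD(2)[OF J is_idealD(4)[OF J h(1) xy(1)] is_idealD(4)[OF
        J h(2) xy(2)]])
  qed
  then have "local_params p s t" unfolding local_params_def using st by blast
  then show ?thesis using lmon_local(2)[OF p] unfolding s_def t_def X_def Y_def by simp
qed

text \<open>A Laurent polynomial in two monomials \<open>X\<close> and \<open>Y\<close> of a frame, as a rational function; the
  companion \<open>lpolyv\<close> is its value.\<close>

definition lpoly :: "(int \<times> int \<Rightarrow> complex) \<Rightarrow> (int \<times> int) set \<Rightarrow> ratfun \<Rightarrow> ratfun \<Rightarrow> ratfun" where
  "lpoly C A X Y = (\<Sum>x\<in>A. rat_const (C x) * (X powi fst x * Y powi snd x))"

definition lpolyv :: "(int \<times> int \<Rightarrow> complex) \<Rightarrow> (int \<times> int) set \<Rightarrow> complex \<Rightarrow> complex \<Rightarrow> complex" where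
  "lpolyv C A X Y = (\<Sum>x\<in>A. C x * (X powi fst x * Y powi snd x))"

lemma frame_laurent:
  assumes "finite A" "unimodular e e'" "f \<in> laurent_space (aff e e' u ` A)"
    "\<forall>x\<in>A. Poly_Mapping.lookup f (aff e e' u x) = C x"
  shows "laurent_ratfun f = lmon u * lpoly C A (lmon e) (lmon e')"
    "q \<in> torus \<Longrightarrow> laurent_eval f q = lmonv q u * lpolyv C A (lmonv q e) (lmonv q e')"
proof -
  have inj: "inj_on (aff e e' u) A" using inj_aff[OF assms(2)] inj_on_subset by blast
  have fin: "finite (aff e e' u ` A)" using assms by simp
  show "laurent_ratfun f = lmon u * lpoly C A (lmon e) (lmon e')"
    unfolding laurent_sums(1)[OF fin assms(3)] lpoly_def sum.reindex[OF inj] sum_distrib_left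
    by (intro sum.cong) (auto simp: assms(4) lmon_aff mult_ac)
  show "laurent_eval f q = lmonv q u * lpolyv C A (lmonv q e) (lmonv q e')" if "q \<in> torus"
    unfolding laurent_sums(2)[OF fin assms(3)] lpolyv_def sum.reindex[OF inj] sum_distrib_left
    by (intro sum.cong) (auto simp: assms(4) lmonv_aff[OF that] mult_ac)
qed

section \<open>Pairs that are bad in every frame\<close>

text \<open>Quantification over all frames makes this property invariant under monomial changes and
  translations by composition of frames, without transporting local rings along automorphisms of
  \<open>\<complex>(x, y)\<close>.\<close>

definition bad :: "(int \<times> int) set \<Rightarrow> (int \<times> int) set \<Rightarrow> bool" where
  "bad A B \<longleftrightarrow> (\<forall>e e' u v. unimodular e e' \<longrightarrow>
     has_root_of_high_multiplicity (aff e e' u ` A) (aff e e' v ` B))"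

text \<open>The root is \<open>(1, 1)\<close>. The hypothesis on powers of \<open>X - 1\<close> and \<open>Y - 1\<close> makes it
  isolated and of finite multiplicity; the three monomials in \<open>X - 1\<close> and \<open>Y - 1\<close>, whose
  combinations vanish along the arc to a lower order than \<open>f\<close> and \<open>g\<close>, make the multiplicity at
  least 3.\<close>

lemma bad_by_arc:
  fixes \<xi> \<eta> :: "complex \<Rightarrow> complex" and \<alpha> \<beta> :: "nat \<Rightarrow> nat"
  assumes fin: "finite A" "finite B"
    and arc: "(\<xi> \<longlongrightarrow> 1) (at 0)" "(\<eta> \<longlongrightarrow> 1) (at 0)"
    and zero: "lpolyv C A 1 1 = 0" "lpolyv D B 1 1 = 0"
    and fO: "(\<lambda>z. lpolyv C A (\<xi> z) (\<eta> z)) \<in> O[at 0](\<lambda>z. z ^ k)"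
    and gO: "(\<lambda>z. lpolyv D B (\<xi> z) (\<eta> z)) \<in> O[at 0](\<lambda>z. z ^ k)"
    and nil: "\<And>p W X Y. is_ideal p W \<Longrightarrow> X \<in> local_ring p \<Longrightarrow> Y \<in> local_ring p \<Longrightarrow> rval p X = 1 \<Longrightarrow> rval p Y = 1
        \<Longrightarrow>
       lpoly C A X Y \<in> W \<Longrightarrow> lpoly D B X Y \<in> W \<Longrightarrow> \<exists>N. (X - 1) ^ N \<in> W \<and> (Y - 1) ^ N \<in> W"
    and indep: "\<And>d i. (\<lambda>z. \<Sum>i<3. d i * ((\<xi> z - 1) ^ \<alpha> i * (\<eta> z - 1) ^ \<beta> i)) \<in> O[at 0](\<lambda>z. z ^ k) \<Longrightarrow> i < 3
        \<Longrightarrow> d i = 0"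
  shows "bad A B"
  unfolding bad_def
proof (intro allI impI)
  fix e e' u v assume uni: "unimodular e e'"
  let ?p = "(1, 1) :: complex \<times> complex" and ?X = "lmon e" and ?Y = "lmon e'"
  have pt: "?p \<in> torus" by (simp add: torus_def)
  have pv: "lmonv ?p a = 1" for a by (simp add: lmonv_def)
  have inj: "inj_on (aff e e' w) S" for w S using inj_aff[OF uni] inj_on_subset by blast
  obtain f where f: "f \<in> laurent_space (aff e e' u ` A)"
      "\<forall>x\<in>A. Poly_Mapping.lookup f (aff e e' u x) = C x"
    using laurent_with_coeffs[OF fin(1) inj, of u C] by blast
  obtain g where g: "g \<in> laurent_space (aff e e' v ` B)"
      "\<forall>x\<in>B. Poly_Mapping.lookup g (aff e e' v x) = D x"
    using laurent_with_coeffs[OF fin(2) inj, of v D] by blast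
  note fl = frame_laurent[OF fin(1) uni f] and gl = frame_laurent[OF fin(2) uni g]
  let ?W = "local_ideal ?p f g"
  note ideal = is_ideal_local_ideal[of ?p f g]
  have loc: "lmon a \<in> local_ring ?p" "rval ?p (lmon a) = 1" for a using lmon_local[OF pt] pv by auto
  have unit: "w \<in> ?W" if "lmon a * w \<in> ?W" for a w
    using is_ideal_unit[OF ideal that loc(1)] loc(2) by simp
  have "lpoly C A ?X ?Y \<in> ?W" "lpoly D B ?X ?Y \<in> ?W"
  proof -
    have *: "lmon u * lpoly C A ?X ?Y \<in> ?W" "lmon v * lpoly D B ?X ?Y \<in> ?W"
      using local_ideal_gens[of f ?p g] local_ideal_gens[of g ?p f] by (simp_all only: fl(1) gl(1))
    show "lpoly C A ?X ?Y \<in> ?W" by (rule unit[OF *(1)])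
    show "lpoly D B ?X ?Y \<in> ?W" by (rule unit[OF *(2)])
  qed
  then obtain N where N: "(?X - 1) ^ N \<in> ?W" "(?Y - 1) ^ N \<in> ?W"
    using nil[OF ideal loc(1) loc(1) loc(2) loc(2)] by blast
  have params: "local_params ?p (?X - 1) (?Y - 1)"
    using local_params_frame[OF uni pt] pv by simp
  obtain a b c d where db: "dual_basis e e' = ((a, b), (c, d))" by (metis surj_pair)
  \<comment> \<open>The arc in the original coordinates, recovered from the frame by the dual basis.\<close>
  define q where "q = (\<lambda>z. (\<xi> z powi a * \<eta> z powi b, \<xi> z powi c * \<eta> z powi d))"
  have "eventually (\<lambda>z. \<xi> z \<noteq> 0) (at 0)" "eventually (\<lambda>z. \<eta> z \<noteq> 0) (at 0)"
    using tendsto_imp_eventually_ne[OF arc(1)] tendsto_imp_eventually_ne[OF arc(2)] by auto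
  then have near: "eventually (\<lambda>z. q z \<in> torus \<and> lmonv (q z) e = \<xi> z \<and> lmonv (q z) e' = \<eta> z) (at 0)"
  proof eventually_elim
    case (elim z)
    have "lmonv (q z) e = \<xi> z" "lmonv (q z) e' = \<eta> z"
      unfolding lmonv_def q_def fst_conv snd_conv two_powers[OF elim]
      using dual_basis_props(5-8)[OF uni db] by (simp_all add: mult.commute)
    then show ?case using elim by (simp add: torus_def q_def)
  qed
  have q: "(q \<longlongrightarrow> ?p) (at 0)"
  proof -
    have "((\<lambda>z. \<xi> z powi i * \<eta> z powi j) \<longlongrightarrow> 1 powi i * 1 powi j) (at 0)" for i j
      by (intro tendsto_intros arc) auto
    then show ?thesis unfolding q_def by (intro tendsto_Pair) simp_all
  qed
  have bdd: "(\<lambda>z. lmonv (q z) w) \<in> O[at 0](\<lambda>_. 1)" for w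
  proof -
    have "((\<lambda>z. rval (q z) (lmon w)) \<longlongrightarrow> rval ?p (lmon w)) (at 0)"
      by (rule filterlim_compose[OF local_ring_ev_near(2)[OF loc(1)] q])
    moreover have "eventually (\<lambda>z. rval (q z) (lmon w) = lmonv (q z) w) (at 0)"
      using near by eventually_elim (simp add: lmon_local)
    ultimately have "((\<lambda>z. lmonv (q z) w) \<longlongrightarrow> 1) (at 0)"
      unfolding loc by (rule Lim_transform_eventually)
    then show ?thesis by (intro bigoI_tendsto[where c = 1]) auto
  qed
  have p: "?p \<in> solutions f g"
    using zero fl(2)[OF pt] gl(2)[OF pt] pt by (simp add: solutions_def pv)
  show "has_root_of_high_multiplicity (aff e e' u ` A) (aff e e' v ` B)"
  proof (rule has_root_by_arc[OF f(1) g(1) p params N q, where k = k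
        and h = "\<lambda>i. (?X - 1) ^ \<alpha> i * (?Y - 1) ^ \<beta> i"
        and H = "\<lambda>i z. (\<xi> z - 1) ^ \<alpha> i * (\<eta> z - 1) ^ \<beta> i"])
    have "eventually (\<lambda>z. laurent_eval f (q z) = lmonv (q z) u * lpolyv C A (\<xi> z) (\<eta> z)) (at 0)"
      using near by eventually_elim (simp add: fl(2))
    note * = landau_o.big.in_cong[OF this]
    then show "(\<lambda>z. laurent_eval f (q z)) \<in> O[at 0](\<lambda>z. z ^ k)"
      unfolding * using landau_o.big.mult[OF bdd fO] by simp
    have "eventually (\<lambda>z. laurent_eval g (q z) = lmonv (q z) v * lpolyv D B (\<xi> z) (\<eta> z)) (at 0)"
      using near by eventually_elim (simp add: gl(2))
    note * = landau_o.big.in_cong[OF this]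
    then show "(\<lambda>z. laurent_eval g (q z)) \<in> O[at 0](\<lambda>z. z ^ k)"
      unfolding * using landau_o.big.mult[OF bdd gO] by simp
    show "(?X - 1) ^ \<alpha> i * (?Y - 1) ^ \<beta> i \<in> local_ring ?p" for i
      by (intro local_ring_intros loc local_ring_01)
    show "eventually (\<lambda>z. rval (q z) ((?X - 1) ^ \<alpha> i * (?Y - 1) ^ \<beta> i)
        = (\<xi> z - 1) ^ \<alpha> i * (\<eta> z - 1) ^ \<beta> i) (at 0)" for i
      using near
    proof eventually_elim
      case (elim z)
      then have l: "?X - 1 \<in> local_ring (q z)" "?Y - 1 \<in> local_ring (q z)"
        "rval (q z) (?X - 1) = \<xi> z - 1" "rval (q z) (?Y - 1) = \<eta> z - 1"
        by (simp_all add: local_ring_diff lmon_local)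
      show ?case using local_ring_power[OF l(1)] local_ring_power[OF l(2)]
          by (simp add: local_ring_mult l)
    qed
  qed (use indep in blast)
qed

section \<open>Systems without roots of high multiplicity\<close>

text \<open>\<open>W\<close> is the least ideal that contains \<open>a\<close> and \<open>b\<close>; in this form the generators may be
  replaced by linear combinations and by multiples with units.\<close>

definition generates :: "complex \<times> complex \<Rightarrow> ratfun set \<Rightarrow> ratfun \<Rightarrow> ratfun \<Rightarrow> bool" where
  "generates p W a b \<longleftrightarrow> is_ideal p W \<and> a \<in> W \<and> b \<in> W \<and> (\<forall>I. is_ideal p I \<longrightarrow> a \<in> I \<longrightarrow> b \<in> I \<longrightarrow> W \<subseteq> I)"

lemma generatesD:
  assumes "generates p W a b"
  shows "is_ideal p W" "a \<in> W" "b \<in> W" "is_ideal p I \<Longrightarrow> a \<in> I \<Longrightarrow> b \<in> I \<Longrightarrow> W \<subseteq> I"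
  using assms unfolding generates_def by blast+

lemma generates_commute: "generates p W a b \<Longrightarrow> generates p W b a"
  unfolding generates_def by blast

lemma generates_combine:
  assumes g: "generates p W a b"
  shows "generates p W (a - rat_const c * b) b"
  unfolding generates_def
proof (intro conjI allI impI)
  note gD = generatesD[OF g]
  show "is_ideal p W" "b \<in> W" by (fact gD)+
  show "a - rat_const c * b \<in> W"
    by (intro is_ideal_diff[OF gD(1) gD(2)] is_idealD(3)[OF gD(1) local_ring_const(1) gD(3)])
  fix I assume I: "is_ideal p I" "a - rat_const c * b \<in> I" "b \<in> I"
  have "(a - rat_const c * b) + rat_const c * b \<in> I"
    by (intro is_idealD(2)[OF I(1) I(2)] is_idealD(3)[OF I(1) local_ring_const(1) I(3)])
  then show "W \<subseteq> I" using gD(4)[OF I(1) _ I(3)] by simp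
qed

lemma generates_local_ideal:
  assumes "laurent_ratfun f = u * a" "laurent_ratfun g = v * b"
    "u \<in> local_ring p" "v \<in> local_ring p" "rval p u \<noteq> 0" "rval p v \<noteq> 0"
  shows "generates p (local_ideal p f g) a b"
  unfolding generates_def
proof (intro conjI allI impI)
  note W = is_ideal_local_ideal[of p f g]
  show "is_ideal p (local_ideal p f g)" by (fact W)
  show "a \<in> local_ideal p f g" "b \<in> local_ideal p f g"
    using is_ideal_unit[OF W] local_ideal_gens[of f p g] local_ideal_gens[of g p f] assms by metis+
  fix I assume I: "is_ideal p I" "a \<in> I" "b \<in> I"
  then show "local_ideal p f g \<subseteq> I"
    using local_ideal_least[OF I(1)] is_idealD(3)[OF I(1)] assms by simp
qed

definition principal :: "complex \<times> complex \<Rightarrow> ratfun \<Rightarrow> ratfun set" where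
  "principal p a = {a * u |u. u \<in> local_ring p}"

lemma principal_is_ideal: "a \<in> local_ring p \<Longrightarrow> is_ideal p (principal p a)"
  unfolding principal_def by (rule is_ideal_principal)

lemma principalI: "u \<in> local_ring p \<Longrightarrow> a * u \<in> principal p a"
  unfolding principal_def by blast

lemma principal_self: "a \<in> principal p a"
  using principalI[OF local_ring_01(2), of a p] by simp

text \<open>A common factor of both equations that vanishes at \<open>p\<close>.\<close>

lemma no_finite_dim_in_principal:
  assumes "generates p W a b" "h \<in> local_ring p" "rval p h = 0" "a \<in> principal p h" "b \<in> principal p h"
  shows "\<not> quotient_has_dim (local_ring p) W m"
  using principal_ideal_infinite_codim[OF assms(2,3) generatesD(1)[OF assms(1)]]
    generatesD(4)[OF assms(1) principal_is_ideal[OF assms(2)] assms(4,5)]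
  unfolding principal_def by blast

lemma no_finite_dim_zero:
  assumes "generates p W 0 b" "b \<in> local_ring p" "rval p b = 0"
  shows "\<not> quotient_has_dim (local_ring p) W m"
  using no_finite_dim_in_principal[OF assms] principal_self principal_is_ideal[OF assms(2)] is_idealD(1)
      by blast

text \<open>Substitution into a Laurent polynomial. It is meaningful for exponents in the positive
  quadrant only, since \<open>nat\<close> truncates negative ones to 0.\<close>

definition psubst :: "(int \<times> int \<Rightarrow> complex) \<Rightarrow> (int \<times> int) set \<Rightarrow> complex poly \<Rightarrow> complex poly \<Rightarrow> complex
    poly" where
  "psubst D B \<phi> \<psi> = (\<Sum>x\<in>B. smult (D x) (\<phi> ^ nat (fst x) * \<psi> ^ nat (snd x)))"

definition nonneg :: "(int \<times> int) set \<Rightarrow> bool" where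
  "nonneg B \<longleftrightarrow> (\<forall>x\<in>B. 0 \<le> fst x \<and> 0 \<le> snd x)"

lemma power_diff_in_ideal:
  assumes "is_ideal p I" "u \<in> local_ring p" "v \<in> local_ring p" "u - v \<in> I"
  shows "u ^ n - v ^ n \<in> I"
proof (induction n)
  case (Suc n)
  have "u * (u ^ n - v ^ n) + (u - v) * v ^ n \<in> I"
    by (intro is_idealD(2)[OF assms(1)] is_idealD(3)[OF assms(1)] is_idealD(4)[OF assms(1)] Suc assms
        local_ring_intros)
  then show ?case by (simp add: algebra_simps)
qed (use is_idealD(1)[OF assms(1)] in simp)

text \<open>\<open>I\<close> is the ideal of the parametrised curve \<open>X = \<phi>(t)\<close>, \<open>Y = \<psi>(t)\<close>. Substitution of
  congruent elements preserves congruence.\<close>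

lemma lpoly_psubst:
  assumes I: "is_ideal p I" and loc: "X \<in> local_ring p" "Y \<in> local_ring p" "t \<in> local_ring p"
    and sub: "X - peval \<phi> t \<in> I" "Y - peval \<psi> t \<in> I" and B: "nonneg B"
  shows "lpoly D B X Y - peval (psubst D B \<phi> \<psi>) t \<in> I"
proof -
  have "lpoly D B X Y - peval (psubst D B \<phi> \<psi>) t =
    (\<Sum>x\<in>B. rat_const (D x) * (X powi fst x * Y powi snd x - peval \<phi> t ^ nat (fst x) * peval \<psi> t ^ nat
        (snd x)))"
    unfolding lpoly_def psubst_def
    by (simp add: peval_sum peval_smult peval_mult peval_power right_diff_distrib sum_subtractf)
  also have "\<dots> = (\<Sum>x\<in>B. rat_const (D x) * (X ^ nat (fst x) * (Y ^ nat (snd x) - peval \<psi> t ^ nat (snd x))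
     + (X ^ nat (fst x) - peval \<phi> t ^ nat (fst x)) * peval \<psi> t ^ nat (snd x)))"
  proof (intro sum.cong refl)
    fix x assume "x \<in> B"
    then have "X powi fst x = X ^ nat (fst x)" "Y powi snd x = Y ^ nat (snd x)"
      using B by (auto simp: nonneg_def power_int_def)
    then show "rat_const (D x) * (X powi fst x * Y powi snd x - peval \<phi> t ^ nat (fst x) * peval \<psi> t ^
        nat (snd x)) =
      rat_const (D x) * (X ^ nat (fst x) * (Y ^ nat (snd x) - peval \<psi> t ^ nat (snd x))
     + (X ^ nat (fst x) - peval \<phi> t ^ nat (fst x)) * peval \<psi> t ^ nat (snd x))"
      by (simp add: algebra_simps)
  qed
  also have "\<dots> \<in> I"
    by (intro is_ideal_sum[OF I] is_idealD(3)[OF I local_ring_const(1)] is_idealD(2)[OF I])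
       (intro is_idealD(3)[OF I] is_idealD(4)[OF I] power_diff_in_ideal[OF I] local_ring_intros loc
           peval_local[THEN conjunct1] sub)+
  finally show ?thesis .
qed

text \<open>If \<open>a = 0\<close> is a smooth arc with coordinate \<open>t\<close>, then the restriction of \<open>b\<close> to it is a
  polynomial in \<open>t\<close>. It is nonzero, since otherwise \<open>a\<close> would divide \<open>b\<close>, and its order of
  vanishing bounds the multiplicity.\<close>

lemma multiplicity_on_smooth_arc:
  assumes gen: "generates p W a (lpoly D B X Y)" and a: "a \<in> local_ring p" "rval p a = 0"
    and loc: "X \<in> local_ring p" "Y \<in> local_ring p" "t \<in> local_ring p"
    and sub: "X - peval \<phi> t \<in> principal p a" "Y - peval \<psi> t \<in> principal p a" and B: "nonneg B"
    and max: "\<And>h. h \<in> local_ring p \<Longrightarrow> rval p h = 0 \<Longrightarrow>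
       \<exists>h1\<in>local_ring p. \<exists>w\<in>principal p a. h = (t - rat_const (rval p t)) * h1 + w"
    and dim: "quotient_has_dim (local_ring p) W m"
  shows "psubst D B \<phi> \<psi> \<noteq> 0" "m \<le> order (rval p t) (psubst D B \<phi> \<psi>)"
proof -
  note P = principal_is_ideal[OF a(1)] and W = generatesD(1)[OF gen]
  let ?b = "lpoly D B X Y" and ?G = "psubst D B \<phi> \<psi>"
  have diff: "?b - peval ?G t \<in> principal p a" by (rule lpoly_psubst[OF P loc sub B])
  have PW: "principal p a \<subseteq> W"
    unfolding principal_def using is_idealD(4)[OF W _ generatesD(2)[OF gen]] by blast
  show nz: "?G \<noteq> 0"
  proof
    assume "?G = 0"
    then have "?b \<in> principal p a" using diff by simp
    then show False using no_finite_dim_in_principal[OF gen a principal_self] dim by blast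
  qed
  have "?b - (?b - peval ?G t) \<in> W"
    using is_ideal_diff[OF W generatesD(3)[OF gen]] diff PW by blast
  then have "peval ?G t \<in> W" by simp
  from power_order_in_ideal[OF W loc(3) nz this]
  have pow: "(t - rat_const (rval p t)) ^ order (rval p t) ?G \<in> W" .
  have "\<exists>h1\<in>local_ring p. \<exists>w\<in>W. h = (t - rat_const (rval p t)) * h1 + w"
    if "h \<in> local_ring p" "rval p h = 0" for h
    using max[OF that] PW by blast
  then show "m \<le> order (rval p t) ?G"
    by (intro dim_le_of_curvilinear[OF W _ pow _ dim] local_ring_intros loc local_ring_const)
qed

text \<open>Rational functions that can serve as the coordinates of a frame at the point \<open>p\<close>.\<close>

definition coords :: "complex \<times> complex \<Rightarrow> ratfun \<Rightarrow> ratfun \<Rightarrow> bool" where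
  "coords p X Y \<longleftrightarrow> X \<in> local_ring p \<and> Y \<in> local_ring p \<and> rval p X \<noteq> 0 \<and> rval p Y \<noteq> 0 \<and>
     local_params p (X - rat_const (rval p X)) (Y - rat_const (rval p Y))"

lemma local_params_commute: "local_params p s t \<Longrightarrow> local_params p t s"
  unfolding local_params_def by (metis add.commute)

lemma coords_commute: "coords p X Y \<Longrightarrow> coords p Y X"
  unfolding coords_def using local_params_commute by blast

lemma coords_max_ideal:
  assumes "coords p X Y" "h \<in> local_ring p" "rval p h = 0"
  obtains h1 h2 where "h1 \<in> local_ring p" "h2 \<in> local_ring p"
    "h = (X - rat_const (rval p X)) * h1 + (Y - rat_const (rval p Y)) * h2"
  using assms unfolding coords_def local_params_def by blast

lemma lpoly_local:
  assumes "coords p X Y"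
  shows "lpoly C A X Y \<in> local_ring p" "rval p (lpoly C A X Y) = lpolyv C A (rval p X) (rval p Y)"
proof -
  have XY: "X powi i \<in> local_ring p" "rval p (X powi i) = rval p X powi i"
     "Y powi i \<in> local_ring p" "rval p (Y powi i) = rval p Y powi i" for i
    using assms local_ring_powi unfolding coords_def by auto
  then have *: "rat_const (C x) * (X powi fst x * Y powi snd x) \<in> local_ring p" for x
    by (intro local_ring_intros local_ring_const)
  show "lpoly C A X Y \<in> local_ring p" unfolding lpoly_def
      by (rule local_ring_sum[THEN conjunct1]) (rule *)
  show "rval p (lpoly C A X Y) = lpolyv C A (rval p X) (rval p Y)"
  proof -
    have "rval p (lpoly C A X Y) = (\<Sum>x\<in>A. rval p (rat_const (C x) * (X powi fst x * Y powi snd x)))"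
      unfolding lpoly_def by (rule local_ring_sum[THEN conjunct2]) (rule *)
    also have "\<dots> = lpolyv C A (rval p X) (rval p Y)"
      unfolding lpolyv_def by (intro sum.cong refl) (simp add: local_ring_mult XY)
    finally show ?thesis .
  qed
qed

text \<open>From here on, a root is treated in the coordinates \<open>X\<close> and \<open>Y\<close> of a frame: the two
  equations are Laurent polynomials in \<open>X\<close> and \<open>Y\<close> up to monomial factors, which are units.\<close>

lemma root_in_frame:
  assumes "unimodular e e'" "finite A" "finite B"
    and "has_root_of_high_multiplicity (aff e e' u ` A) (aff e e' v ` B)"
  obtains p W C D m X Y where "coords p X Y" "generates p W (lpoly C A X Y) (lpoly D B X Y)"
    "rval p (lpoly C A X Y) = 0" "rval p (lpoly D B X Y) = 0" "quotient_has_dim (local_ring p) W m"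
        "m > 2"
proof -
  let ?X = "lmon e" and ?Y = "lmon e'"
  obtain f g p m where f: "f \<in> laurent_space (aff e e' u ` A)"
      and g: "g \<in> laurent_space (aff e e' v ` B)"
    and root: "root_of_multiplicity f g p m" and m: "m > 2"
    using assms(4) unfolding has_root_of_high_multiplicity_def by blast
  have dim: "quotient_has_dim (local_ring p) (local_ideal p f g) m" and sol: "p \<in> solutions f g"
    using root unfolding root_of_multiplicity_def isolated_in_def by auto
  then have pt: "p \<in> torus" and zero: "laurent_eval f p = 0" "laurent_eval g p = 0"
    by (auto simp: solutions_def)
  let ?C = "\<lambda>x. Poly_Mapping.lookup f (aff e e' u x)"
      and ?D = "\<lambda>x. Poly_Mapping.lookup g (aff e e' v x)"
  have fl: "laurent_ratfun f = lmon u * lpoly ?C A ?X ?Y"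
      "laurent_eval f p = lmonv p u * lpolyv ?C A (lmonv p e) (lmonv p e')"
    using frame_laurent[OF assms(2,1) f, of ?C] pt by auto
  have gl: "laurent_ratfun g = lmon v * lpoly ?D B ?X ?Y"
      "laurent_eval g p = lmonv p v * lpolyv ?D B (lmonv p e) (lmonv p e')"
    using frame_laurent[OF assms(3,1) g, of ?D] pt by auto
  have c: "coords p ?X ?Y"
    using local_params_frame[OF assms(1) pt] lmon_local[OF pt] by (simp add: coords_def)
  show ?thesis
  proof (rule that[OF c])
    show "generates p (local_ideal p f g) (lpoly ?C A ?X ?Y) (lpoly ?D B ?X ?Y)"
      by (rule generates_local_ideal[OF fl(1) gl(1)]) (simp_all add: lmon_local[OF pt])
    show "rval p (lpoly ?C A ?X ?Y) = 0" "rval p (lpoly ?D B ?X ?Y) = 0"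
      unfolding lpoly_local[OF c] using zero fl(2) gl(2) lmon_local[OF pt] by auto
  qed (use dim m in auto)
qed

subsection \<open>A line and a conic\<close>

definition simplex2 :: "(int \<times> int) set" where
  "simplex2 = {(0, 0), (1, 0), (0, 1), (2, 0), (1, 1), (0, 2)}"

lemma degree_psubst_le:
  assumes "finite B" "\<And>x. x \<in> B \<Longrightarrow> nat (fst x) + nat (snd x) \<le> n" "degree \<phi> \<le> 1" "degree \<psi> \<le> 1"
  shows "degree (psubst D B \<phi> \<psi>) \<le> n"
  unfolding psubst_def
proof (rule degree_sum_le[OF assms(1)])
  fix x assume x: "x \<in> B"
  have "degree (smult (D x) (\<phi> ^ nat (fst x) * \<psi> ^ nat (snd x))) \<le> degree (\<phi> ^ nat (fst x))
      + degree (\<psi> ^ nat (snd x))"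
    using degree_smult_le degree_mult_le order_trans by blast
  also have "\<dots> \<le> degree \<phi> * nat (fst x) + degree \<psi> * nat (snd x)"
    by (intro add_mono degree_power_le)
  also have "\<dots> \<le> 1 * nat (fst x) + 1 * nat (snd x)"
    using assms(3,4) by (intro add_mono mult_right_mono) auto
  also have "\<dots> \<le> n" using assms(2)[OF x] by simp
  finally show "degree (smult (D x) (\<phi> ^ nat (fst x) * \<psi> ^ nat (snd x))) \<le> n" .
qed

text \<open>The line is the graph of an affine function of \<open>X\<close>, and the conic restricts to a
  polynomial of degree at most 2 in \<open>X\<close>.\<close>

lemma line_conic_graph:
  assumes c: "coords p X Y" and c2: "c2 \<noteq> 0"
    and gen: "generates p W (rat_const c0 + rat_const c1 * X + rat_const c2 * Y) (lpoly D simplex2 X Y)"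
    and zero: "c0 + c1 * rval p X + c2 * rval p Y = 0"
    and dim: "quotient_has_dim (local_ring p) W m"
  shows "m \<le> 2"
proof -
  define k where "k = 1 / c2"
  define K where "K = rat_const k"
  let ?a = "rat_const c0 + rat_const c1 * X + rat_const c2 * Y"
  let ?\<phi> = "[:0, 1:] :: complex poly" and ?\<psi> = "[:- (c0 * k), - (c1 * k):]"
  have loc: "X \<in> local_ring p" "Y \<in> local_ring p" using c by (auto simp: coords_def)
  have a: "?a \<in> local_ring p" "rval p ?a = 0"
    using loc zero by (simp_all add: local_ring_add local_ring_mult)
  note P = principal_is_ideal[OF a(1)]
  have K: "rat_const c2 * K = 1" "K \<in> local_ring p"
    using c2 by (simp_all add: K_def k_def flip: rat_const_simps(4))
  have aK: "?a * K = rat_const c0 * K + rat_const c1 * K * X + Y"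
  proof -
    have "?a * K = rat_const c0 * K + rat_const c1 * K * X + (rat_const c2 * K) * Y"
      by (simp add: algebra_simps)
    then show ?thesis unfolding K(1) by simp
  qed
  have sX: "X - peval ?\<phi> X \<in> principal p ?a" using is_idealD(1)[OF P] by simp
  have "Y - peval ?\<psi> X = ?a * K" unfolding aK by (simp add: K_def algebra_simps)
  then have sY: "Y - peval ?\<psi> X \<in> principal p ?a" using principalI[OF K(2)] by simp
  have nn: "nonneg simplex2" by (simp add: nonneg_def simplex2_def)
  have max: "\<exists>h1\<in>local_ring p. \<exists>w\<in>principal p ?a. h = (X - rat_const (rval p X)) * h1 + w"
    if hh: "h \<in> local_ring p" "rval p h = 0" for h
  proof -
    obtain h1 h2 where h: "h1 \<in> local_ring p" "h2 \<in> local_ring p"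
      "h = (X - rat_const (rval p X)) * h1 + (Y - rat_const (rval p Y)) * h2"
      using coords_max_ideal[OF c hh] by blast
    have y0: "rval p Y = - (c0 * k) - c1 * k * rval p X" using zero c2 unfolding k_def
      by (simp add: field_simps) algebra
    have "Y - rat_const (rval p Y) = ?a * K - rat_const c1 * K * (X - rat_const (rval p X))"
      unfolding aK y0 by (simp add: K_def algebra_simps)
    then have "h = (X - rat_const (rval p X)) * (h1 - rat_const c1 * K * h2) + ?a * (K * h2)"
      unfolding h(3) by (simp add: left_diff_distrib right_diff_distrib mult_ac)
    moreover have "h1 - rat_const c1 * K * h2 \<in> local_ring p" "K * h2 \<in> local_ring p"
      by (intro local_ring_intros h local_ring_const K)+
    ultimately show ?thesis using principalI by blast
  qed
  note main = multiplicity_on_smooth_arc[OF gen a loc loc(1) sX sY nn max dim]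
  have "m \<le> order (rval p X) (psubst D simplex2 ?\<phi> ?\<psi>)" by (rule main(2))
  also have "\<dots> \<le> degree (psubst D simplex2 ?\<phi> ?\<psi>)" by (intro order_degree main(1))
  also have "\<dots> \<le> 2" by (intro degree_psubst_le) (auto simp: simplex2_def)
  finally show ?thesis .
qed

lemma lpoly_extend:
  assumes "finite B'" "B \<subseteq> B'"
  shows "lpoly D B X Y = lpoly (\<lambda>x. if x \<in> B then D x else 0) B' X Y"
  unfolding lpoly_def by (rule sum.mono_neutral_cong_left) (use assms in auto)

lemma lpoly_swap:
  "lpoly D B X Y = lpoly (D \<circ> prod.swap) (prod.swap ` B) Y X"
  unfolding lpoly_def by (subst sum.reindex) (auto simp: inj_on_def mult.commute)

lemma simplex_eq: "lpoly C standard_simplex X Y = rat_const (C (0, 0)) + rat_const (C (1, 0)) * X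
    + rat_const (C (0, 1)) * Y"
  by (simp add: lpoly_def standard_simplex_def add.assoc)

lemma line_conic:
  assumes c: "coords p X Y" and B: "B \<subseteq> simplex2"
    and gen: "generates p W (lpoly C standard_simplex X Y) (lpoly D B X Y)"
    and zero: "rval p (lpoly C standard_simplex X Y) = 0" "rval p (lpoly D B X Y) = 0"
    and dim: "quotient_has_dim (local_ring p) W m"
  shows "m \<le> 2"
proof -
  define D' where "D' = (\<lambda>x. if x \<in> B then D x else 0)"
  have DB: "lpoly D B X Y = lpoly D' simplex2 X Y"
    unfolding D'_def using B by (intro lpoly_extend) (auto simp: simplex2_def)
  have sw: "prod.swap ` simplex2 = simplex2" by (auto simp: simplex2_def)
  let ?c0 = "C (0, 0)" and ?c1 = "C (1, 0)" and ?c2 = "C (0, 1)"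
  have loc: "X \<in> local_ring p" "Y \<in> local_ring p" using c by (auto simp: coords_def)
  have z: "?c0 + ?c1 * rval p X + ?c2 * rval p Y = 0"
    using zero(1) loc unfolding simplex_eq by (simp add: local_ring_add local_ring_mult)
  note gen' = gen[unfolded simplex_eq DB]
  consider "?c2 \<noteq> 0" | "?c2 = 0" "?c1 \<noteq> 0" | "?c2 = 0" "?c1 = 0" by blast
  then show ?thesis
  proof cases
    case 1
    then show ?thesis using line_conic_graph[OF c _ gen' z dim] by blast
  next
    case 2
    have "generates p W (rat_const ?c0 + rat_const ?c2 * Y
        + rat_const ?c1 * X) (lpoly (D' \<circ> prod.swap) simplex2 Y X)"
      using gen' lpoly_swap[of D' simplex2 X Y] by (simp add: sw add_ac)
    moreover have "?c0 + ?c2 * rval p Y + ?c1 * rval p X = 0" using z by (simp add: algebra_simps)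
    ultimately show ?thesis using line_conic_graph[OF coords_commute[OF c] 2(2) _ _ dim] by blast
  next
    case 3
    then have "?c0 = 0" using z by simp
    then have "generates p W 0 (lpoly D B X Y)" using gen 3 by (simp add: simplex_eq)
    from no_finite_dim_zero[OF this lpoly_local(1)[OF c] zero(2)] dim show ?thesis by blast
  qed
qed

lemma simplex2_no_high_multiplicity:
  assumes "unimodular e e'" "B \<subseteq> simplex2"
  shows "\<not> has_root_of_high_multiplicity (aff e e' u ` standard_simplex) (aff e e' v ` B)"
proof
  assume root: "has_root_of_high_multiplicity (aff e e' u ` standard_simplex) (aff e e' v ` B)"
  have fin: "finite standard_simplex" "finite B"
    using assms(2) finite_subset[of B simplex2] by (auto simp: standard_simplex_def simplex2_def)
  obtain p W C D m X Y where r: "coords p X Y"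
    "generates p W (lpoly C standard_simplex X Y) (lpoly D B X Y)"
    "rval p (lpoly C standard_simplex X Y) = 0" "rval p (lpoly D B X Y) = 0"
    "quotient_has_dim (local_ring p) W m" "m > 2"
    by (rule root_in_frame[OF assms(1) fin root])
  from line_conic[OF r(1) assms(2) r(2-5)] r(6) show False by simp
qed

text \<open>A combination of the two equations eliminates the only monomial outside the standard
  simplex. The other equation is a conic because \<open>k\<close> belongs to the 2-simplex.\<close>

lemma equal_pair_no_high_multiplicity:
  assumes uni: "unimodular e e'" and k: "k \<in> simplex2" "k \<notin> standard_simplex"
  defines "S \<equiv> insert k standard_simplex"
  shows "\<not> has_root_of_high_multiplicity (aff e e' u ` S) (aff e e' v ` S)"
proof
  assume root: "has_root_of_high_multiplicity (aff e e' u ` S) (aff e e' v ` S)"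
  have fin: "finite S" by (simp add: S_def standard_simplex_def)
  have S2: "S \<subseteq> simplex2" using k by (auto simp: S_def standard_simplex_def simplex2_def)
  obtain p W C D m X Y where r: "coords p X Y" "generates p W (lpoly C S X Y) (lpoly D S X Y)"
    "rval p (lpoly C S X Y) = 0" "rval p (lpoly D S X Y) = 0" "quotient_has_dim (local_ring p) W m"
        "m > 2"
    by (rule root_in_frame[OF uni fin fin root])
  have drop: "lpoly E S X Y = lpoly E standard_simplex X Y" if "E k = 0" for E
    unfolding S_def lpoly_def using k that by (simp add: standard_simplex_def)
  show False
  proof (cases "D k = 0")
    case True
    from line_conic[OF r(1) S2 _ _ _ r(5), of D C] generates_commute[OF r(2)] r(3,4,6) drop[of D, OF
        True]
    show False by simp
  next
    case False
    define c where "c = C k / D k"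
    define E where "E = (\<lambda>x. C x - c * D x)"
    have "lpoly C S X Y - rat_const c * lpoly D S X Y = lpoly E S X Y"
      unfolding lpoly_def E_def by (simp add: left_diff_distrib sum_subtractf sum_distrib_left
          mult.assoc)
    moreover have "E k = 0" using False by (simp add: E_def c_def)
    ultimately have eq: "lpoly C S X Y - rat_const c * lpoly D S X Y = lpoly E standard_simplex X Y"
      using drop by simp
    have "generates p W (lpoly E standard_simplex X Y) (lpoly D S X Y)"
      using generates_combine[OF r(2), of c] unfolding eq .
    moreover have "rval p (lpoly E standard_simplex X Y) = 0"
      unfolding eq[symmetric] using r(3,4) lpoly_local(1)[OF r(1)]
          by (simp add: local_ring_diff local_ring_mult)
    ultimately show False using line_conic[OF r(1) S2 _ _ r(4,5)] r(6) by fastforce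
  qed
qed

subsection \<open>Parallel lines and sparse polynomials\<close>

text \<open>A power of the variable is divided out to obtain a nonzero constant term; then
  differentiation lowers both the order and the number of terms by one.\<close>

lemma order_less_number_of_terms:
  fixes a :: complex
  assumes "P \<noteq> 0" "a \<noteq> 0"
  shows "order a P < card {i. coeff P i \<noteq> 0}"
  using assms
proof (induction "degree P" arbitrary: P rule: less_induct)
  case less
  let ?T = "\<lambda>P. {i. coeff P i \<noteq> 0}"
  have fin: "finite (?T P)" for P :: "complex poly"
    by (rule finite_subset[of _ "{..degree P}"]) (auto intro: le_degree)
  obtain b Q where P: "P = pCons b Q" by (cases P)
  show ?case
  proof (cases "b = 0")
    case True
    then have Q: "Q \<noteq> 0" using less.prems P by auto
    have PQ: "P = [:0, 1:] * Q" using P True by simp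
    have "order a P = order a [:0, 1:] + order a Q" unfolding PQ by (rule order_mult) (use Q in auto)
    moreover have "order a [:0, 1:] = 0" using less.prems by (intro order_0I) auto
    moreover have "?T P = Suc ` ?T Q"
    proof (intro set_eqI)
      fix i show "i \<in> ?T P \<longleftrightarrow> i \<in> Suc ` ?T Q" unfolding P True by (cases i) auto
    qed
    then have "card (?T P) = card (?T Q)" by (simp add: card_image)
    moreover have "degree Q < degree P" using P Q by simp
    ultimately show ?thesis using less.hyps[OF _ Q less.prems(2)] by simp
  next
    case False
    have zero: "0 \<in> ?T P" using False P by simp
    show ?thesis
    proof (cases "order a P = 0")
      case True
      then show ?thesis using zero fin by (auto simp: card_gt_0_iff)
    next
      case ord: False
      then have "degree P \<noteq> 0" using order_degree[OF less.prems(1), of a] by auto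
      then have d: "pderiv P \<noteq> 0" "degree (pderiv P) < degree P"
        by (auto simp: pderiv_eq_0_iff degree_pderiv)
      have "?T P = insert 0 (Suc ` ?T (pderiv P))"
      proof (intro set_eqI)
        fix i show "i \<in> ?T P \<longleftrightarrow> i \<in> insert 0 (Suc ` ?T (pderiv P))"
          using zero by (cases i) (auto simp: coeff_pderiv simp del: of_nat_Suc)
      qed
      then have "card (?T P) = Suc (card (?T (pderiv P)))"
        using fin by (simp add: card_image)
      moreover have "order a P = Suc (order a (pderiv P))" 
        using order_pderiv[OF less.prems(1), of a] ord order_root by blast
      ultimately show ?thesis using less.hyps[OF d(2,1) less.prems(2)] by simp
    qed
  qed
qed

text \<open>On the line \<open>X = x\<^sub>0\<close> the terms of each row collapse into a single one.\<close>

lemma order_row_restriction: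
  assumes "finite B" "psubst D B [:x0:] [:0, 1:] \<noteq> 0" "y0 \<noteq> 0"
  shows "order y0 (psubst D B [:x0:] [:0, 1:]) < card (snd ` B)"
proof -
  let ?G = "psubst D B [:x0:] [:0, 1:]"
  have "coeff ?G i = 0" if "i \<notin> nat ` snd ` B" for i
  proof -
    have "coeff ([:x0:] ^ k * [:0, 1:] ^ nat (snd x)) i = 0" if "x \<in> B" for x k
    proof -
      have "[:x0:] ^ k * [:0, 1:] ^ nat (snd x) = monom (x0 ^ k) (nat (snd x))"
        by (simp add: monom_altdef poly_const_pow)
      moreover have "nat (snd x) \<noteq> i" using that \<open>i \<notin> nat ` snd ` B\<close> by blast
      ultimately show ?thesis by simp
    qed
    then show ?thesis unfolding psubst_def by (simp add: coeff_sum)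
  qed
  then have "{i. coeff ?G i \<noteq> 0} \<subseteq> nat ` snd ` B" by blast
  then have "card {i. coeff ?G i \<noteq> 0} \<le> card (nat ` snd ` B)" using assms(1) by (intro card_mono) auto
  also have "\<dots> \<le> card (snd ` B)" using assms(1) by (intro card_image_le) simp
  finally show ?thesis using order_less_number_of_terms[OF assms(2,3)] by simp
qed

lemma shift_to_nonneg:
  assumes "finite B"
  obtains w where "nonneg ((\<lambda>x. x + w) ` B)"
proof -
  define M where "M = (\<Sum>x\<in>B. \<bar>fst x\<bar> + \<bar>snd x\<bar>)"
  have "\<bar>fst x\<bar> + \<bar>snd x\<bar> \<le> M" if "x \<in> B" for x
    unfolding M_def using member_le_sum[OF that, of "\<lambda>x. \<bar>fst x\<bar> + \<bar>snd x\<bar>"] assms by simp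
  then have "nonneg ((\<lambda>x. x + (M, M)) ` B)" unfolding nonneg_def by fastforce
  then show ?thesis by (rule that)
qed

lemma aff_shift: "aff e e' v ` B = aff e e' (aff e e' v (- w)) ` (\<lambda>x. x + w) ` B"
  unfolding image_image aff_def by (intro image_cong refl) (auto simp: algebra_simps)

text \<open>Let \<open>x\<^sub>0\<close> be a root of the equation in \<open>X\<close> alone. If \<open>A\<close> has two points, \<open>X - x\<^sub>0\<close> lies
  in the ideal and the multiplicity is at most the order of a polynomial with at most three
  terms. If \<open>A\<close> has three points, \<open>(X - x\<^sub>0)\<^sup>2\<close> lies in the ideal, and the restriction of the
  other equation to \<open>X = x\<^sub>0\<close> has at most two terms, thus a simple root; so the maximal ideal
  is generated by \<open>X - x\<^sub>0\<close> modulo the ideal.\<close>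

lemma rows_no_high_multiplicity_nonneg:
  assumes uni: "unimodular e e'" and B: "finite B" "nonneg B"
    and cases: "A = {(0, 0), (1, 0)} \<and> card (snd ` B) \<le> 3 \<or> A = {(0, 0), (1, 0), (2, 0)}
        \<and> card (snd ` B) \<le> 2"
  shows "\<not> has_root_of_high_multiplicity (aff e e' u ` A) (aff e e' v ` B)"
proof
  assume root: "has_root_of_high_multiplicity (aff e e' u ` A) (aff e e' v ` B)"
  have fin: "finite A" using cases by auto
  obtain p W C D m X Y where r: "coords p X Y" "generates p W (lpoly C A X Y) (lpoly D B X Y)"
    "rval p (lpoly C A X Y) = 0" "rval p (lpoly D B X Y) = 0" "quotient_has_dim (local_ring p) W m"
        "m > 2"
    by (rule root_in_frame[OF uni fin B(1) root])
  define x0 y0 where "x0 = rval p X" and "y0 = rval p Y"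
  define s t where "s = X - rat_const x0" and "t = Y - rat_const y0"
  have loc: "X \<in> local_ring p" "Y \<in> local_ring p" "y0 \<noteq> 0" using r(1) by (auto simp: coords_def y0_def)
  have s: "s \<in> local_ring p" "rval p s = 0" using loc by (simp_all add: s_def local_ring_diff x0_def)
  note W = generatesD(1)[OF r(2)] and S = principal_is_ideal[OF s(1)]
  let ?a = "lpoly C A X Y" and ?b = "lpoly D B X Y"
  \<comment> \<open>Both cases for \<open>A\<close> are treated as one quadratic polynomial \<open>P\<close>.\<close>
  define c2 where "c2 = (if (2, 0) \<in> A then C (2, 0) else 0)"
  define P where "P = [:C (0, 0), C (1, 0), c2:]"
  have a: "?a = peval P X"
    using cases by (auto simp: lpoly_def P_def c2_def power2_eq_square algebra_simps)
  have "P \<noteq> 0"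
  proof
    assume "P = 0"
    then have "generates p W 0 ?b" using r(2) a by simp
    from no_finite_dim_zero[OF this lpoly_local(1)[OF r(1)] r(4)] show False using r(5) by blast
  qed
  have P0: "poly P x0 = 0" using r(3) peval_local[OF loc(1), of P] unfolding a x0_def by simp
  have s_pow: "s ^ order x0 P \<in> W"
    using power_order_in_ideal[OF W loc(1) \<open>P \<noteq> 0\<close>] generatesD(2)[OF r(2)] unfolding a s_def x0_def
        by simp
  have "?a \<in> principal p s"
  proof -
    obtain Q where Q: "P = [:- x0, 1:] * Q" using P0 by (metis dvdE poly_eq_0_iff_dvd)
    have "?a = s * peval Q X" unfolding a Q peval_mult by (simp add: s_def)
    then show ?thesis using principalI peval_local[OF loc(1)] by simp
  qed
  note no_dim = no_finite_dim_in_principal[OF r(2) s this]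
  let ?G = "psubst D B [:x0:] [:0, 1:]"
  have diff: "?b - peval ?G Y \<in> principal p s"
    by (rule lpoly_psubst[OF S loc(1,2,2) _ _ B(2)])
      (use principal_self is_idealD(1)[OF S] in \<open>auto simp: s_def\<close>)
  then obtain w where w: "w \<in> local_ring p" "?b - peval ?G Y = s * w" unfolding principal_def by blast
  have G: "?G \<noteq> 0"
  proof
    assume "?G = 0"
    then have "?b \<in> principal p s" using diff by simp
    then show False using no_dim r(5) by blast
  qed
  have ord: "order y0 ?G < card (snd ` B)" by (rule order_row_restriction[OF B(1) G loc(3)])
  have "rval p ?b = rval p (peval ?G Y + s * w)" using w(2) by (simp add: algebra_simps)
  also have "\<dots> = poly ?G y0"
    using peval_local[OF loc(2), of ?G] s w(1) by (simp add: local_ring_add local_ring_mult y0_def)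
  finally have "poly ?G y0 = 0" using r(4) by simp
  then have ord1: "order y0 ?G \<ge> 1" using G by (simp add: order_root Suc_le_eq)
  have maxd: "\<exists>h1 h2. h1 \<in> local_ring p \<and> h2 \<in> local_ring p \<and> h = s * h1 + t * h2"
      if "h \<in> local_ring p" "rval p h = 0" for h
    using r(1) that unfolding coords_def local_params_def s_def t_def x0_def y0_def by blast
  from cases show False
  proof (elim disjE conjE)
    assume A: "A = {(0, 0), (1, 0)}" and rows: "card (snd ` B) \<le> 3"
    have "degree P \<le> 1" using A by (simp add: P_def c2_def)
    moreover have "order x0 P \<le> degree P" "order x0 P \<noteq> 0"
      using order_degree \<open>P \<noteq> 0\<close> P0 order_root by blast+
    ultimately have "order x0 P = 1" by simp
    then have sW: "s \<in> W" using s_pow by simp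
    have bW: "?b - s * w \<in> W"
      by (intro is_ideal_diff[OF W generatesD(3)[OF r(2)]] is_idealD(4)[OF W w(1) sW])
    have "?b - s * w = peval ?G Y" using w(2) by (simp add: algebra_simps)
    then have "t ^ order y0 ?G \<in> W" using power_order_in_ideal[OF W loc(2) G] bW
        by (simp add: t_def y0_def)
    moreover have "t \<in> local_ring p" using loc by (simp add: t_def local_ring_diff)
    moreover have "\<exists>h1\<in>local_ring p. \<exists>w\<in>W. h = t * h1 + w" if "h \<in> local_ring p" "rval p h = 0" for h
      using maxd[OF that] is_idealD(4)[OF W _ sW] by (metis add.commute)
    ultimately have "m \<le> order y0 ?G" using dim_le_of_curvilinear[OF W _ _ _ r(5)] by blast
    then show False using ord rows r(6) by simp
  next
    assume A: "A = {(0, 0), (1, 0), (2, 0)}" and rows: "card (snd ` B) \<le> 2"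
    have "order x0 P \<le> degree P" using order_degree \<open>P \<noteq> 0\<close> by blast
    also have "degree P \<le> 2" by (simp add: P_def)
    finally have "s ^ 2 = s ^ order x0 P * s ^ (2 - order x0 P)" by (simp flip: power_add)
    then have s2: "s ^ 2 \<in> W" using is_idealD(4)[OF W _ s_pow] local_ring_power[OF s(1)] by simp
    have "order y0 ?G = 1" using ord ord1 rows by simp
    then obtain H where H: "?G = [:- y0, 1:] * H" "\<not> [:- y0, 1:] dvd H"
      using order_decomp[OF G, of y0] by auto
    define U where "U = peval H Y"
    have U: "U \<in> local_ring p" "rval p U \<noteq> 0"
      using peval_local[OF loc(2), of H] H(2) by (auto simp: U_def poly_eq_0_iff_dvd y0_def)
    have "peval ?G Y = t * U" unfolding H(1) peval_mult by (simp add: t_def U_def)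
    then have b: "?b = t * U + s * w" using w(2) by (simp add: algebra_simps)
    note Ui = local_ring_inverse[OF U]
    have t: "t = inverse U * ?b - s * (inverse U * w)" unfolding b using Ui(3)
        by (simp add: field_simps)
    have "\<exists>h1\<in>local_ring p. \<exists>w\<in>W. h = s * h1 + w" if hh: "h \<in> local_ring p" "rval p h = 0" for h
    proof -
      obtain h1 h2 where h: "h1 \<in> local_ring p" "h2 \<in> local_ring p" "h = s * h1 + t * h2"
          using maxd[OF hh] by blast
      have "h = s * (h1 - inverse U * w * h2) + (inverse U * h2) * ?b"
        unfolding h(3) by (subst t) (simp add: algebra_simps)
      moreover have "h1 - inverse U * w * h2 \<in> local_ring p" by (intro local_ring_intros h Ui w)
      moreover have "(inverse U * h2) * ?b \<in> W"
        by (intro is_idealD(3)[OF W _ generatesD(3)[OF r(2)]] local_ring_intros h Ui)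
      ultimately show ?thesis by blast
    qed
    then have "m \<le> 2" using dim_le_of_curvilinear[OF W s(1) s2 _ r(5)] by blast
    then show False using r(6) by simp
  qed
qed

lemma rows_no_high_multiplicity:
  assumes "unimodular e e'" and B: "finite B"
    and "A = {(0, 0), (1, 0)} \<and> card (snd ` B) \<le> 3 \<or> A = {(0, 0), (1, 0), (2, 0)} \<and> card (snd ` B) \<le> 2"
  shows "\<not> has_root_of_high_multiplicity (aff e e' u ` A) (aff e e' v ` B)"
proof -
  obtain w where w: "nonneg ((\<lambda>x. x + w) ` B)" using shift_to_nonneg[OF B] by blast
  have "snd ` (\<lambda>x. x + w) ` B = (\<lambda>i. i + snd w) ` snd ` B" by (simp add: image_image)
  then have "card (snd ` (\<lambda>x. x + w) ` B) \<le> card (snd ` B)" using B by (simp add: card_image_le)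
  then show ?thesis unfolding aff_shift[of e e' v B w]
    using assms(3) by (intro rows_no_high_multiplicity_nonneg[OF assms(1) finite_imageI[OF B] w])
        linarith
qed

lemma point_no_high_multiplicity:
  assumes "unimodular e e'" "finite B"
  shows "\<not> has_root_of_high_multiplicity (aff e e' u ` {(0, 0)}) (aff e e' v ` B)"
proof
  assume root: "has_root_of_high_multiplicity (aff e e' u ` {(0, 0)}) (aff e e' v ` B)"
  obtain p W C D m X Y where r: "coords p X Y" "generates p W (lpoly C {(0, 0)} X Y) (lpoly D B X Y)"
    "rval p (lpoly C {(0, 0)} X Y) = 0" "rval p (lpoly D B X Y) = 0"
        "quotient_has_dim (local_ring p) W m" "m > 2"
    by (rule root_in_frame[OF assms(1) _ assms(2) root]) simp
  have a: "lpoly C {(0, 0)} X Y = rat_const (C (0, 0))" by (simp add: lpoly_def)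
  then have "C (0, 0) = 0" using r(3) by simp
  then have "generates p W 0 (lpoly D B X Y)" using r(2) a by simp
  from no_finite_dim_zero[OF this lpoly_local(1)[OF r(1)] r(4)] show False using r(5) by blast
qed

section \<open>Symmetries of bad pairs\<close>

lemma aff_comp: "aff e e' u (aff f f' w x) = aff (aff e e' 0 f) (aff e e' 0 f') (aff e e' u w) x"
  by (simp add: aff_def algebra_simps)

lemma unimodular_comp:
  assumes "unimodular e e'" "unimodular f f'"
  shows "unimodular (aff e e' 0 f) (aff e e' 0 f')"
proof -
  have "cross (aff e e' 0 f) (aff e e' 0 f') = cross e e' * cross f f'"
    by (simp add: cross_def aff_def algebra_simps)
  then show ?thesis using assms by (auto simp: unimodular_def)
qed

lemma aff_inverse:
  assumes "unimodular e e'"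
  shows "\<exists>f f'. unimodular f f' \<and> (\<forall>u w. \<exists>w'. \<forall>x. aff f f' w' (aff e e' u x) = w + x)"
proof -
  obtain \<alpha> \<beta> \<gamma> \<delta> where db: "dual_basis e e' = ((\<alpha>, \<beta>), (\<gamma>, \<delta>))" by (metis surj_pair)
  note d = dual_basis_props[OF assms db]
  have "cross (\<alpha>, \<beta>) (\<gamma>, \<delta>) * cross e e' = (\<alpha> * fst e + \<gamma> * snd e) * (\<beta> * fst e'
      + \<delta> * snd e') - (\<beta> * fst e + \<delta> * snd e) * (\<alpha> * fst e' + \<gamma> * snd e')"
    by (simp add: cross_def algebra_simps)
  then have "cross (\<alpha>, \<beta>) (\<gamma>, \<delta>) * cross e e' = 1" using d by simp
  then have "unimodular (\<alpha>, \<beta>) (\<gamma>, \<delta>)" using assms by (auto simp: unimodular_def)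
  moreover have "aff (\<alpha>, \<beta>) (\<gamma>, \<delta>) (w - aff (\<alpha>, \<beta>) (\<gamma>, \<delta>) 0 u) (aff e e' u x) = w + x" for u w x
  proof -
    have a: "\<alpha> * (fst x * fst e + snd x * fst e') + \<gamma> * (fst x * snd e + snd x * snd e')
       = fst x * (\<alpha> * fst e + \<gamma> * snd e) + snd x * (\<alpha> * fst e' + \<gamma> * snd e')"
      by (simp add: algebra_simps)
    have b: "\<beta> * (fst x * fst e + snd x * fst e') + \<delta> * (fst x * snd e + snd x * snd e')
       = fst x * (\<beta> * fst e + \<delta> * snd e) + snd x * (\<beta> * fst e' + \<delta> * snd e')"
      by (simp add: algebra_simps)
    show ?thesis using a b unfolding d by (simp add: aff_def prod_eq_iff algebra_simps)
  qed
  ultimately show ?thesis by blast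
qed

text \<open>Frames can be composed, and every unimodular frame has an inverse.\<close>

lemma bad_aff_iff:
  assumes "unimodular e e'"
  shows "bad (aff e e' u ` A) (aff e e' v ` B) \<longleftrightarrow> bad A B"
proof
  assume "bad A B"
  then show "bad (aff e e' u ` A) (aff e e' v ` B)"
    unfolding bad_def image_image aff_comp using unimodular_comp[OF _ assms] by blast
next
  assume b: "bad (aff e e' u ` A) (aff e e' v ` B)"
  obtain f f' where f: "unimodular f f'" "\<forall>u w. \<exists>w'. \<forall>x. aff f f' w' (aff e e' u x) = w + x"
    using aff_inverse[OF assms] by blast
  obtain u' v' where u': "\<forall>x. aff f f' u' (aff e e' u x) = 0 + x"
      and v': "\<forall>x. aff f f' v' (aff e e' v x) = 0 + x"
    using f(2) by blast
  show "bad A B" unfolding bad_def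
  proof (intro allI impI)
    fix g g' w w' assume g: "unimodular g g'"
    have "has_root_of_high_multiplicity
      (aff (aff g g' 0 f) (aff g g' 0 f') (aff g g' w u') ` aff e e' u ` A)
      (aff (aff g g' 0 f) (aff g g' 0 f') (aff g g' w' v') ` aff e e' v ` B)"
      using b unimodular_comp[OF g f(1)] unfolding bad_def by blast
    then show "has_root_of_high_multiplicity (aff g g' w ` A) (aff g g' w' ` B)"
      unfolding aff_comp[symmetric] image_image using u' v' by simp
  qed
qed

lemma bad_shift: "bad A ((\<lambda>x. x + w) ` B) \<longleftrightarrow> bad A B"
proof -
  have u: "unimodular (1, 0) (0, 1)" by (simp add: unimodular_def cross_def)
  have "aff (1, 0) (0, 1) w = (\<lambda>x. x + w)" for w by (auto simp: aff_def fun_eq_iff prod_eq_iff)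
  then show ?thesis using bad_aff_iff[OF u, of 0 A w B] by simp
qed

lemma laurent_space_mono: "A \<subseteq> A' \<Longrightarrow> laurent_space A \<subseteq> laurent_space A'"
  by (auto simp: laurent_space_def)

lemma has_root_mono:
  assumes "has_root_of_high_multiplicity A B" "A \<subseteq> A'" "B \<subseteq> B'"
  shows "has_root_of_high_multiplicity A' B'"
  using assms laurent_space_mono unfolding has_root_of_high_multiplicity_def by blast

lemma bad_mono: "bad A B \<Longrightarrow> A \<subseteq> A' \<Longrightarrow> B \<subseteq> B' \<Longrightarrow> bad A' B'"
  unfolding bad_def by (intro allI impI) (elim allE impE, assumption, erule has_root_mono, (erule
      image_mono)+)

lemma has_root_commute:
  assumes "has_root_of_high_multiplicity A B"
  shows "has_root_of_high_multiplicity B A"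
proof -
  obtain f g p m where r: "f \<in> laurent_space A" "g \<in> laurent_space B" "root_of_multiplicity f g p m"
      "m > 2"
    using assms unfolding has_root_of_high_multiplicity_def by blast
  have "solutions f g = solutions g f" by (auto simp: solutions_def)
  then have "root_of_multiplicity g f p m"
    using r(3) unfolding root_of_multiplicity_def by (simp add: local_ideal_commute[of p f g])
  then show ?thesis unfolding has_root_of_high_multiplicity_def
    by (intro bexI[OF _ r(2)] bexI[OF _ r(1)] exI[of _ p] exI[of _ m] conjI r(4))
qed

lemma bad_commute: "bad A B \<longleftrightarrow> bad B A"
proof -
  have "bad B A" if b: "bad A B" for A B
    unfolding bad_def
  proof (intro allI impI)
    fix e e' u v assume "unimodular e e'"
    then show "has_root_of_high_multiplicity (aff e e' u ` B) (aff e e' v ` A)"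
      using b unfolding bad_def by (intro has_root_commute[of "aff e e' v ` A"]) blast
  qed
  then show ?thesis by blast
qed

lemma bad_imp_has_root:
  assumes "bad A B"
  shows "has_root_of_high_multiplicity A B"
proof -
  have "aff (1, 0) (0, 1) 0 = (\<lambda>x. x)" by (auto simp: aff_def fun_eq_iff prod_eq_iff)
  moreover have "unimodular (1, 0) (0, 1)" by (simp add: unimodular_def cross_def)
  ultimately show ?thesis using assms unfolding bad_def by (metis image_ident)
qed

section \<open>Orders of vanishing along an arc\<close>

text \<open>Polynomials in a function \<open>\<zeta>\<close> that tends to 0 vanish to the order of their lowest term.\<close>

lemma coeff_eq_0_of_bigo:
  fixes \<zeta> :: "complex \<Rightarrow> complex"
  assumes "(\<zeta> \<longlongrightarrow> 0) (at 0)" "eventually (\<lambda>z. \<zeta> z \<noteq> 0) (at 0)"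
    and "(\<lambda>z. poly P (\<zeta> z)) \<in> O[at 0](\<lambda>z. \<zeta> z ^ k)" "i < k"
  shows "coeff P i = 0"
  using assms(3,4)
proof (induction k arbitrary: P i)
  case (Suc k)
  have "((\<lambda>z. \<zeta> z ^ Suc k) \<longlongrightarrow> 0 ^ Suc k) (at 0)" by (intro tendsto_intros assms)
  then have "((\<lambda>z. poly P (\<zeta> z)) \<longlongrightarrow> 0) (at 0)"
  proof -
    assume "((\<lambda>z. \<zeta> z ^ Suc k) \<longlongrightarrow> 0 ^ Suc k) (at 0)"
    then have "(\<lambda>z. \<zeta> z ^ Suc k) \<in> o[at 0](\<lambda>_. 1)" by (intro smalloI_tendsto) simp_all
    then have "(\<lambda>z. poly P (\<zeta> z)) \<in> o[at 0](\<lambda>_. 1)" using Suc.prems(1) landau_o.big_small_trans by blast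
    then show ?thesis using smalloD_tendsto by force
  qed
  moreover have "((\<lambda>z. poly P (\<zeta> z)) \<longlongrightarrow> poly P 0) (at 0)" by (intro tendsto_intros assms)
  ultimately have "poly P 0 = 0" using tendsto_unique by (metis trivial_limit_at)
  then obtain Q where P: "P = pCons 0 Q" by (cases P) auto
  have "(\<lambda>z. \<zeta> z * poly Q (\<zeta> z)) \<in> O[at 0](\<lambda>z. \<zeta> z * \<zeta> z ^ k)"
    using Suc.prems(1) by (simp add: P)
  then have Q: "(\<lambda>z. poly Q (\<zeta> z)) \<in> O[at 0](\<lambda>z. \<zeta> z ^ k)"
    by (rule iffD1[OF landau_o.big.mult_cancel_left[OF bigtheta_refl assms(2)]])
  show ?case
  proof (cases i)
    case 0 then show ?thesis by (simp add: P)
  next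
    case (Suc j)
    have "coeff Q j = 0" by (rule Suc.IH[OF Q]) (use Suc.prems(2) Suc in simp)
    then show ?thesis by (simp add: P Suc)
  qed
next
  case 0
  from 0(2) show ?case by simp
qed

lemma bigo_poly_dvd:
  fixes \<zeta> :: "complex \<Rightarrow> complex"
  assumes "T ^ k dvd P" "((\<lambda>z. \<zeta> z) \<longlongrightarrow> a) (at 0)" "\<And>z. poly T (\<zeta> z) = z"
  shows "(\<lambda>z. poly P (\<zeta> z)) \<in> O[at 0](\<lambda>z. z ^ k)"
proof -
  obtain Q where P: "P = T ^ k * Q" using assms(1) by (rule dvdE)
  have "((\<lambda>z. poly Q (\<zeta> z)) \<longlongrightarrow> poly Q a) (at 0)" by (intro tendsto_intros assms)
  then have "(\<lambda>z. poly Q (\<zeta> z)) \<in> O[at 0](\<lambda>_. 1)"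
      by (intro bigoI_tendsto[where c = "poly Q a"]) simp_all
  from landau_o.big.mult[OF this landau_o.big_refl[of "\<lambda>z. z ^ k" "at 0"]]
  show ?thesis unfolding P by (simp add: assms(3) mult.commute)
qed

lemma lpolyv_psubst:
  assumes "nonneg B"
  shows "lpolyv D B (poly \<phi> z) (poly \<psi> z) = poly (psubst D B \<phi> \<psi>) z"
  unfolding lpolyv_def psubst_def using assms
  by (simp add: poly_sum nonneg_def power_int_def)

lemma truncated_binomial2:
  fixes T :: "'a :: comm_ring_1"
  shows "T ^ 2 dvd (1 + T) ^ n - (1 + of_nat n * T)"
proof (induction n)
  case (Suc n)
  then obtain R where R: "(1 + T) ^ n - (1 + of_nat n * T) = T ^ 2 * R" by (rule dvdE)
  have "(1 + T) ^ Suc n - (1 + of_nat (Suc n) * T) = (1 + T) * ((1 + T) ^ n - (1 + of_nat n * T))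
      + of_nat n * T ^ 2"
    by (simp add: algebra_simps power2_eq_square)
  also have "\<dots> = T ^ 2 * ((1 + T) * R + of_nat n)" unfolding R by (simp add: algebra_simps)
  finally show ?case by (rule dvdI)
qed simp

lemma truncated_binomial3:
  fixes T :: "'a :: comm_ring_1"
  shows "T ^ 3 dvd (1 + T) ^ n - (1 + of_nat n * T + of_nat (n choose 2) * T ^ 2)"
proof (induction n)
  case (Suc n)
  then obtain R where R: "(1 + T) ^ n - (1 + of_nat n * T + of_nat (n choose 2) * T ^ 2) = T ^ 3 * R"
      by (rule dvdE)
  have c: "of_nat (Suc n choose 2) = of_nat n + (of_nat (n choose 2) :: 'a)"
    by (simp add: numeral_2_eq_2)
  have "(1 + T) ^ Suc n - (1 + of_nat (Suc n) * T + of_nat (Suc n choose 2) * T ^ 2)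
     = (1 + T) * ((1 + T) ^ n - (1 + of_nat n * T + of_nat (n choose 2) * T ^ 2))
         + of_nat (n choose 2) * T ^ 3"
    unfolding c by (simp add: algebra_simps power2_eq_square power3_eq_cube)
  also have "\<dots> = T ^ 3 * ((1 + T) * R + of_nat (n choose 2))" unfolding R by (simp add: algebra_simps)
  finally show ?case by (rule dvdI)
qed (simp add: binomial_eq_0)

lemma dvd_diff_mult:
  fixes d :: "'a :: comm_ring_1"
  assumes "d dvd a - a'" "d dvd b - b'" "d dvd a' * b' - e"
  shows "d dvd a * b - e"
proof -
  have "a * b - e = (a - a') * b + a' * (b - b') + (a' * b' - e)" by (simp add: algebra_simps)
  then show ?thesis by (simp only:) (intro dvd_add dvd_mult dvd_mult2 assms)
qed

text \<open>The expansion of the monomial \<open>x\<^sup>i y\<^sup>j\<close> along a line, up to order 2.\<close>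

lemma truncated_line_monomial:
  fixes T L :: "'a :: comm_ring_1"
  shows "T ^ 3 dvd (1 + T) ^ i * (1 + L * T) ^ j - (1 + (of_nat i + L * of_nat j) * T +
    (of_nat (i choose 2) + L * of_nat i * of_nat j + L ^ 2 * of_nat (j choose 2)) * T ^ 2)"
proof (rule dvd_diff_mult[OF truncated_binomial3])
  have "T ^ 3 dvd (L * T) ^ 3" by (simp add: power_mult_distrib)
  then show "T ^ 3 dvd (1 + L * T) ^ j - (1 + of_nat j * (L * T) + of_nat (j choose 2) * (L * T) ^ 2)"
    using truncated_binomial3[of "L * T" j] dvd_trans by blast
  have "(1 + of_nat i * T + of_nat (i choose 2) * T\<^sup>2) * (1 + of_nat j * (L * T)
      + of_nat (j choose 2) * (L * T)\<^sup>2) -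
    (1 + (of_nat i + L * of_nat j) * T + (of_nat (i choose 2) + L * of_nat i * of_nat j
        + L ^ 2 * of_nat (j choose 2)) * T ^ 2)
    = T ^ 3 * (of_nat i * L ^ 2 * of_nat (j choose 2) + of_nat (i choose 2) * of_nat j * L
       + T * L ^ 2 * of_nat (i choose 2) * of_nat (j choose 2))"
    by (simp add: algebra_simps power2_eq_square power3_eq_cube)
  then show "T ^ 3 dvd (1 + of_nat i * T + of_nat (i choose 2) * T\<^sup>2) * (1 + of_nat j * (L * T)
      + of_nat (j choose 2) * (L * T)\<^sup>2) -
    (1 + (of_nat i + L * of_nat j) * T + (of_nat (i choose 2) + L * of_nat i * of_nat j
        + L ^ 2 * of_nat (j choose 2)) * T ^ 2)"
    by (rule dvdI)
qed

lemma two_choose_2: "2 * (of_nat (n choose 2) :: complex) = of_nat n ^ 2 - of_nat n"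
  by (induction n) (auto simp: numeral_2_eq_2 algebra_simps)

text \<open>The three sums are the coefficients of the restriction to the line at \<open>(1, 1)\<close> up to
  order 2, the last one up to the factor 2.\<close>

lemma dvd_psubst_line:
  assumes "nonneg B"
    and "(\<Sum>x\<in>B. D x) = 0" "(\<Sum>x\<in>B. D x * (of_int (fst x) + \<mu> * of_int (snd x))) = 0"
    and "(\<Sum>x\<in>B. D x * ((of_int (fst x) + \<mu> * of_int (snd x)) ^ 2 - of_int (fst x) - \<mu> ^ 2 * of_int (snd
        x))) = 0"
  shows "[:-1, 1:] ^ 3 dvd psubst D B [:0, 1:] [:1 - \<mu>, \<mu>:]"
proof -
  let ?T = "[:-1, 1:] :: complex poly"
  define \<theta> where "\<theta> = (\<lambda>x :: int \<times> int. of_int (fst x) + \<mu> * of_int (snd x))"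
  define q where "q = (\<lambda>x :: int \<times> int. (\<theta> x ^ 2 - of_int (fst x) - \<mu> ^ 2 * of_int (snd x)) / 2)"
  define E where "E = (\<lambda>x. 1 + smult (\<theta> x) ?T + smult (q x) (?T ^ 2))"
  have "?T ^ 3 dvd [:0, 1:] ^ nat (fst x) * [:1 - \<mu>, \<mu>:] ^ nat (snd x) - E x" if x: "x \<in> B" for x
  proof -
    define i j where "i = nat (fst x)" and "j = nat (snd x)"
    have ij: "of_int (fst x) = (of_nat i :: complex)" "of_int (snd x) = (of_nat j :: complex)"
      using x assms(1) by (auto simp: i_def j_def nonneg_def)
    have "2 * q x = \<theta> x ^ 2 - of_nat i - \<mu> ^ 2 * of_nat j" by (simp add: q_def ij)
    also have "\<dots> = 2 * (of_nat (i choose 2) + \<mu> * of_nat i * of_nat j + \<mu> ^ 2 * of_nat (j choose 2))"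
      unfolding distrib_left two_choose_2 mult.left_commute[of 2 "\<mu> ^ 2"] \<theta>_def ij
      by (simp add: algebra_simps power2_eq_square)
    finally have q: "q x = of_nat (i choose 2) + \<mu> * of_nat i * of_nat j + \<mu> ^ 2 * of_nat (j choose 2)"
      by (metis mult_cancel_left zero_neq_numeral)
    have e1: "[:0, 1:] = 1 + ?T" "[:1 - \<mu>, \<mu>:] = 1 + [:\<mu>:] * ?T" by (simp_all add: one_pCons)
    have e2: "1 + (of_nat i + [:\<mu>:] * of_nat j) * ?T +
      (of_nat (i choose 2) + [:\<mu>:] * of_nat i * of_nat j + [:\<mu>:] ^ 2 * of_nat (j choose 2)) * ?T ^ 2
          = E x"
      unfolding E_def q \<theta>_def ij by (simp add: of_nat_poly power2_eq_square)
    show ?thesis unfolding i_def[symmetric] j_def[symmetric] e1 e2[symmetric]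
        by (rule truncated_line_monomial)
  qed
  then have "?T ^ 3 dvd (\<Sum>x\<in>B. smult (D x) ([:0, 1:] ^ nat (fst x) * [:1 - \<mu>, \<mu>:] ^ nat (snd x) - E x))"
    by (intro dvd_sum dvd_smult)
  also have "(\<Sum>x\<in>B. smult (D x) ([:0, 1:] ^ nat (fst x) * [:1 - \<mu>, \<mu>:] ^ nat (snd x) - E x))
     = psubst D B [:0, 1:] [:1 - \<mu>, \<mu>:] - (\<Sum>x\<in>B. smult (D x) (E x))"
    by (simp add: psubst_def smult_diff_right sum_subtractf)
  also have "(\<Sum>x\<in>B. smult (D x) (E x)) = smult (\<Sum>x\<in>B. D x) 1 + smult (\<Sum>x\<in>B. D x * \<theta> x) ?T
      + smult (\<Sum>x\<in>B. D x * q x) (?T ^ 2)"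
    unfolding E_def smult_sum by (simp only: smult_add_right sum.distrib smult_smult)
  also have "(\<Sum>x\<in>B. D x * q x) = (\<Sum>x\<in>B. D x * (\<theta> x ^ 2 - of_int (fst x) - \<mu> ^ 2 * of_int (snd x))) / 2"
    unfolding q_def sum_divide_distrib by simp
  finally show ?thesis using assms unfolding \<theta>_def by simp
qed

section \<open>Bad pairs\<close>

text \<open>The line \<open>Y = 1 + \<mu> (X - 1)\<close> and a curve that has contact of order at least 3 with
  it at \<open>(1, 1)\<close>, and does not contain it. The case \<open>\<mu> = 0\<close> is allowed, in which \<open>A\<close> may have
  two points only.\<close>

lemma bad_line:
  assumes A: "finite A" and B: "finite B" "nonneg B"
    and C: "\<And>X Y. lpoly C A X Y = Y - (rat_const \<mu> * X + rat_const (1 - \<mu>))"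
    and Cv: "\<And>X Y. lpolyv C A X Y = Y - (\<mu> * X + (1 - \<mu>))"
    and G: "psubst D B [:0, 1:] [:1 - \<mu>, \<mu>:] \<noteq> 0" "[:-1, 1:] ^ 3 dvd psubst D B [:0, 1:] [:1 - \<mu>, \<mu>:]"
  shows "bad A B"
proof (rule bad_by_arc[OF A B(1), where \<xi> = "\<lambda>z. 1 + z" and \<eta> = "\<lambda>z. 1 + \<mu> * z" and k = 3
      and \<alpha> = "\<lambda>i. i" and \<beta> = "\<lambda>_. 0" and C = C and D = D])
  let ?G = "psubst D B [:0, 1:] [:1 - \<mu>, \<mu>:]"
  have t: "((\<lambda>z. 1 + c * z) \<longlongrightarrow> 1 + c * 0) (at 0)" for c :: complex by (intro tendsto_intros)
  then show t1: "((\<lambda>z. 1 + z) \<longlongrightarrow> 1) (at (0 :: complex))" and "((\<lambda>z. 1 + \<mu> * z) \<longlongrightarrow> 1) (at 0)"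
    using t[of 1] t[of \<mu>] by simp_all
  show "lpolyv C A 1 1 = 0" by (simp add: Cv)
  have G': "lpolyv D B (1 + z) (1 + \<mu> * z) = poly ?G (1 + z)" for z
    using lpolyv_psubst[OF B(2), of D "[:0, 1:]" "1 + z" "[:1 - \<mu>, \<mu>:]"] by (simp add: algebra_simps)
  have "[:-1, 1:] dvd ?G" using G(2) by (metis dvd_mult_left power3_eq_cube mult.assoc)
  then have "poly ?G 1 = 0" by (metis poly_eq_0_iff_dvd)
  then show "lpolyv D B 1 1 = 0" using G'[of 0] by simp
  have "lpolyv C A (1 + z) (1 + \<mu> * z) = 0" for z by (simp add: Cv algebra_simps)
  then show "(\<lambda>z. lpolyv C A (1 + z) (1 + \<mu> * z)) \<in> O[at 0](\<lambda>z. z ^ 3)" by simp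
  show "(\<lambda>z. lpolyv D B (1 + z) (1 + \<mu> * z)) \<in> O[at 0](\<lambda>z. z ^ 3)"
    unfolding G' by (rule bigo_poly_dvd[OF G(2) t1]) simp
next
  fix p W X Y
  assume W: "is_ideal p W" and loc: "X \<in> local_ring p" "Y \<in> local_ring p" "rval p X = 1" "rval p Y = 1"
    and mem: "lpoly C A X Y \<in> W" "lpoly D B X Y \<in> W"
  let ?G = "psubst D B [:0, 1:] [:1 - \<mu>, \<mu>:]"
  have "Y - peval [:1 - \<mu>, \<mu>:] X \<in> W" using mem(1) unfolding C by (simp add: algebra_simps)
  then have "lpoly D B X Y - peval ?G X \<in> W"
    using lpoly_psubst[OF W loc(1,2,1) _ _ B(2), of "[:0, 1:]" "[:1 - \<mu>, \<mu>:]"] is_idealD(1)[OF W]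
        by simp
  then have "peval ?G X \<in> W" using is_ideal_diff[OF W mem(2)] by force
  from power_order_in_ideal[OF W loc(1) G(1) this]
  have X: "(X - 1) ^ order 1 ?G \<in> W" by (simp add: loc)
  have "(Y - 1) - rat_const \<mu> * (X - 1) \<in> W" using mem(1) unfolding C by (simp add: algebra_simps)
  from power_diff_in_ideal[OF W _ _ this, of "order 1 ?G"]
  have "(Y - 1) ^ order 1 ?G - (rat_const \<mu> * (X - 1)) ^ order 1 ?G \<in> W"
    using loc by (simp add: local_ring_diff local_ring_mult)
  moreover have "(rat_const \<mu> * (X - 1)) ^ order 1 ?G \<in> W"
    unfolding power_mult_distrib
    by (intro is_idealD(3)[OF W _ X]) (use local_ring_power[OF local_ring_const(1)] in blast)
  ultimately have "((Y - 1) ^ order 1 ?G - (rat_const \<mu> * (X - 1)) ^ order 1 ?G)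
      + (rat_const \<mu> * (X - 1)) ^ order 1 ?G \<in> W"
    by (rule is_idealD(2)[OF W])
  then show "\<exists>N. (X - 1) ^ N \<in> W \<and> (Y - 1) ^ N \<in> W" using X by auto
next
  fix d :: "nat \<Rightarrow> complex" and i :: nat
  assume *: "(\<lambda>z. \<Sum>i<3. d i * ((1 + z - 1) ^ i * (1 + \<mu> * z - 1) ^ 0)) \<in> O[at 0](\<lambda>z. z ^ 3)"
      and i: "i < 3"
  let ?P = "\<Sum>i<3. monom (d i) i"
  have "(\<lambda>z. poly ?P z) \<in> O[at 0](\<lambda>z. z ^ 3)" using * by (simp add: poly_sum poly_monom)
  then have "coeff ?P i = 0"
    by (rule coeff_eq_0_of_bigo[rotated 2, OF _ i]) (auto intro: tendsto_ident_at simp: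
        eventually_at_filter)
  moreover have "coeff ?P i = d i" using i by (simp only: coeff_sum coeff_monom) (simp add: sum.delta)
  ultimately show "d i = 0" by simp
qed

lemma sum_nonzero_distinct_degrees:
  fixes f :: "'i \<Rightarrow> complex poly"
  assumes "finite B" "x1 \<in> B" "f x1 \<noteq> 0" "inj_on (\<lambda>x. degree (f x)) B"
  shows "sum f B \<noteq> 0"
proof -
  let ?N = "{x \<in> B. f x \<noteq> 0}"
  have fin: "finite ?N" "?N \<noteq> {}" using assms by auto
  obtain x0 where x0: "x0 \<in> ?N" "\<And>x. x \<in> ?N \<Longrightarrow> degree (f x) \<le> degree (f x0)"
  proof -
    let ?d = "\<lambda>x. degree (f x)"
    have "Max (?d ` ?N) \<in> ?d ` ?N" using fin by (intro Max_in) auto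
    then obtain x0 where "x0 \<in> ?N" "?d x0 = Max (?d ` ?N)" by auto
    moreover have "?d x \<le> Max (?d ` ?N)" if "x \<in> ?N" for x using that fin by (intro Max_ge) auto
    ultimately show ?thesis using that[of x0] by simp
  qed
  have "coeff (f x) (degree (f x0)) = 0" if "x \<in> B - {x0}" for x
  proof (cases "f x = 0")
    case False
    then have "degree (f x) \<le> degree (f x0)" using x0 that by blast
    moreover have "degree (f x) \<noteq> degree (f x0)" using that x0 assms(4) by (auto dest: inj_onD)
    ultimately show ?thesis by (intro coeff_eq_0) simp
  qed simp
  then have "coeff (sum f B) (degree (f x0)) = coeff (f x0) (degree (f x0))"
    using x0(1) assms(1) by (simp add: coeff_sum sum.remove[of B x0])
  then show ?thesis using x0(1) by auto
qed

text \<open>The terms of the restriction to a line have distinct degrees, so no cancellation of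
  leading terms takes place.\<close>

lemma psubst_line_nonzero:
  assumes B: "finite B" "nonneg B" "x1 \<in> B" "D x1 \<noteq> 0" and c: "degree \<psi> = n" "\<psi> \<noteq> 0"
    and inj: "inj_on (\<lambda>x. fst x + int n * snd x) B" and D: "\<And>x. x \<in> B \<Longrightarrow> D x \<noteq> 0"
  shows "psubst D B [:0, 1:] \<psi> \<noteq> 0"
  unfolding psubst_def
proof (rule sum_nonzero_distinct_degrees[OF B(1,3)])
  have deg: "degree (smult (D x) ([:0, 1:] ^ nat (fst x) * \<psi> ^ nat (snd x))) = nat (fst x)
      + n * nat (snd x)" if "x \<in> B" for x
    using D[OF that] c by (simp add: degree_mult_eq degree_power_eq)
  show "smult (D x1) ([:0, 1:] ^ nat (fst x1) * \<psi> ^ nat (snd x1)) \<noteq> 0" using B c by simp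
  show "inj_on (\<lambda>x. degree (smult (D x) ([:0, 1:] ^ nat (fst x) * \<psi> ^ nat (snd x)))) B"
  proof (rule inj_onI)
    fix x y assume xy: "x \<in> B" "y \<in> B"
      and "degree (smult (D x) ([:0, 1:] ^ nat (fst x) * \<psi> ^ nat (snd x)))
          = degree (smult (D y) ([:0, 1:] ^ nat (fst y) * \<psi> ^ nat (snd y)))"
    then have "nat (fst x) + n * nat (snd x) = nat (fst y) + n * nat (snd y)" by (simp only: deg)
    then have "int (nat (fst x) + n * nat (snd x)) = int (nat (fst y) + n * nat (snd y))" by simp
    then have "fst x + int n * snd x = fst y + int n * snd y"
      using xy B(2) by (simp add: nonneg_def)
    then show "x = y" using inj xy by (auto dest: inj_onD)
  qed
qed

text \<open>The coefficients of the trinomial are determined, up to a factor, by its vanishing at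
  \<open>(1, 1)\<close> and its tangent there; the last hypothesis is then the condition for contact of
  order 3.\<close>

lemma bad_triangle:
  fixes \<mu> :: complex and \<theta> \<rho> :: "int \<times> int \<Rightarrow> complex"
  assumes \<theta>_def: "\<And>x. \<theta> x = of_int (fst x) + \<mu> * of_int (snd x)"
    and \<rho>_def: "\<And>x. \<rho> x = \<theta> x ^ 2 - of_int (fst x) - \<mu> ^ 2 * of_int (snd x)"
    and nn: "nonneg {b0, b1, b2}" and \<mu>: "\<mu> \<noteq> 0"
    and z: "fst b0 + snd b0 \<noteq> fst b1 + snd b1" "fst b0 + snd b0 \<noteq> fst b2 + snd b2"
        "fst b1 + snd b1 \<noteq> fst b2 + snd b2"
    and \<theta>: "\<theta> b0 \<noteq> \<theta> b1" "\<theta> b0 \<noteq> \<theta> b2" "\<theta> b1 \<noteq> \<theta> b2"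
    and Q: "(\<theta> b1 - \<theta> b2) * \<rho> b0 + (\<theta> b2 - \<theta> b0) * \<rho> b1 + (\<theta> b0 - \<theta> b1) * \<rho> b2 = 0"
  shows "bad standard_simplex {b0, b1, b2}"
proof -
  have ne: "b0 \<noteq> b1" "b0 \<noteq> b2" "b1 \<noteq> b2" using z by auto
  \<comment> \<open>The only weights, up to a factor, for which the value and the first derivative along the
    line vanish.\<close>
  define D where "D = (\<lambda>x. if x = b0 then \<theta> b1 - \<theta> b2 else if x = b1 then \<theta> b2 - \<theta> b0 else \<theta> b0 - \<theta> b1)"
  define C :: "int \<times> int \<Rightarrow> complex" where "C = (\<lambda>x. if x = (0, 1) then 1 else
      if x = (1, 0) then - \<mu> else - (1 - \<mu>))"
  let ?B = "{b0, b1, b2}" and ?\<psi> = "[:1 - \<mu>, \<mu>:]"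
  have sum: "(\<Sum>x\<in>?B. D x * h x) = (\<theta> b1 - \<theta> b2) * h b0 + (\<theta> b2 - \<theta> b0) * h b1 + (\<theta> b0 - \<theta> b1) * h b2"
      for h
    using ne by (simp add: D_def)
  have D: "D x \<noteq> 0" if "x \<in> ?B" for x using that \<theta> by (auto simp: D_def)
  show ?thesis
  proof (rule bad_line[where C = C and D = D and \<mu> = \<mu>, OF _ _ nn])
    show "psubst D ?B [:0, 1:] ?\<psi> \<noteq> 0"
      by (rule psubst_line_nonzero[where n = 1 and ?x1.0 = b0])
        (use nn \<mu> D z in \<open>auto simp: inj_on_def\<close>)
    show "[:-1, 1:] ^ 3 dvd psubst D ?B [:0, 1:] ?\<psi>"
    proof (rule dvd_psubst_line[OF nn])
      show "sum D ?B = 0" using sum[of "\<lambda>_. 1"] by simp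
      show "(\<Sum>x\<in>?B. D x * (of_int (fst x) + \<mu> * of_int (snd x))) = 0"
        unfolding sum unfolding \<theta>_def by (simp add: algebra_simps)
      show "(\<Sum>x\<in>?B. D x * ((of_int (fst x) + \<mu> * of_int (snd x))\<^sup>2 - of_int (fst x) - \<mu>\<^sup>2 * of_int (snd
          x))) = 0"
        unfolding sum using Q by (simp only: \<rho>_def \<theta>_def)
    qed
  qed (auto simp: lpoly_def lpolyv_def standard_simplex_def C_def algebra_simps)
qed

text \<open>The pair consists of \<open>Y = 1\<close> and a polynomial whose restriction has four terms and a
  triple root at 1.\<close>

lemma bad_four_columns:
  assumes nn: "nonneg {b1, b2, b3, b4}"
    and ne: "fst b1 \<noteq> fst b2" "fst b1 \<noteq> fst b3" "fst b1 \<noteq> fst b4" "fst b2 \<noteq> fst b3" "fst b2 \<noteq> fst b4"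
        "fst b3 \<noteq> fst b4"
  shows "bad {(0, 0), (0, 1)} {b1, b2, b3, b4}"
proof -
  let ?B = "{b1, b2, b3, b4}"
  define h :: "int \<times> int \<Rightarrow> complex" where "h = (\<lambda>x. of_int (fst x))"
  have hne: "h b1 \<noteq> h b2" "h b1 \<noteq> h b3" "h b1 \<noteq> h b4" "h b2 \<noteq> h b3" "h b2 \<noteq> h b4" "h b3 \<noteq> h b4"
    using ne by (simp_all add: h_def)
  \<comment> \<open>The weights of the third divided difference, which annihilates polynomials of degree at
    most 2, multiplied by the Vandermonde determinant.\<close>
  define g1 g2 g3 g4 where "g1 = (h b2 - h b3) * (h b2 - h b4) * (h b3 - h b4)"
    and "g2 = - ((h b1 - h b3) * (h b1 - h b4) * (h b3 - h b4))"
    and "g3 = (h b1 - h b2) * (h b1 - h b4) * (h b2 - h b4)"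
    and "g4 = - ((h b1 - h b2) * (h b1 - h b3) * (h b2 - h b3))"
  define D where "D = (\<lambda>x. if x = b1 then g1 else if x = b2 then g2 else if x = b3 then g3 else g4)"
  define C :: "int \<times> int \<Rightarrow> complex" where "C = (\<lambda>x. if x = (0, 1) then 1 else - 1)"
  have sum: "(\<Sum>x\<in>?B. D x * k x) = g1 * k b1 + g2 * k b2 + g3 * k b3 + g4 * k b4" for k
  proof -
    have "b1 \<noteq> b2" "b1 \<noteq> b3" "b1 \<noteq> b4" "b2 \<noteq> b3" "b2 \<noteq> b4" "b3 \<noteq> b4" using ne by auto
    then show ?thesis by (simp add: D_def add.assoc)
  qed
  have s0: "g1 + g2 + g3 + g4 = 0" and s1: "g1 * h b1 + g2 * h b2 + g3 * h b3 + g4 * h b4 = 0"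
    and s2: "g1 * h b1 ^ 2 + g2 * h b2 ^ 2 + g3 * h b3 ^ 2 + g4 * h b4 ^ 2 = 0"
    unfolding g1_def g2_def g3_def g4_def by algebra+
  have D: "D x \<noteq> 0" if "x \<in> ?B" for x using that hne by (auto simp: D_def g1_def g2_def g3_def g4_def)
  show ?thesis
  proof (rule bad_line[where C = C and D = D and \<mu> = 0, OF _ _ nn])
    show "psubst D ?B [:0, 1:] [:1 - 0, 0:] \<noteq> 0"
      by (rule psubst_line_nonzero[where n = 0 and ?x1.0 = b1])
        (use nn D ne in \<open>auto simp: inj_on_def\<close>)
    show "[:-1, 1:] ^ 3 dvd psubst D ?B [:0, 1:] [:1 - 0, 0:]"
    proof (rule dvd_psubst_line[OF nn])
      show "sum D ?B = 0" using sum[of "\<lambda>_. 1"] s0 by simp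
      show "(\<Sum>x\<in>?B. D x * (of_int (fst x) + 0 * of_int (snd x))) = 0"
        unfolding sum using s1 by (simp add: h_def)
      have "g1 * (h b1 ^ 2 - h b1) + g2 * (h b2 ^ 2 - h b2) + g3 * (h b3 ^ 2 - h b3)
          + g4 * (h b4 ^ 2 - h b4) = 0"
        using s1 s2 by algebra
      then show "(\<Sum>x\<in>?B. D x * ((of_int (fst x) + 0 * of_int (snd x))\<^sup>2 - of_int (fst x) - 0\<^sup>2 * of_int
          (snd x))) = 0"
        unfolding sum by (simp add: h_def)
    qed
  qed (auto simp: lpoly_def lpolyv_def C_def algebra_simps)
qed

text \<open>Modulo \<open>X - 1\<close> the second equation is a polynomial in \<open>Y\<close>, the \<open>j\<close>-th power of which
  lies in the ideal since \<open>(X - 1)\<^sup>j\<close> does.\<close>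

lemma nilpotent_double_line:
  assumes W: "is_ideal p W" and loc: "X \<in> local_ring p" "Y \<in> local_ring p" "rval p X = 1" "rval p Y = 1"
    and mem: "(X - 1) ^ j \<in> W" "lpoly D B X Y \<in> W" and B: "nonneg B"
        and G: "psubst D B [:1:] [:0, 1:] \<noteq> 0"
  shows "\<exists>N. (X - 1) ^ N \<in> W \<and> (Y - 1) ^ N \<in> W"
proof -
  let ?G = "psubst D B [:1:] [:0, 1:]" and ?b = "lpoly D B X Y"
  have X1: "X - 1 \<in> local_ring p" using loc by (simp add: local_ring_diff)
  note P = principal_is_ideal[OF X1]
  have "?b - peval ?G Y \<in> principal p (X - 1)"
    by (rule lpoly_psubst[OF P loc(1,2,2) _ _ B]) (use principal_self is_idealD(1)[OF P] in auto)
  then obtain k where k: "k \<in> local_ring p" "?b - peval ?G Y = (X - 1) * k" unfolding principal_def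
      by blast
  have v: "- k * (X - 1) \<in> local_ring p" by (intro local_ring_intros k X1)
  have "peval ?G Y - (- k * (X - 1)) = ?b" using k(2) by (simp add: algebra_simps)
  then have "peval ?G Y ^ j - (- k * (X - 1)) ^ j \<in> W"
    using power_diff_in_ideal[OF W peval_local[OF loc(2), THEN conjunct1] v] mem(2) by simp
  moreover have "(- k * (X - 1)) ^ j \<in> W" unfolding power_mult_distrib
    by (intro is_idealD(3)[OF W _ mem(1)] local_ring_power[THEN conjunct1] local_ring_uminus k)
  ultimately have "(peval ?G Y ^ j - (- k * (X - 1)) ^ j) + (- k * (X - 1)) ^ j \<in> W"
      by (rule is_idealD(2)[OF W])
  then have "peval (?G ^ j) Y \<in> W" by (simp add: peval_power)
  from power_order_in_ideal[OF W loc(2) _ this] G obtain M where M: "(Y - 1) ^ M \<in> W"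
      by (auto simp: loc)
  have Y1: "Y - 1 \<in> local_ring p" using loc by (simp add: local_ring_diff)
  have "(X - 1) ^ (j + M) \<in> W" "(Y - 1) ^ (j + M) \<in> W" unfolding power_add
    using is_idealD(4)[OF W _ mem(1)] is_idealD(3)[OF W _ M] local_ring_power X1 Y1 by blast+
  then show ?thesis by blast
qed

lemma psubst_rows_nonzero:
  assumes B: "finite B" "nonneg B" "x1 \<in> B" "D x1 \<noteq> 0" and inj: "inj_on snd B" and D: "\<And>x. x \<in> B
      \<Longrightarrow> D x \<noteq> 0"
  shows "psubst D B [:1:] [:0, 1:] \<noteq> 0"
  unfolding psubst_def
proof (rule sum_nonzero_distinct_degrees[OF B(1,3)])
  have deg: "degree (smult (D x) ([:1:] ^ nat (fst x) * [:0, 1:] ^ nat (snd x))) = nat (snd x)"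
      if "x \<in> B" for x
    using D[OF that] by (simp add: degree_mult_eq degree_power_eq)
  show "smult (D x1) ([:1:] ^ nat (fst x1) * [:0, 1:] ^ nat (snd x1)) \<noteq> 0" using B by simp
  show "inj_on (\<lambda>x. degree (smult (D x) ([:1:] ^ nat (fst x) * [:0, 1:] ^ nat (snd x)))) B"
  proof (rule inj_onI)
    fix x y assume xy: "x \<in> B" "y \<in> B"
      and "degree (smult (D x) ([:1:] ^ nat (fst x) * [:0, 1:] ^ nat (snd x)))
          = degree (smult (D y) ([:1:] ^ nat (fst y) * [:0, 1:] ^ nat (snd y)))"
    then have "nat (snd x) = nat (snd y)" by (simp only: deg)
    then have "snd x = snd y" using xy B(2) unfolding nonneg_def by (metis eq_nat_nat_iff)
    then show "x = y" using inj xy by (auto dest: inj_onD)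
  qed
qed

text \<open>The pair consists of \<open>(X - 1)\<^sup>3 = 0\<close> and a binomial. The zero set of the binomial
  through \<open>(1, 1)\<close> is parametrised by two powers of \<open>1 + z\<close>, and \<open>X - 1\<close> has a simple zero
  along it because the two points have different heights.\<close>

lemma bad_segment4:
  assumes nn: "nonneg {b1, b2}" and ne: "snd b1 \<noteq> snd b2"
  shows "bad {(0, 0), (1, 0), (2, 0), (3, 0)} {b1, b2}"
proof -
  let ?A = "{(0, 0), (1, 0), (2, 0), (3, 0)} :: (int \<times> int) set" and ?B = "{b1, b2}"
  define h a where "h = snd b1 - snd b2" and "a = fst b1 - fst b2"
  define C :: "int \<times> int \<Rightarrow> complex" where
    "C = (\<lambda>x. if x = (0, 0) then -1 else if x = (1, 0) then 3 else if x = (2, 0) then -3 else 1)"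
  define D :: "int \<times> int \<Rightarrow> complex" where "D = (\<lambda>x. if x = b1 then 1 else -1)"
  define \<xi> \<eta> where "\<xi> = (\<lambda>z :: complex. (1 + z) powi h)" and "\<eta> = (\<lambda>z :: complex. (1 + z) powi (- a))"
  have r3: "rat_const 3 = 3"
    using rat_const_simps(3)[of 1 2] rat_const_simps(3)[of 1 1] by (simp del: rat_const_simps(3))
  have C: "lpoly C ?A X Y = (X - 1) ^ 3" for X Y
    by (simp add: lpoly_def C_def r3 algebra_simps power2_eq_square power3_eq_cube)
  have Cv: "lpolyv C ?A X Y = (X - 1) ^ 3" for X Y
    by (simp add: lpolyv_def C_def algebra_simps power2_eq_square power3_eq_cube)
  have bne: "b1 \<noteq> b2" using ne by auto
  then have Dv: "lpolyv D ?B X Y = X powi fst b1 * Y powi snd b1 - X powi fst b2 * Y powi snd b2"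
      for X Y
    by (simp add: lpolyv_def D_def)
  have t: "((\<lambda>z :: complex. (1 + z) powi i) \<longlongrightarrow> 1) (at 0)" for i
  proof -
    have "((\<lambda>z :: complex. (1 + z) powi i) \<longlongrightarrow> (1 + 0) powi i) (at 0)" by (intro tendsto_intros) simp
    then show ?thesis by simp
  qed
  have "((\<lambda>z :: complex. (1 + z) powi h) has_field_derivative of_int h * (1 + 0) powi (h - 1) * (0
      + 1)) (at 0)"
    by (intro DERIV_power_int DERIV_add DERIV_const DERIV_ident) simp
  then have "((\<lambda>z. ((1 + z) powi h - (1 + 0) powi h) / (z - 0)) \<longlongrightarrow> of_int h) (at (0 :: complex))"
    unfolding has_field_derivative_iff by simp
  then have ratio: "((\<lambda>z. (\<xi> z - 1) / z) \<longlongrightarrow> of_int h) (at 0)" by (simp add: \<xi>_def)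
  have h: "of_int h \<noteq> (0 :: complex)" using ne by (simp add: h_def)
  have ev0: "eventually (\<lambda>z. z \<noteq> 0) (at (0 :: complex))" by (simp add: eventually_at_filter)
  have ev: "eventually (\<lambda>z. \<xi> z - 1 \<noteq> 0) (at 0)"
    using tendsto_imp_eventually_ne[OF ratio h] by eventually_elim auto
  have O1: "(\<lambda>z. \<xi> z - 1) \<in> O[at 0](\<lambda>z. z)" by (rule bigoI_tendsto[OF ratio ev0])
  have "((\<lambda>z. z / (\<xi> z - 1)) \<longlongrightarrow> inverse (of_int h)) (at 0)"
    using tendsto_inverse[OF ratio h] by (simp add: inverse_eq_divide)
  then have O2: "(\<lambda>z. z) \<in> O[at 0](\<lambda>z. \<xi> z - 1)" by (rule bigoI_tendsto[OF _ ev])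
  show ?thesis
  proof (rule bad_by_arc[where \<xi> = \<xi> and \<eta> = \<eta> and k = 3 and \<alpha> = "\<lambda>i. i" and \<beta> = "\<lambda>_. 0" and C = C
      and D = D])
    show "(\<xi> \<longlongrightarrow> 1) (at 0)" "(\<eta> \<longlongrightarrow> 1) (at 0)" unfolding \<xi>_def \<eta>_def by (rule t)+
    show "lpolyv C ?A 1 1 = 0" "lpolyv D ?B 1 1 = 0" by (simp_all add: Cv Dv)
    show "(\<lambda>z. lpolyv C ?A (\<xi> z) (\<eta> z)) \<in> O[at 0](\<lambda>z. z ^ 3)"
      unfolding Cv by (rule landau_o.big_power[OF O1])
    have "eventually (\<lambda>z. z \<in> - {- 1}) (at (0 :: complex))" by (rule eventually_at_in_open') auto
    then have "eventually (\<lambda>z. lpolyv D ?B (\<xi> z) (\<eta> z) = 0) (at 0)"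
    proof eventually_elim
      case (elim z)
      then have nz: "1 + z \<noteq> 0" by (auto simp: add_eq_0_iff)
      have "\<xi> z powi i * \<eta> z powi j = (1 + z) powi (h * i + - a * j)" for i j
        unfolding \<xi>_def \<eta>_def power_int_mult[symmetric]
            by (rule power_int_add[symmetric]) (use nz in simp)
      moreover have "h * fst b1 + - a * snd b1 = h * fst b2 + - a * snd b2"
        by (simp add: h_def a_def algebra_simps)
      ultimately show ?case unfolding Dv by simp
    qed
    from landau_o.big.in_cong[OF this] show "(\<lambda>z. lpolyv D ?B (\<xi> z) (\<eta> z)) \<in> O[at 0](\<lambda>z. z ^ 3)" by simp
  next
    fix p W X Y
    assume W: "is_ideal p W" and loc: "X \<in> local_ring p" "Y \<in> local_ring p" "rval p X = 1"
        "rval p Y = 1"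
      and mem: "lpoly C ?A X Y \<in> W" "lpoly D ?B X Y \<in> W"
    have "psubst D ?B [:1:] [:0, 1:] \<noteq> 0"
      by (rule psubst_rows_nonzero[where ?x1.0 = b1]) (use nn ne in \<open>auto simp: D_def\<close>)
    from nilpotent_double_line[OF W loc mem(1)[unfolded C] mem(2) nn this]
    show "\<exists>N. (X - 1) ^ N \<in> W \<and> (Y - 1) ^ N \<in> W" .
  next
    fix d :: "nat \<Rightarrow> complex" and i :: nat
    assume *: "(\<lambda>z. \<Sum>i<3. d i * ((\<xi> z - 1) ^ i * (\<eta> z - 1) ^ 0)) \<in> O[at 0](\<lambda>z. z ^ 3)" and i: "i < 3"
    let ?P = "\<Sum>i<3. monom (d i) i"
    have eq: "(\<lambda>z. \<Sum>i<3. d i * ((\<xi> z - 1) ^ i * (\<eta> z - 1) ^ 0)) = (\<lambda>z. poly ?P (\<xi> z - 1))"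
      by (simp add: poly_sum poly_monom)
    have "(\<lambda>z. poly ?P (\<xi> z - 1)) \<in> O[at 0](\<lambda>z. (\<xi> z - 1) ^ 3)"
      using landau_o.big_trans[OF *[unfolded eq] landau_o.big_power[OF O2]] .
    moreover have "((\<lambda>z. \<xi> z - 1) \<longlongrightarrow> 0) (at 0)"
      using tendsto_diff[OF t[of h] tendsto_const[of 1]] by (simp add: \<xi>_def)
    ultimately have "coeff ?P i = 0" using coeff_eq_0_of_bigo[OF _ ev _ i] by blast
    moreover have "coeff ?P i = d i" using i by (simp only: coeff_sum coeff_monom) (simp add: sum.delta)
    ultimately show "d i = 0" by simp
  qed simp_all
qed

lemma dvd_psubst_diff:
  assumes "\<And>x. x \<in> B \<Longrightarrow> d dvd \<phi> ^ nat (fst x) * \<psi> ^ nat (snd x) - E x"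
  shows "d dvd psubst D B \<phi> \<psi> - (\<Sum>x\<in>B. smult (D x) (E x))"
proof -
  have "psubst D B \<phi> \<psi> - (\<Sum>x\<in>B. smult (D x) (E x)) = (\<Sum>x\<in>B. smult (D x) (\<phi> ^ nat (fst x) * \<psi> ^ nat (snd
      x) - E x))"
    by (simp add: psubst_def smult_diff_right sum_subtractf)
  then show ?thesis using assms by (simp only:) (intro dvd_sum dvd_smult)
qed

lemma truncation_error3:
  fixes T :: "'a :: comm_ring_1"
  shows "(1 + i * (K * T ^ 2)) * (1 + j * T + c * T ^ 2) - (1 + j * T + (c + K * i) * T ^ 2)
      = T ^ 3 * (i * K * (j + c * T))"
  by (simp add: algebra_simps power2_eq_square power3_eq_cube)

lemma truncation_error4:
  fixes T :: "'a :: comm_ring_1"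
  shows "(1 + i * T ^ 3) * (1 + j * T ^ 2) - (1 + j * T ^ 2 + i * T ^ 3) = T ^ 4 * (i * j * T)"
  by (simp add: algebra_simps power2_eq_square power3_eq_cube power4_eq_xxxx)

text \<open>The pair consists of \<open>(X - 1)\<^sup>2 = 0\<close> and a trinomial whose restriction to \<open>X = 1\<close>
  has a double root. If the trinomial is smooth at \<open>(1, 1)\<close>, it is approximated to order 2 by
  an arc \<open>X = 1 + \<kappa> z\<^sup>2\<close>, \<open>Y = 1 + z\<close>, on which \<open>(X - 1)\<^sup>2\<close> has order at least 4. If
  it is singular there, both equations vanish along the cusp \<open>X = 1 + z\<^sup>3\<close>,
  \<open>Y = 1 + z\<^sup>2\<close> to order at least 4, while \<open>1\<close>, \<open>Y - 1\<close> and \<open>X - 1\<close> have the orders 0, 2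
  and 3.\<close>

lemma bad_three_rows:
  assumes nn: "nonneg {b1, b2, b3}" and ne: "snd b1 \<noteq> snd b2" "snd b1 \<noteq> snd b3" "snd b2 \<noteq> snd b3"
  shows "bad {(0, 0), (1, 0), (2, 0)} {b1, b2, b3}"
proof -
  let ?A = "{(0, 0), (1, 0), (2, 0)} :: (int \<times> int) set" and ?B = "{b1, b2, b3}"
  define a h :: "int \<times> int \<Rightarrow> complex" where "a = (\<lambda>x. of_int (fst x))" and "h = (\<lambda>x. of_int (snd x))"
  define C :: "int \<times> int \<Rightarrow> complex" where "C = (\<lambda>x. if x = (1, 0) then -2 else 1)"
  \<comment> \<open>The weights of the second divided difference in the heights, up to a common factor.\<close>
  define D where "D = (\<lambda>x. if x = b1 then h b2 - h b3 else if x = b2 then h b3 - h b1 else h b1 - h b2)"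
  have r2: "rat_const 2 = 2" using rat_const_simps(3)[of 1 1] by (simp del: rat_const_simps(3))
  have C: "lpoly C ?A X Y = (X - 1) ^ 2" for X Y
    by (simp add: lpoly_def C_def r2 algebra_simps power2_eq_square)
  have Cv: "lpolyv C ?A X Y = (X - 1) ^ 2" for X Y
    by (simp add: lpolyv_def C_def algebra_simps power2_eq_square)
  have bne: "b1 \<noteq> b2" "b1 \<noteq> b3" "b2 \<noteq> b3" using ne by auto
  then have sum: "(\<Sum>x\<in>?B. D x * k x) = (h b2 - h b3) * k b1 + (h b3 - h b1) * k b2
      + (h b1 - h b2) * k b3" for k
    by (simp add: D_def)
  have hne: "h b1 \<noteq> h b2" "h b1 \<noteq> h b3" "h b2 \<noteq> h b3" using ne by (simp_all add: h_def)
  then have D: "D x \<noteq> 0" if "x \<in> ?B" for x using that by (auto simp: D_def)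
  have s0: "sum D ?B = 0" using sum[of "\<lambda>_. 1"] by simp
  have s1: "(\<Sum>x\<in>?B. D x * h x) = 0" unfolding sum by (simp add: algebra_simps)
  have nat: "of_int (fst x) = (of_nat (nat (fst x)) :: complex)"
      "of_int (snd x) = (of_nat (nat (snd x)) :: complex)"
    if "x \<in> ?B" for x using nn that by (auto simp: nonneg_def)
  define \<alpha> where "\<alpha> = (\<Sum>x\<in>?B. D x * a x)"
  have Dv0: "lpolyv D ?B 1 1 = 0" using s0 by (simp add: lpolyv_def)
  have nil: "\<exists>N. (X - 1) ^ N \<in> W \<and> (Y - 1) ^ N \<in> W"
    if W: "is_ideal p W" and loc: "X \<in> local_ring p" "Y \<in> local_ring p" "rval p X = 1" "rval p Y = 1"
      and mem: "lpoly C ?A X Y \<in> W" "lpoly D ?B X Y \<in> W" for p W X Y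
  proof -
    have "psubst D ?B [:1:] [:0, 1:] \<noteq> 0"
      by (rule psubst_rows_nonzero[where ?x1.0 = b1]) (use nn ne D in \<open>auto simp: inj_on_def\<close>)
    from nilpotent_double_line[OF W loc mem(1)[unfolded C] mem(2) nn this] show ?thesis .
  qed
  let ?T = "[:0, 1:] :: complex poly"
  have tp: "((\<lambda>z. poly P z) \<longlongrightarrow> poly P 0) (at 0)" for P :: "complex poly" by (intro tendsto_intros)
  have tp1: "(poly P \<longlongrightarrow> 1) (at 0)" if "poly P 0 = 1" for P :: "complex poly" using tp[of P] that by simp
  have small: "coeff P i = 0" if "(\<lambda>z. poly P z) \<in> O[at 0](\<lambda>z. z ^ k)" "i < k" for P :: "complex poly"
      and i k
    using coeff_eq_0_of_bigo[of "\<lambda>z. z", OF _ _ that]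
        by (auto intro: tendsto_ident_at simp: eventually_at_filter)
  have O: "(\<lambda>z. poly P z) \<in> O[at 0](\<lambda>z. z ^ k)" if "?T ^ k dvd P" for P k
    using bigo_poly_dvd[OF that tendsto_ident_at] by simp
  show ?thesis
  proof (cases "\<alpha> = 0")
    case False
    define c2 where "c2 = (\<lambda>x :: int \<times> int. of_nat (nat (snd x) choose 2) :: complex)"
    \<comment> \<open>The choice that removes the term of order 2 of the trinomial along the arc.\<close>
    define \<kappa> where "\<kappa> = - (\<Sum>x\<in>?B. D x * c2 x) / \<alpha>"
    let ?\<phi> = "[:1, 0, \<kappa>:]" and ?\<psi> = "[:1, 1:] :: complex poly"
    define E where "E = (\<lambda>x. 1 + smult (h x) ?T + smult (c2 x + \<kappa> * a x) (?T ^ 2))"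
    have dvd: "?T ^ 3 dvd ?\<phi> ^ nat (fst x) * ?\<psi> ^ nat (snd x) - E x" if x: "x \<in> ?B" for x
    proof -
      let ?i = "nat (fst x)" and ?j = "nat (snd x)"
      let ?S = "[:\<kappa>:] * ?T ^ 2"
      have e: "?\<phi> = 1 + ?S" "?\<psi> = 1 + ?T" by (simp_all add: one_pCons power2_eq_square)
      have S2: "?S ^ 2 = ?T ^ 3 * ([:\<kappa>:] ^ 2 * ?T)"
          by (simp add: algebra_simps power2_eq_square power3_eq_cube)
      have 1: "?T ^ 3 dvd (1 + ?S) ^ ?i - (1 + of_nat ?i * ?S)"
        by (rule dvd_trans[OF dvdI[OF S2] truncated_binomial2])
      have E: "E x = 1 + of_nat ?j * ?T + (of_nat (?j choose 2) + [:\<kappa>:] * of_nat ?i) * ?T ^ 2"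
        unfolding E_def c2_def h_def a_def nat[OF x] by (simp add: of_nat_poly power2_eq_square)
      have "(1 + of_nat ?i * ?S) * (1 + of_nat ?j * ?T + of_nat (?j choose 2) * ?T ^ 2) - E x
         = ?T ^ 3 * (of_nat ?i * [:\<kappa>:] * (of_nat ?j + of_nat (?j choose 2) * ?T))"
        unfolding E by (rule truncation_error3)
      then have 3: "?T ^ 3 dvd (1 + of_nat ?i * ?S) * (1 + of_nat ?j * ?T
          + of_nat (?j choose 2) * ?T ^ 2) - E x"
        by (rule dvdI)
      show ?thesis unfolding e by (rule dvd_diff_mult[OF 1 truncated_binomial3 3])
    qed
    have "(\<Sum>x\<in>?B. smult (D x) (E x)) = smult (sum D ?B) 1 + smult (\<Sum>x\<in>?B. D x * h x) ?T
       + smult (\<Sum>x\<in>?B. D x * (c2 x + \<kappa> * a x)) (?T ^ 2)"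
      unfolding E_def smult_sum by (simp only: smult_add_right sum.distrib smult_smult)
    also have "(\<Sum>x\<in>?B. D x * (c2 x + \<kappa> * a x)) = (\<Sum>x\<in>?B. D x * c2 x) + \<kappa> * \<alpha>"
      unfolding \<alpha>_def by (simp only: distrib_left sum.distrib sum_distrib_left mult_ac)
    also have "\<dots> = 0" using False by (simp add: \<kappa>_def)
    finally have G: "?T ^ 3 dvd psubst D ?B ?\<phi> ?\<psi>" using dvd_psubst_diff[OF dvd, of ?B D] s0 s1 by simp
    show ?thesis
    proof (rule bad_by_arc[where \<xi> = "poly ?\<phi>" and \<eta> = "poly ?\<psi>" and k = 3 and \<alpha> = "\<lambda>_. 0"
        and \<beta> = "\<lambda>i. i" and C = C and D = D])
      show "(poly ?\<phi> \<longlongrightarrow> 1) (at 0)" "(poly ?\<psi> \<longlongrightarrow> 1) (at 0)" by (rule tp1, simp)+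
      have "lpolyv C ?A (poly ?\<phi> z) (poly ?\<psi> z) = poly (?T ^ 3 * [:0, \<kappa> ^ 2:]) z" for z
        unfolding Cv by (simp add: power2_eq_square power3_eq_cube)
      then show "(\<lambda>z. lpolyv C ?A (poly ?\<phi> z) (poly ?\<psi> z)) \<in> O[at 0](\<lambda>z. z ^ 3)"
        using O[of 3 "?T ^ 3 * [:0, \<kappa> ^ 2:]"] by (simp only: dvd_triv_left)
      show "(\<lambda>z. lpolyv D ?B (poly ?\<phi> z) (poly ?\<psi> z)) \<in> O[at 0](\<lambda>z. z ^ 3)"
        unfolding lpolyv_psubst[OF nn] by (rule O[OF G])
    next
      fix d :: "nat \<Rightarrow> complex" and i :: nat
      assume *: "(\<lambda>z. \<Sum>i<3. d i * ((poly ?\<phi> z - 1) ^ 0 * (poly ?\<psi> z - 1) ^ i)) \<in> O[at 0](\<lambda>z. z ^ 3)"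
          and i: "i < 3"
      let ?P = "\<Sum>i<3. monom (d i) i"
      have "(\<lambda>z. poly ?P z) \<in> O[at 0](\<lambda>z. z ^ 3)" using * by (simp add: poly_sum poly_monom)
      then have "coeff ?P i = 0" using small i by blast
      moreover have "coeff ?P i = d i" using i by (simp only: coeff_sum coeff_monom) (simp add:
          sum.delta)
      ultimately show "d i = 0" by simp
    qed (use nil Dv0 in \<open>auto simp: Cv\<close>)
  next
    case True
    let ?\<phi> = "[:1, 0, 0, 1:] :: complex poly" and ?\<psi> = "[:1, 0, 1:] :: complex poly"
    define E where "E = (\<lambda>x. 1 + smult (h x) (?T ^ 2) + smult (a x) (?T ^ 3))"
    have dvd: "?T ^ 4 dvd ?\<phi> ^ nat (fst x) * ?\<psi> ^ nat (snd x) - E x" if x: "x \<in> ?B" for x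
    proof -
      let ?i = "nat (fst x)" and ?j = "nat (snd x)"
      have e: "?\<phi> = 1 + ?T ^ 3" "?\<psi> = 1 + ?T ^ 2"
          by (simp_all add: one_pCons power2_eq_square power3_eq_cube)
      have 1: "?T ^ 4 dvd (1 + ?T ^ 3) ^ ?i - (1 + of_nat ?i * ?T ^ 3)"
        by (rule dvd_trans[OF _ truncated_binomial2]) (simp add: le_imp_power_dvd flip: power_mult)
      have 2: "?T ^ 4 dvd (1 + ?T ^ 2) ^ ?j - (1 + of_nat ?j * ?T ^ 2)"
        by (rule dvd_trans[OF _ truncated_binomial2]) (simp add: le_imp_power_dvd flip: power_mult)
      have E: "E x = 1 + of_nat ?j * ?T ^ 2 + of_nat ?i * ?T ^ 3"
        unfolding E_def h_def a_def nat[OF x] by (simp add: of_nat_poly power2_eq_square power3_eq_cube)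
      have "(1 + of_nat ?i * ?T ^ 3) * (1 + of_nat ?j * ?T ^ 2) - E x
          = ?T ^ 4 * (of_nat ?i * of_nat ?j * ?T)"
        unfolding E by (rule truncation_error4)
      then have 3: "?T ^ 4 dvd (1 + of_nat ?i * ?T ^ 3) * (1 + of_nat ?j * ?T ^ 2) - E x" by (rule dvdI)
      show ?thesis unfolding e by (rule dvd_diff_mult[OF 1 2 3])
    qed
    have "(\<Sum>x\<in>?B. smult (D x) (E x)) = smult (sum D ?B) 1 + smult (\<Sum>x\<in>?B. D x * h x) (?T ^ 2)
       + smult (\<Sum>x\<in>?B. D x * a x) (?T ^ 3)"
      unfolding E_def smult_sum by (simp only: smult_add_right sum.distrib smult_smult)
    then have G: "?T ^ 4 dvd psubst D ?B ?\<phi> ?\<psi>"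
      using dvd_psubst_diff[OF dvd, of ?B D] s0 s1 True by (simp add: \<alpha>_def)
    show ?thesis
    proof (rule bad_by_arc[where \<xi> = "poly ?\<phi>" and \<eta> = "poly ?\<psi>" and k = 4
          and \<alpha> = "\<lambda>i. if i = 2 then 1 else 0" and \<beta> = "\<lambda>i. if i = 1 then 1 else 0" and C = C
              and D = D])
      show "(poly ?\<phi> \<longlongrightarrow> 1) (at 0)" "(poly ?\<psi> \<longlongrightarrow> 1) (at 0)" by (rule tp1, simp)+
      have "lpolyv C ?A (poly ?\<phi> z) (poly ?\<psi> z) = poly (?T ^ 4 * ?T ^ 2) z" for z
        unfolding Cv by (simp add: power2_eq_square power4_eq_xxxx)
      then show "(\<lambda>z. lpolyv C ?A (poly ?\<phi> z) (poly ?\<psi> z)) \<in> O[at 0](\<lambda>z. z ^ 4)"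
        using O[of 4 "?T ^ 4 * ?T ^ 2"] by (simp only: dvd_triv_left)
      show "(\<lambda>z. lpolyv D ?B (poly ?\<phi> z) (poly ?\<psi> z)) \<in> O[at 0](\<lambda>z. z ^ 4)"
        unfolding lpolyv_psubst[OF nn] by (rule O[OF G])
    next
      fix d :: "nat \<Rightarrow> complex" and i :: nat
      assume *: "(\<lambda>z. \<Sum>i<3. d i * ((poly ?\<phi> z - 1) ^ (if i = 2 then 1 else 0) * (poly ?\<psi> z - 1) ^ (if i
          = 1 then 1 else 0))) \<in> O[at 0](\<lambda>z. z ^ 4)"
        and i: "i < 3"
      let ?P = "[:d 0, 0, d 1, d 2:]"
      have "(\<Sum>i<3. d i * ((poly ?\<phi> z - 1) ^ (if i = 2 then 1 else 0) * (poly ?\<psi> z - 1) ^ (if i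
          = 1 then 1 else 0))) = poly ?P z" for z
        by (simp add: eval_nat_numeral algebra_simps)
      then have "(\<lambda>z. poly ?P z) \<in> O[at 0](\<lambda>z. z ^ 4)" using * by simp
      then have "coeff ?P j = 0" if "j < 4" for j using small that by blast
      from this[of 0] this[of 2] this[of 3] show "d i = 0" using i
          by (auto simp: eval_nat_numeral less_Suc_eq)
    qed (use nil Dv0 in \<open>auto simp: Cv\<close>)
  qed
qed

section \<open>Convex lattice sets\<close>

text \<open>The consequence of convexity that is used: rational convex combinations of up to three
  points, with integral weights in place of denominators.\<close>

definition lconv :: "(int \<times> int) set \<Rightarrow> bool" where
  "lconv X \<longleftrightarrow> (\<forall>p\<in>X. \<forall>q\<in>X. \<forall>r\<in>X. \<forall>s \<alpha> \<beta> \<gamma>. 0 \<le> \<alpha> \<longrightarrow> 0 \<le> \<beta> \<longrightarrow> 0 \<le> \<gamma> \<longrightarrow> 0 < \<alpha> + \<beta> + \<gamma> \<longrightarrow>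
     (\<alpha> + \<beta> + \<gamma>) * fst s = \<alpha> * fst p + \<beta> * fst q + \<gamma> * fst r \<longrightarrow>
     (\<alpha> + \<beta> + \<gamma>) * snd s = \<alpha> * snd p + \<beta> * snd q + \<gamma> * snd r \<longrightarrow> s \<in> X)"

lemma lconvD:
  assumes "lconv X" "p \<in> X" "q \<in> X" "r \<in> X" "0 \<le> \<alpha>" "0 \<le> \<beta>" "0 \<le> \<gamma>" "0 < \<alpha> + \<beta> + \<gamma>"
    "(\<alpha> + \<beta> + \<gamma>) * fst s = \<alpha> * fst p + \<beta> * fst q + \<gamma> * fst r"
    "(\<alpha> + \<beta> + \<gamma>) * snd s = \<alpha> * snd p + \<beta> * snd q + \<gamma> * snd r"
  shows "s \<in> X"
  using assms unfolding lconv_def by blast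

lemma lconv_segment:
  assumes "lconv X" "p \<in> X" "q \<in> X" "0 \<le> \<alpha>" "0 \<le> \<beta>" "0 < \<alpha> + \<beta>"
    "(\<alpha> + \<beta>) * fst s = \<alpha> * fst p + \<beta> * fst q" "(\<alpha> + \<beta>) * snd s = \<alpha> * snd p + \<beta> * snd q"
  shows "s \<in> X"
  using lconvD[of X p q q \<alpha> \<beta> 0 s] assms by simp

lemma newton_polygon_lconv:
  assumes "newton_polygon X"
  shows "lconv X"
proof -
  obtain K where K: "convex K" "X = lattice_points K" using assms unfolding newton_polygon_def by blast
  define R where "R = (\<lambda>p :: int \<times> int. (real_of_int (fst p), real_of_int (snd p)))"
  have X: "p \<in> X \<longleftrightarrow> R p \<in> K" for p unfolding K(2) lattice_points_def R_def by (cases p) simp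
  show ?thesis unfolding lconv_def
  proof (intro ballI allI impI)
    fix p q r s and \<alpha> \<beta> \<gamma> :: int
    assume pqr: "p \<in> X" "q \<in> X" "r \<in> X" and nn: "0 \<le> \<alpha>" "0 \<le> \<beta>" "0 \<le> \<gamma>" "0 < \<alpha> + \<beta> + \<gamma>"
      and eq: "(\<alpha> + \<beta> + \<gamma>) * fst s = \<alpha> * fst p + \<beta> * fst q + \<gamma> * fst r"
        "(\<alpha> + \<beta> + \<gamma>) * snd s = \<alpha> * snd p + \<beta> * snd q + \<gamma> * snd r"
    define a b c m where "a = real_of_int \<alpha>" and "b = real_of_int \<beta>" and "c = real_of_int \<gamma>"
        and "m = a + b + c"
    have m: "m > 0" "a \<ge> 0" "b \<ge> 0" "c \<ge> 0" using nn by (simp_all add: m_def a_def b_def c_def)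
    have "m * real_of_int (fst s) = a * real_of_int (fst p) + b * real_of_int (fst q)
        + c * real_of_int (fst r)"
      "m * real_of_int (snd s) = a * real_of_int (snd p) + b * real_of_int (snd q)
          + c * real_of_int (snd r)"
      unfolding m_def a_def b_def c_def using eq by (simp_all flip: of_int_add of_int_mult)
    then have "R s = (a / m) *\<^sub>R R p + (b / m) *\<^sub>R R q + (c / m) *\<^sub>R R r"
      using m(1) unfolding R_def by (simp add: field_simps)
    also have "\<dots> \<in> K"
    proof -
      have sub: "{R p, R q, R r} \<subseteq> K" using pqr X by simp
      have "(a / m) *\<^sub>R R p + (b / m) *\<^sub>R R q + (c / m) *\<^sub>R R r \<in> convex hull {R p, R q, R r}"
        unfolding convex_hull_3 mem_Collect_eq using m
        by (intro exI[of _ "a / m"] exI[of _ "b / m"] exI[of _ "c / m"]) (simp add: m_def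
            add_divide_distrib[symmetric])
      then show ?thesis using hull_minimal[of _ K convex, OF sub K(1)] by blast
    qed
    finally show "s \<in> X" by (simp add: X)
  qed
qed

lemma aff_surj:
  assumes "unimodular e e'"
  shows "\<exists>x. aff e e' u x = s"
proof -
  obtain \<alpha> \<beta> \<gamma> \<delta> where db: "dual_basis e e' = ((\<alpha>, \<beta>), (\<gamma>, \<delta>))" by (metis surj_pair)
  note d = dual_basis_props[OF assms db]
  define a b where "a = fst s - fst u" and "b = snd s - snd u"
  have "(\<alpha> * a + \<gamma> * b) * fst e + (\<beta> * a + \<delta> * b) * fst e' = (fst e * \<alpha> + fst e' * \<beta>) * a + (fst e * \<gamma>
      + fst e' * \<delta>) * b"
    "(\<alpha> * a + \<gamma> * b) * snd e + (\<beta> * a + \<delta> * b) * snd e' = (snd e * \<alpha> + snd e' * \<beta>) * a + (snd e * \<gamma>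
        + snd e' * \<delta>) * b"
    by (simp_all add: algebra_simps)
  then have "aff e e' u (\<alpha> * a + \<gamma> * b, \<beta> * a + \<delta> * b) = s"
    unfolding d by (simp add: aff_def prod_eq_iff a_def b_def)
  then show ?thesis by blast
qed

lemma lconv_aff:
  assumes uni: "unimodular e e'" and X: "lconv X"
  shows "lconv (aff e e' u ` X)"
  unfolding lconv_def
proof (intro ballI allI impI)
  fix p q r s and \<alpha> \<beta> \<gamma> :: int
  assume pqr: "p \<in> aff e e' u ` X" "q \<in> aff e e' u ` X" "r \<in> aff e e' u ` X"
      and nn: "0 \<le> \<alpha>" "0 \<le> \<beta>" "0 \<le> \<gamma>" "0 < \<alpha> + \<beta> + \<gamma>"
    and eq: "(\<alpha> + \<beta> + \<gamma>) * fst s = \<alpha> * fst p + \<beta> * fst q + \<gamma> * fst r"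
      "(\<alpha> + \<beta> + \<gamma>) * snd s = \<alpha> * snd p + \<beta> * snd q + \<gamma> * snd r"
  obtain p' q' r' where p': "p' \<in> X" "q' \<in> X" "r' \<in> X" "p = aff e e' u p'" "q = aff e e' u q'"
      "r = aff e e' u r'"
    using pqr by blast
  obtain s' where s': "aff e e' u s' = s" using aff_surj[OF uni] by blast
  let ?m = "\<alpha> + \<beta> + \<gamma>"
  let ?x = "(?m * fst s', ?m * snd s')"
  let ?y = "(\<alpha> * fst p' + \<beta> * fst q' + \<gamma> * fst r', \<alpha> * snd p' + \<beta> * snd q' + \<gamma> * snd r')"
  have "aff e e' 0 ?x = aff e e' 0 ?y"
    using eq unfolding p'(4-6) s'[symmetric] by (simp add: aff_def algebra_simps)
  then have "?x = ?y" using inj_aff[OF uni] by (metis injD)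
  then have "s' \<in> X" by (intro lconvD[OF X p'(1-3) nn]) auto
  then show "s \<in> aff e e' u ` X" using s' by blast
qed

definition collinear_set :: "(int \<times> int) set \<Rightarrow> bool" where
  "collinear_set X \<longleftrightarrow> (\<forall>p\<in>X. \<forall>q\<in>X. \<forall>r\<in>X. cross (q - p) (r - p) = 0)"

lemma cross_aff: "cross (aff e e' u q - aff e e' u p) (aff e e' u r - aff e e' u p)
    = cross e e' * cross (q - p) (r - p)"
  by (simp add: cross_def aff_def algebra_simps)

lemma collinear_aff:
  assumes "unimodular e e'"
  shows "collinear_set (aff e e' u ` X) \<longleftrightarrow> collinear_set X"
proof -
  have "cross e e' \<noteq> 0" using assms by (auto simp: unimodular_def)
  then show ?thesis by (simp add: collinear_set_def cross_aff)
qed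

section \<open>A line and a polygon that does not fit into the double simplex\<close>

text \<open>Containment in a translate of the 2-simplex, stated without choosing the translation: \<open>p\<close>
  and \<open>q\<close> test the left and lower sides, \<open>r\<close> the oblique one.\<close>

definition fits :: "(int \<times> int) set \<Rightarrow> bool" where
  "fits B \<longleftrightarrow> (\<forall>p\<in>B. \<forall>q\<in>B. \<forall>r\<in>B. fst r + snd r - fst p - snd q \<le> 2)"

text \<open>The condition for contact of order 3, rewritten in terms of the edge vectors. It does not
  depend on the position \<open>b\<close> of the triangle.\<close>

lemma bad_triangle_root:
  fixes \<mu> :: complex
  defines "\<theta> \<equiv> \<lambda>x :: int \<times> int. of_int (fst x) + \<mu> * of_int (snd x)"
  assumes \<mu>: "\<mu> \<noteq> 0" "\<mu> \<noteq> 1" and D: "cross u v \<noteq> 0"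
    and z: "fst u + snd u \<noteq> 0" "fst v + snd v \<noteq> 0" "fst u + snd u \<noteq> fst v + snd v"
    and Q: "\<theta> u * \<theta> v * (\<theta> u - \<theta> v) = of_int (cross u v) * \<mu> * (1 - \<mu>)"
  shows "bad standard_simplex {b, b + u, b + v}"
proof -
  obtain w where w: "nonneg ((\<lambda>x. x + w) ` {b, b + u, b + v})"
      using shift_to_nonneg[of "{b, b + u, b + v}"] by auto
  define b0 b1 b2 where "b0 = b + w" and "b1 = b + u + w" and "b2 = b + v + w"
  have im: "(\<lambda>x. x + w) ` {b, b + u, b + v} = {b0, b1, b2}" by (simp add: b0_def b1_def b2_def)
  have "of_int (cross u v) * \<mu> * (1 - \<mu>) \<noteq> 0" using \<mu> D by simp
  then have \<theta>: "\<theta> u \<noteq> 0" "\<theta> v \<noteq> 0" "\<theta> u \<noteq> \<theta> v" using Q by auto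
  have t: "\<theta> b1 = \<theta> b0 + \<theta> u" "\<theta> b2 = \<theta> b0 + \<theta> v"
    by (simp_all add: \<theta>_def b0_def b1_def b2_def algebra_simps)
  have "bad standard_simplex {b0, b1, b2}"
  proof (rule bad_triangle[where \<mu> = \<mu> and \<theta> = \<theta>
      and \<rho> = "\<lambda>x. (\<theta> x)\<^sup>2 - of_int (fst x) - \<mu>\<^sup>2 * of_int (snd x)"])
    show "nonneg {b0, b1, b2}" using w unfolding im .
    show "fst b0 + snd b0 \<noteq> fst b1 + snd b1" "fst b0 + snd b0 \<noteq> fst b2 + snd b2"
        "fst b1 + snd b1 \<noteq> fst b2 + snd b2"
      using z by (simp_all add: b0_def b1_def b2_def)
    show "\<theta> b0 \<noteq> \<theta> b1" "\<theta> b0 \<noteq> \<theta> b2" "\<theta> b1 \<noteq> \<theta> b2" unfolding t using \<theta> by auto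
    have e: "of_int (fst b1) = (of_int (fst b0) + of_int (fst u) :: complex)"
        "of_int (snd b1) = (of_int (snd b0) + of_int (snd u) :: complex)"
      "of_int (fst b2) = (of_int (fst b0) + of_int (fst v) :: complex)"
          "of_int (snd b2) = (of_int (snd b0) + of_int (snd v) :: complex)"
      by (simp_all add: b0_def b1_def b2_def)
    let ?S = "(\<theta> b1 - \<theta> b2) * ((\<theta> b0)\<^sup>2 - of_int (fst b0) - \<mu>\<^sup>2 * of_int (snd b0)) +
      (\<theta> b2 - \<theta> b0) * ((\<theta> b1)\<^sup>2 - of_int (fst b1) - \<mu>\<^sup>2 * of_int (snd b1)) +
      (\<theta> b0 - \<theta> b1) * ((\<theta> b2)\<^sup>2 - of_int (fst b2) - \<mu>\<^sup>2 * of_int (snd b2))"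
    have "?S = \<theta> u * \<theta> v * (\<theta> u - \<theta> v) - (\<theta> v * (of_int (fst u)
        + \<mu>\<^sup>2 * of_int (snd u)) - \<theta> u * (of_int (fst v) + \<mu>\<^sup>2 * of_int (snd v)))"
      unfolding t e by (simp add: algebra_simps power2_eq_square)
    also have "\<theta> v * (of_int (fst u) + \<mu>\<^sup>2 * of_int (snd u)) - \<theta> u * (of_int (fst v)
        + \<mu>\<^sup>2 * of_int (snd v))
       = of_int (cross u v) * \<mu> * (1 - \<mu>)"
      unfolding \<theta>_def cross_def by (simp add: algebra_simps power2_eq_square)
    finally show "?S = 0" using Q by simp
  qed (use \<mu> in \<open>auto simp: \<theta>_def\<close>)
  then show ?thesis using bad_shift[of standard_simplex w "{b, b + u, b + v}"] unfolding im by simp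
qed

lemma complex_poly_root:
  assumes "degree P \<noteq> 0"
  shows "\<exists>z :: complex. poly P z = 0"
  using fundamental_theorem_of_algebra[of P] constant_degree[of P] assms by simp

text \<open>The values of the cubic at 0 and 1 and its leading coefficient are products of differences
  of the three coordinates \<open>x\<close>, \<open>x + y\<close> and \<open>y\<close>, up to sign. None of them vanishes if no edge
  is parallel to an edge of the standard simplex.\<close>

lemma bad_triangle_generic:
  assumes D: "cross u v \<noteq> 0"
    and x: "fst u \<noteq> 0" "fst v \<noteq> 0" "fst u \<noteq> fst v" and y: "snd u \<noteq> 0" "snd v \<noteq> 0" "snd u \<noteq> snd v"
    and z: "fst u + snd u \<noteq> 0" "fst v + snd v \<noteq> 0" "fst u + snd u \<noteq> fst v + snd v"
  shows "bad standard_simplex {b, b + u, b + v}"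
proof -
  define u1 u2 v1 v2 :: complex where "u1 = of_int (fst u)" and "u2 = of_int (snd u)"
      and "v1 = of_int (fst v)" and "v2 = of_int (snd v)"
  let ?D = "of_int (cross u v) :: complex"
  \<comment> \<open>The condition for contact of order 3, as a polynomial in \<open>\<mu>\<close>.\<close>
  define P where "P = [:u1, u2:] * [:v1, v2:] * [:u1 - v1, u2 - v2:] - [:0, ?D, - ?D:]"
  have "coeff P 3 = u2 * v2 * (u2 - v2)" by (simp add: P_def eval_nat_numeral)
  also have "\<dots> \<noteq> 0" using y by (simp add: u2_def v2_def)
  finally have "degree P \<noteq> 0" by (metis coeff_eq_0 gr0I zero_less_numeral)
  then obtain \<mu> where \<mu>: "poly P \<mu> = 0" using complex_poly_root by blast
  have p: "poly P \<mu> = (u1 + \<mu> * u2) * (v1 + \<mu> * v2) * ((u1 + \<mu> * u2) - (v1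
      + \<mu> * v2)) - ?D * \<mu> * (1 - \<mu>)" for \<mu>
    by (simp add: P_def algebra_simps)
  have "poly P 0 = u1 * v1 * (u1 - v1)" unfolding p by simp
  also have "\<dots> \<noteq> 0" using x by (simp add: u1_def v1_def)
  finally have m0: "\<mu> \<noteq> 0" using \<mu> by auto
  have zz: "u1 + u2 = of_int (fst u + snd u)" "v1 + v2 = of_int (fst v + snd v)"
      by (simp_all add: u1_def u2_def v1_def v2_def)
  have "poly P 1 = (u1 + u2) * (v1 + v2) * ((u1 + u2) - (v1 + v2))" unfolding p by simp
  also have "\<dots> \<noteq> 0" unfolding zz using z by (simp del: of_int_add)
  finally have m1: "\<mu> \<noteq> 1" using \<mu> by auto
  show ?thesis
    by (rule bad_triangle_root[OF m0 m1 D z]) (use \<mu> p[of \<mu>] in \<open>simp add: u1_def u2_def v1_def v2_def\<close>)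
qed

text \<open>Here \<open>{b, b + (0, d)}\<close> is the only edge of the triangle that is parallel to an edge of
  the standard simplex, and 0 is a root of the cubic. After division by \<open>\<mu>\<close> a quadratic
  polynomial \<open>q\<close>
  remains. It is a multiple of \<open>\<mu>\<^sup>2\<close> only if \<open>h = 1\<close> and \<open>d = 2 m + 1\<close>, which is excluded
      by the bound on \<open>d\<close>.\<close>

lemma bad_triangle_one_parallel_edge:
  assumes d: "d \<noteq> 0" "\<bar>d\<bar> \<le> 2" and h: "h \<noteq> 0" and m: "m \<noteq> 0" "m \<noteq> d" "m + h \<noteq> 0" "m + h \<noteq> d"
  shows "bad standard_simplex {b, b + (0, d), b + (h, m)}"
proof -
  define d' h' m' :: complex where "d' = of_int d" and "h' = of_int h" and "m' = of_int m"
  define q where "q = (\<lambda>\<mu>. h' * (1 - h') + h' * (d' - 2 * m' - 1) * \<mu> + m' * (d' - m') * \<mu> ^ 2)"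
  have lead: "m' * (d' - m') \<noteq> 0" using m by (simp add: m'_def d'_def)
  have q1: "q 1 \<noteq> 0"
  proof -
    have "q 1 = (d' - (m' + h')) * (m' + h')" by (simp add: q_def algebra_simps power2_eq_square)
    moreover have "m' + h' = of_int (m + h)" by (simp add: m'_def h'_def)
    ultimately show ?thesis using m by (simp add: d'_def del: of_int_add)
  qed
  have "\<exists>\<mu>. q \<mu> = 0 \<and> \<mu> \<noteq> 0"
  proof (cases "h = 1")
    case True
    \<comment> \<open>The remaining odd values \<open>d = 1\<close> and \<open>d = -1\<close> would give \<open>m = 0\<close> and \<open>m = d\<close>.\<close>
    have "d \<noteq> 2 * m + 1" using d m by presburger
    have "d' - 2 * m' - 1 \<noteq> 0"
    proof -
      have "d' - 2 * m' - 1 = of_int (d - 2 * m - 1)" by (simp add: d'_def m'_def)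
      then show ?thesis using \<open>d \<noteq> 2 * m + 1\<close> by (simp del: of_int_diff)
    qed
    define k t where "k = d' - 2 * m' - 1" and "t = - k / (m' * (d' - m'))"
    have "m' * (d' - m') * t = - k" using lead by (simp add: t_def)
    moreover have "q t = t * (k + m' * (d' - m') * t)"
      using True by (simp add: q_def k_def h'_def algebra_simps power2_eq_square)
    moreover have "t \<noteq> 0" using lead \<open>d' - 2 * m' - 1 \<noteq> 0\<close> by (simp add: t_def k_def)
    ultimately show ?thesis by auto
  next
    case False
    let ?P = "[:h' * (1 - h'), h' * (d' - 2 * m' - 1), m' * (d' - m'):]"
    have "degree ?P \<noteq> 0" using lead by simp
    then obtain \<mu> where "poly ?P \<mu> = 0" using complex_poly_root by blast
    then have "q \<mu> = 0" by (simp add: q_def algebra_simps power2_eq_square)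
    moreover have "q 0 \<noteq> 0" using False h by (simp add: q_def h'_def)
    ultimately show ?thesis by metis
  qed
  then obtain \<mu> where \<mu>: "q \<mu> = 0" "\<mu> \<noteq> 0" by blast
  have m1: "\<mu> \<noteq> 1" using \<mu> q1 by metis
  show ?thesis
  proof (rule bad_triangle_root[OF \<mu>(2) m1])
    have "(0 + \<mu> * d') * (h' + \<mu> * m') * (0 + \<mu> * d' - (h' + \<mu> * m')) - (- d' * h') * \<mu> * (1 - \<mu>)
        = d' * \<mu> * q \<mu>"
      by (simp add: q_def algebra_simps power2_eq_square)
    then show "(of_int (fst (0, d)) + \<mu> * of_int (snd (0, d))) * (of_int (fst (h, m))
        + \<mu> * of_int (snd (h, m))) *
       (of_int (fst (0, d)) + \<mu> * of_int (snd (0, d)) - (of_int (fst (h, m)) + \<mu> * of_int (snd (h, m))))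
       = of_int (cross (0, d) (h, m)) * \<mu> * (1 - \<mu>)"
      using \<mu>(1) by (simp add: cross_def d'_def h'_def m'_def eq_neg_iff_add_eq_0)
  qed (use d h m in \<open>auto simp: cross_def\<close>)
qed

text \<open>Here two edges are parallel to the axes and the cubic has only one root other than 0 and
  \<open>\<infinity>\<close>.\<close>

lemma bad_triangle_corner:
  assumes "d \<noteq> 0" "d \<noteq> 1" "h \<noteq> 0" "h \<noteq> 1" "d \<noteq> h"
  shows "bad standard_simplex {b, b + (0, d), b + (h, 0)}"
proof -
  define d' h' :: complex where "d' = of_int d" and "h' = of_int h"
  have ne: "d' \<noteq> 1" "h' \<noteq> 1" "d' \<noteq> h'" using assms by (simp_all add: d'_def h'_def)
  define \<mu> where "\<mu> = (h' - 1) / (d' - 1)"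
  have \<mu>: "\<mu> \<noteq> 0" "\<mu> \<noteq> 1" "\<mu> * (d' - 1) = h' - 1" using ne by (auto simp: \<mu>_def divide_simps)
  show ?thesis
  proof (rule bad_triangle_root[OF \<mu>(1,2)])
    have "(0 + \<mu> * d') * (h' + \<mu> * 0) * (0 + \<mu> * d' - (h' + \<mu> * 0)) - (- d' * h') * \<mu> * (1 - \<mu>)
       = d' * h' * \<mu> * (\<mu> * (d' - 1) - (h' - 1))"
      by (simp add: algebra_simps)
    then show "(of_int (fst (0, d)) + \<mu> * of_int (snd (0, d))) * (of_int (fst (h, 0))
        + \<mu> * of_int (snd (h, 0))) *
       (of_int (fst (0, d)) + \<mu> * of_int (snd (0, d)) - (of_int (fst (h, 0)) + \<mu> * of_int (snd (h, 0))))
       = of_int (cross (0, d) (h, 0)) * \<mu> * (1 - \<mu>)"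
      using \<mu>(3) by (simp add: cross_def d'_def h'_def eq_neg_iff_add_eq_0)
  qed (use assms in \<open>auto simp: cross_def\<close>)
qed

text \<open>It permutes cyclically the coordinates \<open>x\<close>, \<open>y\<close> and \<open>- x - y\<close> that belong to the sides
  of the standard simplex.\<close>

definition simplex_rotation :: "int \<times> int \<Rightarrow> int \<times> int" where
  "simplex_rotation = aff (0, -1) (1, -1) 0"

definition simplex_reflection :: "int \<times> int \<Rightarrow> int \<times> int" where
  "simplex_reflection = aff (0, 1) (1, 0) 0"

lemma simplex_symmetries:
  "simplex_rotation x = (snd x, - fst x - snd x)" "simplex_reflection x = (snd x, fst x)"
  by (simp_all add: simplex_rotation_def simplex_reflection_def aff_def)

lemma unimodular_symmetries: "unimodular (0, -1) (1, -1)" "unimodular (0, 1) (1, 0)"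
  by (simp_all add: unimodular_def cross_def)

lemma bad_simplex_symmetries:
  "bad standard_simplex (simplex_rotation ` B) \<longleftrightarrow> bad standard_simplex B"
  "bad standard_simplex (simplex_reflection ` B) \<longleftrightarrow> bad standard_simplex B"
proof -
  have "aff (0, -1) (1, -1) (0, 1) ` standard_simplex = standard_simplex"
    "aff (0, 1) (1, 0) 0 ` standard_simplex = standard_simplex"
    by (auto simp: standard_simplex_def aff_def)
  then show "bad standard_simplex (simplex_rotation ` B) \<longleftrightarrow> bad standard_simplex B"
    "bad standard_simplex (simplex_reflection ` B) \<longleftrightarrow> bad standard_simplex B"
    using bad_aff_iff[OF unimodular_symmetries(1), of "(0, 1)" standard_simplex 0 B]
      bad_aff_iff[OF unimodular_symmetries(2), of 0 standard_simplex 0 B]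
    by (simp_all add: simplex_rotation_def simplex_reflection_def)
qed

lemma lconv_symmetries:
  "lconv B \<Longrightarrow> lconv (simplex_rotation ` B)" "lconv B \<Longrightarrow> lconv (simplex_reflection ` B)"
  unfolding simplex_rotation_def simplex_reflection_def
  using lconv_aff unimodular_symmetries by blast+

lemma fits_symmetries:
  "fits (simplex_rotation ` B) \<longleftrightarrow> fits B" "fits (simplex_reflection ` B) \<longleftrightarrow> fits B"
proof -
  show "fits (simplex_rotation ` B) \<longleftrightarrow> fits B"
  proof
    assume f: "fits B"
    show "fits (simplex_rotation ` B)" unfolding fits_def ball_simps
    proof (intro ballI)
      fix p q r assume "p \<in> B" "q \<in> B" "r \<in> B"
      then have "fst q + snd q - fst r - snd p \<le> 2" using f unfolding fits_def by blast
      then show "fst (simplex_rotation r) + snd (simplex_rotation r) - fst (simplex_rotation p) - snd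
          (simplex_rotation q) \<le> 2"
        by (simp add: simplex_symmetries)
    qed
  next
    assume f: "fits (simplex_rotation ` B)"
    show "fits B" unfolding fits_def
    proof (intro ballI)
      fix p q r assume "p \<in> B" "q \<in> B" "r \<in> B"
      then have "fst (simplex_rotation p) + snd (simplex_rotation p) - fst (simplex_rotation q) - snd
          (simplex_rotation r) \<le> 2"
        using f unfolding fits_def by blast
      then show "fst r + snd r - fst p - snd q \<le> 2" by (simp add: simplex_symmetries)
    qed
  qed
  have *: "fits (simplex_reflection ` B)" if "fits B" for B
    unfolding fits_def ball_simps
  proof (intro ballI)
    fix p q r assume "p \<in> B" "q \<in> B" "r \<in> B"
    then have "fst r + snd r - fst q - snd p \<le> 2" using that unfolding fits_def by blast
    then show "fst (simplex_reflection r) + snd (simplex_reflection r) - fst (simplex_reflection p) -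
        snd (simplex_reflection q) \<le> 2"
      by (simp add: simplex_symmetries)
  qed
  have "simplex_reflection ` simplex_reflection ` B = B" by (simp add: image_image simplex_symmetries)
  then show "fits (simplex_reflection ` B) \<longleftrightarrow> fits B" using *[of B] *[of "simplex_reflection ` B"]
      by auto
qed

text \<open>In a frame with a vertical first vector, \<open>B\<close> contains the support of \<open>(X - 1)\<^sup>3\<close>.\<close>

lemma bad_four_in_line:
  assumes B: "lconv B" "b \<in> B" "b + (0, d) \<in> B" and d: "\<bar>d\<bar> \<ge> 3"
  shows "bad standard_simplex B"
proof -
  define s where "s = sgn d"
  have s: "s = 1 \<or> s = -1" "d = s * \<bar>d\<bar>" using d by (auto simp: s_def sgn_if)
  have pt: "b + (0, s * j) \<in> B" if "0 \<le> j" "j \<le> 3" for j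
    by (rule lconv_segment[OF B(1-3), of "\<bar>d\<bar> - j" j]) (use that d s(2) in \<open>auto simp: algebra_simps\<close>)
  have "unimodular (0, s) (1, 0)" using s by (auto simp: unimodular_def cross_def)
  moreover have "bad {(0, 0), (1, 0), (2, 0), (3, 0)} {(0, 1), (0, 0)}"
    by (rule bad_segment4) (auto simp: nonneg_def)
  ultimately have "bad (aff (0, s) (1, 0) b ` {(0, 0), (1, 0), (2, 0), (3, 0)}) (aff (0, s) (1, 0) 0 `
      {(0, 1), (0, 0)})"
    using bad_aff_iff by blast
  moreover have "aff (0, s) (1, 0) b ` {(0, 0), (1, 0), (2, 0), (3, 0)} \<subseteq> B"
    using pt[of 0] pt[of 1] pt[of 2] pt[of 3] by (auto simp: aff_def plus_prod_def mult.commute)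
  moreover have "aff (0, s) (1, 0) 0 ` {(0, 1), (0, 0)} \<subseteq> standard_simplex"
    by (auto simp: aff_def standard_simplex_def)
  ultimately have "bad B standard_simplex" by (rule bad_mono)
  then show ?thesis using bad_commute by blast
qed

text \<open>Edges of length at least 3 contain four points in line. For shorter ones, the triangles to
  which \<open>bad_triangle_corner\<close> does not apply either fit into the 2-simplex or contain another
  lattice point on an edge, which yields a suitable smaller triangle.\<close>

lemma bad_corner:
  assumes B: "lconv B" "b \<in> B" "b + (0, d) \<in> B" "b + (h, 0) \<in> B" and dh: "d \<noteq> 0" "h \<noteq> 0"
    and nf: "\<not> fits {b, b + (0, d), b + (h, 0)}"
  shows "bad standard_simplex B"
proof -
  consider "\<bar>d\<bar> \<ge> 3" | "\<bar>h\<bar> \<ge> 3" | "\<bar>d\<bar> \<le> 2" "\<bar>h\<bar> \<le> 2" by linarith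
  then show ?thesis
  proof cases
    case 1 then show ?thesis using bad_four_in_line B by blast
  next
    case 2
    have "simplex_reflection b + (0, h) \<in> simplex_reflection ` B"
        "simplex_reflection b \<in> simplex_reflection ` B"
      using B(2) imageI[OF B(4), of simplex_reflection] by (auto simp: simplex_symmetries plus_prod_def)
    then have "bad standard_simplex (simplex_reflection ` B)"
      using bad_four_in_line[OF lconv_symmetries(2)[OF B(1)]] 2 by blast
    then show ?thesis by (simp add: bad_simplex_symmetries)
  next
    case 3
    have d: "d = -2 \<or> d = -1 \<or> d = 1 \<or> d = 2" and h: "h = -2 \<or> h = -1 \<or> h = 1 \<or> h = 2"
      using 3 dh by presburger+
    consider "d \<noteq> 1" "h \<noteq> 1" "d \<noteq> h" | "d = -2" "h = -2" | "d = 1" "h = -2" | "d = -2" "h = 1"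
      using nf d h by (auto simp: fits_def)
    then show ?thesis
    proof cases
      case 1
      then have "bad standard_simplex {b, b + (0, d), b + (h, 0)}" using dh
          by (intro bad_triangle_corner) auto
      then show ?thesis by (rule bad_mono) (use B in auto)
    next
      case 2
      have "b + (-1, 0) \<in> B" by (rule lconv_segment[OF B(1,2,4), of 1 1]) (use 2 in auto)
      moreover have "bad standard_simplex {b, b + (0, -2), b + (-1, 0)}"
          by (rule bad_triangle_corner) auto
      ultimately show ?thesis using B 2 by (elim bad_mono) auto
    next
      case 3
      have mid: "b + (-1, 0) \<in> B" by (rule lconv_segment[OF B(1,2,4), of 1 1]) (use 3 in auto)
      \<comment> \<open>The triangle without the corner \<open>b\<close>, reflected so that its short edge becomes
        vertical.\<close>
      define c where "c = simplex_reflection b + (0, -1)"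
      have "bad standard_simplex {c, c + (0, -1), c + (1, 1)}"
        by (rule bad_triangle_one_parallel_edge) auto
      moreover have "{c, c + (0, -1), c + (1, 1)} \<subseteq> simplex_reflection ` B"
        using imageI[OF mid, of simplex_reflection] imageI[OF B(3), of simplex_reflection] imageI[OF
            B(4), of simplex_reflection] 3
        by (auto simp: c_def simplex_symmetries plus_prod_def)
      ultimately have "bad standard_simplex (simplex_reflection ` B)" using bad_mono by blast
      then show ?thesis by (simp add: bad_simplex_symmetries)
    next
      case 4
      have mid: "b + (0, -1) \<in> B" by (rule lconv_segment[OF B(1,2,3), of 1 1]) (use 4 in auto)
      define c where "c = b + (0, -1)"
      have "bad standard_simplex {c, c + (0, -1), c + (1, 1)}"
        by (rule bad_triangle_one_parallel_edge) auto
      moreover have "{c, c + (0, -1), c + (1, 1)} \<subseteq> B"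
        using mid B 4 by (auto simp: c_def plus_prod_def)
      ultimately show ?thesis using bad_mono by blast
    qed
  qed
qed

text \<open>According to the number of edges parallel to those of the standard simplex, the triangle
  is covered by the lemma on one such edge or becomes a corner after a symmetry; a long vertical
  edge contains four points in line.\<close>

lemma bad_vertical_edge:
  assumes B: "lconv B" "b0 \<in> B" "b1 \<in> B" "b2 \<in> B" and D: "cross (b1 - b0) (b2 - b0) \<noteq> 0"
    and nf: "\<not> fits {b0, b1, b2}" and vert: "fst b0 = fst b1"
  shows "bad standard_simplex B"
proof -
  define d h m where "d = snd b1 - snd b0" and "h = fst b2 - fst b0" and "m = snd b2 - snd b0"
  have b: "b1 = b0 + (0, d)" "b2 = b0 + (h, m)" using vert by (auto simp: d_def h_def m_def prod_eq_iff)
  have dh: "d \<noteq> 0" "h \<noteq> 0" using D by (auto simp: b cross_def)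
  consider "\<bar>d\<bar> \<ge> 3" | "m = 0" | "m = d" | "m + h = 0 \<or> m + h = d"
    | "\<bar>d\<bar> \<le> 2" "m \<noteq> 0" "m \<noteq> d" "m + h \<noteq> 0" "m + h \<noteq> d" by linarith
  then show ?thesis
  proof cases
    case 1 then show ?thesis using bad_four_in_line[OF B(1,2)] B(3) b by blast
  next
    case 2
    then show ?thesis using bad_corner[OF B(1,2) _ _ dh] B nf unfolding b by simp
  next
    case 3
    have eq: "b1 + (0, - d) = b0" "b1 + (h, 0) = b2" using 3 by (simp_all add: b prod_eq_iff)
    have "{b1, b0, b2} = {b0, b1, b2}" by auto
    then show ?thesis using bad_corner[OF B(1,3), of "- d" h, unfolded eq] B dh nf by simp
  next
    case 4
    \<comment> \<open>The symmetry that fixes \<open>x\<close> and exchanges the horizontal with the oblique side.\<close>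
    define \<tau> where "\<tau> = (\<lambda>x. simplex_rotation (simplex_reflection x))"
    have \<tau>: "\<tau> x = (fst x, - fst x - snd x)" for x by (simp add: \<tau>_def simplex_symmetries)
    have im: "\<tau> ` X = simplex_rotation ` simplex_reflection ` X" for X by (simp add: \<tau>_def image_image)
    have lc: "lconv (\<tau> ` B)" unfolding im using lconv_symmetries B(1) by blast
    have nf': "\<not> fits {\<tau> b0, \<tau> b1, \<tau> b2}" 
      using nf fits_symmetries(1)[of "simplex_reflection ` {b0, b1, b2}"] fits_symmetries(2)[of "{b0,
          b1, b2}"]
      by (simp add: \<tau>_def)
    have mem: "\<tau> b0 \<in> \<tau> ` B" "\<tau> b1 \<in> \<tau> ` B" "\<tau> b2 \<in> \<tau> ` B" using B by auto
    have "bad standard_simplex (\<tau> ` B)"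
    proof (cases "m + h = 0")
      case True
      then have eq: "\<tau> b0 + (0, - d) = \<tau> b1" "\<tau> b0 + (h, 0) = \<tau> b2" by (simp_all add: \<tau> b prod_eq_iff)
      show ?thesis using bad_corner[OF lc mem(1), of "- d" h, unfolded eq] mem dh nf' by simp
    next
      case False
      then have eq: "\<tau> b1 + (0, d) = \<tau> b0" "\<tau> b1 + (h, 0) = \<tau> b2" using 4
          by (simp_all add: \<tau> b prod_eq_iff)
      have "{\<tau> b1, \<tau> b0, \<tau> b2} = {\<tau> b0, \<tau> b1, \<tau> b2}" by auto
      then show ?thesis using bad_corner[OF lc mem(2), of d h, unfolded eq] mem dh nf' by simp
    qed
    then show ?thesis unfolding im by (simp add: bad_simplex_symmetries)
  next
    case 5
    then have "bad standard_simplex {b0, b0 + (0, d), b0 + (h, m)}"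
      using dh by (intro bad_triangle_one_parallel_edge) auto
    then show ?thesis by (rule bad_mono) (use B b in auto)
  qed
qed

lemma bad_vertical_edge_any:
  assumes B: "lconv B" "b0 \<in> B" "b1 \<in> B" "b2 \<in> B" and D: "cross (b1 - b0) (b2 - b0) \<noteq> 0"
    and nf: "\<not> fits {b0, b1, b2}" and vert: "fst b0 = fst b1 \<or> fst b0 = fst b2 \<or> fst b1 = fst b2"
  shows "bad standard_simplex B"
proof -
  have s: "{b0, b2, b1} = {b0, b1, b2}" "{b1, b2, b0} = {b0, b1, b2}" by auto
  have "cross (b2 - b0) (b1 - b0) = - cross (b1 - b0) (b2 - b0)"
      "cross (b2 - b1) (b0 - b1) = cross (b1 - b0) (b2 - b0)"
    by (simp_all add: cross_def algebra_simps)
  then have D': "cross (b2 - b0) (b1 - b0) \<noteq> 0" "cross (b2 - b1) (b0 - b1) \<noteq> 0" using D by simp_all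
  from vert show ?thesis
  proof (elim disjE)
    assume "fst b0 = fst b1"
    then show ?thesis by (rule bad_vertical_edge[OF B D nf])
  next
    assume "fst b0 = fst b2"
    then show ?thesis by (rule bad_vertical_edge[OF B(1,2,4,3) D'(1) nf[folded s(1)]])
  next
    assume "fst b1 = fst b2"
    then show ?thesis by (rule bad_vertical_edge[OF B(1,3,4,2) D'(2) nf[folded s(2)]])
  qed
qed

lemma bad_triangle_not_fitting:
  assumes B: "lconv B" "b0 \<in> B" "b1 \<in> B" "b2 \<in> B" and D: "cross (b1 - b0) (b2 - b0) \<noteq> 0"
    and nf: "\<not> fits {b0, b1, b2}"
  shows "bad standard_simplex B"
proof -
  let ?\<rho> = simplex_rotation
  have cr: "cross (?\<rho> q - ?\<rho> p) (?\<rho> r - ?\<rho> p) = cross (q - p) (r - p)" for p q r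
    unfolding simplex_rotation_def cross_aff by (simp add: cross_def)
  consider "fst b0 = fst b1 \<or> fst b0 = fst b2 \<or> fst b1 = fst b2"
      | "snd b0 = snd b1 \<or> snd b0 = snd b2 \<or> snd b1 = snd b2"
    | "fst b0 + snd b0 = fst b1 + snd b1 \<or> fst b0 + snd b0 = fst b2 + snd b2 \<or> fst b1 + snd b1 = fst b2
        + snd b2"
    | "\<not> (fst b0 = fst b1 \<or> fst b0 = fst b2 \<or> fst b1 = fst b2)"
        "\<not> (snd b0 = snd b1 \<or> snd b0 = snd b2 \<or> snd b1 = snd b2)"
      "\<not> (fst b0 + snd b0 = fst b1 + snd b1 \<or> fst b0 + snd b0 = fst b2 + snd b2 \<or> fst b1 + snd b1
          = fst b2 + snd b2)"
    by blast
  then show ?thesis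
  proof cases
    case 1 then show ?thesis using bad_vertical_edge_any[OF B D nf] by blast
  next
    case 2
    have "\<not> fits {?\<rho> b0, ?\<rho> b1, ?\<rho> b2}" using nf fits_symmetries(1)[of "{b0, b1, b2}"] by simp
    from bad_vertical_edge_any[OF lconv_symmetries(1)[OF B(1)] imageI[OF B(2)] imageI[OF B(3)] imageI[OF
        B(4)] _ this]
    have "bad standard_simplex (?\<rho> ` B)" using 2 D unfolding cr by (simp add: simplex_symmetries)
    then show ?thesis by (simp add: bad_simplex_symmetries)
  next
    case 3
    have nf': "\<not> fits {?\<rho> (?\<rho> b0), ?\<rho> (?\<rho> b1), ?\<rho> (?\<rho> b2)}"
      using nf fits_symmetries(1)[of "{b0, b1, b2}"] fits_symmetries(1)[of "{?\<rho> b0, ?\<rho> b1, ?\<rho> b2}"]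
          by simp
    have "bad standard_simplex (?\<rho> ` ?\<rho> ` B)"
    proof (rule bad_vertical_edge_any[OF _ _ _ _ _ nf'])
      show "lconv (?\<rho> ` ?\<rho> ` B)" by (intro lconv_symmetries B)
      show "?\<rho> (?\<rho> b0) \<in> ?\<rho> ` ?\<rho> ` B" "?\<rho> (?\<rho> b1) \<in> ?\<rho> ` ?\<rho> ` B" "?\<rho> (?\<rho> b2) \<in> ?\<rho> ` ?\<rho> ` B"
        by (intro imageI B)+
      show "cross (?\<rho> (?\<rho> b1) - ?\<rho> (?\<rho> b0)) (?\<rho> (?\<rho> b2) - ?\<rho> (?\<rho> b0)) \<noteq> 0" unfolding cr by (rule D)
      have e: "fst (?\<rho> (?\<rho> x)) = - (fst x + snd x)" for x by (simp add: simplex_symmetries)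
      show "fst (?\<rho> (?\<rho> b0)) = fst (?\<rho> (?\<rho> b1)) \<or> fst (?\<rho> (?\<rho> b0)) = fst (?\<rho> (?\<rho> b2)) \<or> fst (?\<rho> (?\<rho> b1))
          = fst (?\<rho> (?\<rho> b2))"
        unfolding e neg_equal_iff_equal by (rule 3)
    qed
    then show ?thesis by (simp add: bad_simplex_symmetries)
  next
    case 4
    have "bad standard_simplex {b0, b0 + (b1 - b0), b0 + (b2 - b0)}"
      using 4 by (intro bad_triangle_generic[OF D]) auto
    then show ?thesis by (rule bad_mono) (use B in auto)
  qed
qed

text \<open>With \<open>u = q - p\<close> and \<open>v = r - p\<close>, collinearity gives
  \<open>(v \<cdot> v) u = (u \<cdot> v) v\<close>, and the position of \<open>u \<cdot> v\<close> relative to 0 and \<open>v \<cdot> v\<close>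
  tells which of the points is in the middle.\<close>

lemma collinear_between:
  assumes "cross (q - p) (r - p) = 0"
  shows "\<exists>a b c \<alpha> \<beta>. {a, b, c} = {p, q, r} \<and> 0 \<le> \<alpha> \<and> 0 \<le> \<beta> \<and> 0 < \<alpha> + \<beta> \<and>
    (\<alpha> + \<beta>) * fst c = \<alpha> * fst a + \<beta> * fst b \<and> (\<alpha> + \<beta>) * snd c = \<alpha> * snd a + \<beta> * snd b"
proof -
  define u1 u2 v1 v2 where "u1 = fst q - fst p" and "u2 = snd q - snd p" and "v1 = fst r - fst p"
      and "v2 = snd r - snd p"
  define N t where "N = v1 * v1 + v2 * v2" and "t = u1 * v1 + u2 * v2"
  have par: "u1 * v2 = u2 * v1" using assms by (simp add: cross_def u1_def u2_def v1_def v2_def)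
  have eq: "N * u1 = t * v1" "N * u2 = t * v2"
  proof -
    have "N * u1 - t * v1 = v2 * (u1 * v2 - u2 * v1)" "N * u2 - t * v2 = v1 * (u2 * v1 - u1 * v2)"
      by (simp_all add: N_def t_def algebra_simps)
    then show "N * u1 = t * v1" "N * u2 = t * v2" using par by simp_all
  qed
  have e: "N * fst q - N * fst p = t * fst r - t * fst p"
      "N * snd q - N * snd p = t * snd r - t * snd p"
    using eq by (simp_all add: u1_def u2_def v1_def v2_def right_diff_distrib)
  have N: "N \<ge> 0" by (simp add: N_def)
  show ?thesis
  proof (cases "N = 0")
    case True
    then have "v1 = 0 \<and> v2 = 0" unfolding N_def by (simp add: sum_squares_eq_zero_iff)
    then have "r = p" by (simp add: v1_def v2_def prod_eq_iff)
    then show ?thesis by (intro exI[of _ p] exI[of _ q] exI[of _ r] exI[of _ 1] exI[of _ 0]) auto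
  next
    case False
    consider "0 \<le> t" "t \<le> N" | "t < 0" | "t > N" by linarith
    then show ?thesis
    proof cases
      case 1
      then show ?thesis using e False N
        by (intro exI[of _ p] exI[of _ r] exI[of _ q] exI[of _ "N - t"] exI[of _ t]) (auto simp:
            algebra_simps)
    next
      case 2
      then show ?thesis using e False N
        by (intro exI[of _ q] exI[of _ r] exI[of _ p] exI[of _ N] exI[of _ "- t"]) (auto simp:
            algebra_simps)
    next
      case 3
      then show ?thesis using e False N
        by (intro exI[of _ p] exI[of _ q] exI[of _ r] exI[of _ "t - N"] exI[of _ N]) (auto simp:
            algebra_simps)
    qed
  qed
qed

lemma weighted_mean_bounds:
  fixes x y z :: int
  assumes "0 \<le> \<alpha>" "0 \<le> \<beta>" "0 < \<alpha> + \<beta>" "(\<alpha> + \<beta>) * z = \<alpha> * x + \<beta> * y"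
  shows "min x y \<le> z" "z \<le> max x y"
proof -
  have "(\<alpha> + \<beta>) * min x y \<le> \<alpha> * x + \<beta> * y" "\<alpha> * x + \<beta> * y \<le> (\<alpha> + \<beta>) * max x y"
    unfolding distrib_right by (intro add_mono mult_left_mono assms; simp)+
  then have "(\<alpha> + \<beta>) * min x y \<le> (\<alpha> + \<beta>) * z" "(\<alpha> + \<beta>) * z \<le> (\<alpha> + \<beta>) * max x y"
    using assms(4) by simp_all
  then show "min x y \<le> z" "z \<le> max x y" using assms(3) by (auto dest: mult_left_le_imp_le)
qed

lemma fits_between:
  assumes ab: "fits {a, b}" and w: "0 \<le> \<alpha>" "0 \<le> \<beta>" "0 < \<alpha> + \<beta>"
    "(\<alpha> + \<beta>) * fst c = \<alpha> * fst a + \<beta> * fst b" "(\<alpha> + \<beta>) * snd c = \<alpha> * snd a + \<beta> * snd b"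
  shows "fits {a, b, c}"
proof -
  have "(\<alpha> + \<beta>) * (fst c + snd c) = \<alpha> * (fst a + snd a) + \<beta> * (fst b + snd b)"
    using w(4,5) by (simp add: algebra_simps)
  note bounds = weighted_mean_bounds(1)[OF w(1-4)] weighted_mean_bounds(1)[OF w(1-3,5)]
      weighted_mean_bounds(2)[OF w(1-3) this]
  have upper: "\<exists>r'\<in>{a, b}. fst r + snd r \<le> fst r' + snd r'" if "r \<in> {a, b, c}" for r
    using that bounds(3) by (auto simp: max_def split: if_splits)
  have left: "\<exists>p'\<in>{a, b}. fst p' \<le> fst p" and lower: "\<exists>p'\<in>{a, b}. snd p' \<le> snd p" if "p \<in> {a, b, c}"
      for p
    using that bounds(1,2) by (auto simp: min_def split: if_splits)
  show ?thesis unfolding fits_def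
  proof (intro ballI)
    fix p q r assume pqr: "p \<in> {a, b, c}" "q \<in> {a, b, c}" "r \<in> {a, b, c}"
    obtain p' where p': "p' \<in> {a, b}" "fst p' \<le> fst p" using left[OF pqr(1)] by blast
    obtain q' where q': "q' \<in> {a, b}" "snd q' \<le> snd q" using lower[OF pqr(2)] by blast
    obtain r' where r': "r' \<in> {a, b}" "fst r + snd r \<le> fst r' + snd r'" using upper[OF pqr(3)] by blast
    have "fst r' + snd r' - fst p' - snd q' \<le> 2" using ab p' q' r' unfolding fits_def by blast
    then show "fst r + snd r - fst p - snd q \<le> 2" using p' q' r' by linarith
  qed
qed

lemma fits_mono: "fits B \<Longrightarrow> C \<subseteq> B \<Longrightarrow> fits C"
  unfolding fits_def by blast

text \<open>Three points witness that \<open>B\<close> does not fit. If they are collinear, the two outer ones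
  witness it already, and they are completed to a triangle by a point off their line.\<close>

lemma bad_not_fitting:
  assumes B: "lconv B" "\<not> collinear_set B" and nf: "\<not> fits B"
  shows "bad standard_simplex B"
proof -
  obtain p q r where pqr: "p \<in> B" "q \<in> B" "r \<in> B" "\<not> fst r + snd r - fst p - snd q \<le> 2"
    using nf unfolding fits_def by blast
  then have nf3: "\<not> fits {p, q, r}" unfolding fits_def by blast
  show ?thesis
  proof (cases "cross (q - p) (r - p) = 0")
    case False
    then show ?thesis using bad_triangle_not_fitting[OF B(1) pqr(1-3) _ nf3] by blast
  next
    case True
    from collinear_between[OF True] obtain a b c \<alpha> \<beta>
        where abc: "{a, b, c} = {p, q, r}" "0 \<le> \<alpha>" "0 \<le> \<beta>" "0 < \<alpha> + \<beta>"
      "(\<alpha> + \<beta>) * fst c = \<alpha> * fst a + \<beta> * fst b" "(\<alpha> + \<beta>) * snd c = \<alpha> * snd a + \<beta> * snd b" by blast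
    have nf2: "\<not> fits {a, b}" using fits_between[OF _ abc(2-6)] nf3 abc(1) by auto
    have "{a, b, c} \<subseteq> B" unfolding abc(1) using pqr(1-3) by simp
    then have ab: "a \<in> B" "b \<in> B" by simp_all
    have ne: "a \<noteq> b"
    proof
      assume "a = b"
      then have "fits {a, b}" by (simp add: fits_def)
      then show False using nf2 by blast
    qed
    have "\<exists>s\<in>B. cross (b - a) (s - a) \<noteq> 0"
    proof (rule ccontr)
      assume "\<not> ?thesis"
      then have z: "cross (b - a) (s - a) = 0" if "s \<in> B" for s using that by blast
      define w1 w2 where "w1 = fst b - fst a" and "w2 = snd b - snd a"
      have w: "w1 \<noteq> 0 \<or> w2 \<noteq> 0" using ne by (auto simp: w1_def w2_def prod_eq_iff)
      have l: "w1 * (snd s - snd a) = w2 * (fst s - fst a)" if "s \<in> B" for s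
        using z[OF that] by (simp add: cross_def w1_def w2_def)
      have "cross (y - x) (t - x) = 0" if xyt: "x \<in> B" "y \<in> B" "t \<in> B" for x y t
      proof -
        have d: "w1 * (snd s - snd x) = w2 * (fst s - fst x)" if "s \<in> B" for s
          using l[OF that] l[OF xyt(1)] by (simp add: algebra_simps)
        define Y1 Y2 T1 T2 where "Y1 = fst y - fst x" and "Y2 = snd y - snd x" and "T1 = fst t - fst x"
            and "T2 = snd t - snd x"
        have e: "w1 * Y2 = w2 * Y1" "w1 * T2 = w2 * T1"
          using d[OF xyt(2)] d[OF xyt(3)] by (simp_all add: Y1_def Y2_def T1_def T2_def)
        have c: "cross (y - x) (t - x) = Y1 * T2 - Y2 * T1"
            by (simp add: cross_def Y1_def Y2_def T1_def T2_def)
        have "w1 * (Y1 * T2 - Y2 * T1) = 0" "w2 * (Y1 * T2 - Y2 * T1) = 0" using e by algebra+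
        then show ?thesis unfolding c using w by auto
      qed
      then show False using B(2) unfolding collinear_set_def by blast
    qed
    then obtain s where s: "s \<in> B" "cross (b - a) (s - a) \<noteq> 0" by blast
    have "\<not> fits {a, b, s}" using nf2 fits_mono[of "{a, b, s}" "{a, b}"] by blast
    then show ?thesis using bad_triangle_not_fitting[OF B(1) ab s(1) s(2)] by blast
  qed
qed

section \<open>Frames and monomial changes\<close>

lemma unimodular_id: "unimodular (1, 0) (0, 1)"
  by (simp add: unimodular_def cross_def)

lemma aff_id: "aff (1, 0) (0, 1) w = (\<lambda>x. x + w)"
  by (auto simp: aff_def fun_eq_iff prod_eq_iff)

lemma aff_add: "aff e e' u ` (\<lambda>x. x + w) ` X = aff e e' (aff e e' u w) ` X"
  unfolding image_image by (intro image_cong refl) (simp add: aff_def algebra_simps)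

lemma lattice_map_aff:
  "lattice_map M a + u = aff (M $ 1 $ 1, M $ 2 $ 1) (M $ 1 $ 2, M $ 2 $ 2) u a"
  by (cases a, cases u) (simp add: lattice_map_def aff_def algebra_simps)

lemma invertible_imp_unimodular:
  fixes M :: "int^2^2"
  assumes "invertible M"
  shows "unimodular (M $ 1 $ 1, M $ 2 $ 1) (M $ 1 $ 2, M $ 2 $ 2)"
proof -
  obtain N where "M ** N = mat 1" using assms unfolding invertible_def by blast
  then have "det M * det N = 1" by (metis det_mul det_I)
  then have "det M = 1 \<or> det M = -1" by (auto simp: zmult_eq_1_iff)
  then show ?thesis by (simp add: unimodular_def cross_def det_2 mult.commute)
qed

lemma unimodular_imp_invertible:
  assumes "unimodular e e'"
  obtains M :: "int^2^2" where "invertible M" "\<And>u a. lattice_map M a + u = aff e e' u a"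
proof -
  obtain \<alpha> \<beta> \<gamma> \<delta> where db: "dual_basis e e' = ((\<alpha>, \<beta>), (\<gamma>, \<delta>))" by (metis surj_pair)
  note d = dual_basis_props[OF assms db]
  define M N :: "int^2^2" where "M = vector [vector [fst e, fst e'], vector [snd e, snd e']]"
    and "N = vector [vector [\<alpha>, \<gamma>], vector [\<beta>, \<delta>]]"
  have "M ** N = mat 1" "N ** M = mat 1"
    unfolding M_def N_def
    by (simp_all add: vec_eq_iff forall_2 matrix_matrix_mult_def sum_2 mat_def d)
  then have "invertible M" unfolding invertible_def by blast
  moreover have "lattice_map M a + u = aff e e' u a" for u a
    unfolding lattice_map_aff by (simp add: M_def)
  ultimately show ?thesis by (rule that)
qed

text \<open>The change of variables is inverted here: the given polygons are images of the normal
  forms.\<close>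

lemma same_up_to_monomial_change_iff:
  "same_up_to_monomial_change A B A' B' \<longleftrightarrow>
     (\<exists>e e' u v. unimodular e e' \<and> A = aff e e' u ` A' \<and> B = aff e e' v ` B')"
proof
  assume "same_up_to_monomial_change A B A' B'"
  then obtain M u v where M: "invertible M" "A' = (\<lambda>a. lattice_map M a + u) ` A"
      "B' = (\<lambda>b. lattice_map M b + v) ` B"
    unfolding same_up_to_monomial_change_def by blast
  obtain f f' where f: "unimodular f f'"
    "\<forall>u w. \<exists>w'. \<forall>x. aff f f' w' (aff (M $ 1 $ 1, M $ 2 $ 1) (M $ 1 $ 2, M $ 2 $ 2) u x) = w + x"
    using aff_inverse[OF invertible_imp_unimodular[OF M(1)]] by blast
  obtain u' where u': "\<forall>x. aff f f' u' (aff (M $ 1 $ 1, M $ 2 $ 1) (M $ 1 $ 2, M $ 2 $ 2) u x) = 0 + x"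
    using f(2)[rule_format, of u 0] by blast
  obtain v' where v': "\<forall>x. aff f f' v' (aff (M $ 1 $ 1, M $ 2 $ 1) (M $ 1 $ 2, M $ 2 $ 2) v x) = 0 + x"
    using f(2)[rule_format, of v 0] by blast
  have "A = aff f f' u' ` A'" "B = aff f f' v' ` B'"
    unfolding M(2,3) lattice_map_aff image_image
    by (simp_all only: u'[rule_format] v'[rule_format]) simp_all
  then show "\<exists>e e' u v. unimodular e e' \<and> A = aff e e' u ` A' \<and> B = aff e e' v ` B'" using f(1) by blast
next
  assume "\<exists>e e' u v. unimodular e e' \<and> A = aff e e' u ` A' \<and> B = aff e e' v ` B'"
  then obtain e e' u v where e: "unimodular e e'" "A = aff e e' u ` A'" "B = aff e e' v ` B'" by blast
  obtain f f' where f: "unimodular f f'" "\<forall>u w. \<exists>w'. \<forall>x. aff f f' w' (aff e e' u x) = w + x"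
    using aff_inverse[OF e(1)] by blast
  obtain u' where u': "\<forall>x. aff f f' u' (aff e e' u x) = 0 + x" using f(2)[rule_format, of u 0] by blast
  obtain v' where v': "\<forall>x. aff f f' v' (aff e e' v x) = 0 + x" using f(2)[rule_format, of v 0] by blast
  obtain M where M: "invertible M" "\<And>u a. lattice_map M a + u = aff f f' u a"
    using unimodular_imp_invertible[OF f(1)] by blast
  have "A' = (\<lambda>a. lattice_map M a + u') ` A" "B' = (\<lambda>b. lattice_map M b + v') ` B"
    unfolding M(2) e(2,3) image_image
    by (simp_all only: u'[rule_format] v'[rule_format]) simp_all
  then show "same_up_to_monomial_change A B A' B'" unfolding same_up_to_monomial_change_def using M(1)
      by blast
qed

lemma frame_preimage:
  assumes "unimodular e e'"
  obtains X' where "X = aff e e' u ` X'" "lconv X \<Longrightarrow> lconv X'"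
proof -
  obtain f f' where f: "unimodular f f'" "\<forall>u w. \<exists>w'. \<forall>x. aff f f' w' (aff e e' u x) = w + x"
    using aff_inverse[OF assms] by blast
  obtain u' where u': "\<forall>x. aff f f' u' (aff e e' u x) = 0 + x" using f(2)[rule_format, of u 0] by blast
  define X' where "X' = {x. aff e e' u x \<in> X}"
  have X: "X = aff e e' u ` X'" using aff_surj[OF assms, of u] by (auto simp: X'_def image_iff) metis
  have "X' = aff f f' u' ` X" unfolding X image_image by (simp only: u'[rule_format]) simp
  then show ?thesis using X lconv_aff[OF f(1)] that by metis
qed

lemma two_simplex_eq: "two_simplex = simplex2"
proof -
  have hull: "(x, y) \<in> convex hull {(0, 0), (2, 0), (0, 2)} \<longleftrightarrow> 0 \<le> x \<and> 0 \<le> y \<and> x + y \<le> 2" for x y :: real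
  proof
    assume "(x, y) \<in> convex hull {(0, 0), (2, 0), (0, 2)}"
    then show "0 \<le> x \<and> 0 \<le> y \<and> x + y \<le> 2" unfolding convex_hull_3 by auto
  next
    assume "0 \<le> x \<and> 0 \<le> y \<and> x + y \<le> 2"
    then show "(x, y) \<in> convex hull {(0, 0), (2, 0), (0, 2)}" unfolding convex_hull_3 mem_Collect_eq
      by (intro exI[of _ "1 - x / 2 - y / 2"] exI[of _ "x / 2"] exI[of _ "y / 2"]) auto
  qed
  have "(i, j) \<in> two_simplex \<longleftrightarrow> (i, j) \<in> simplex2" for i j
  proof -
    have "(i, j) \<in> two_simplex \<longleftrightarrow> 0 \<le> i \<and> 0 \<le> j \<and> i + j \<le> 2"
      unfolding two_simplex_def lattice_points_def by (simp add: hull) linarith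
    also have "\<dots> \<longleftrightarrow> (i, j) \<in> simplex2" unfolding simplex2_def by auto
    finally show ?thesis .
  qed
  then show ?thesis by auto
qed

lemma in_horizontal_segments_iff:
  assumes "finite B"
  shows "in_horizontal_segments n B \<longleftrightarrow> card (snd ` B) = n"
proof
  assume "in_horizontal_segments n B"
  then obtain L where L: "finite L" "card L = n" "B = (\<Union>l\<in>L. B \<inter> horizontal_line l)"
      "\<forall>l\<in>L. B \<inter> horizontal_line l \<noteq> {}"
    unfolding in_horizontal_segments_def by blast
  have "snd ` B = L"
  proof
    show "snd ` B \<subseteq> L"
    proof
      fix l assume "l \<in> snd ` B"
      then obtain b where b: "b \<in> B" "l = snd b" by blast
      then obtain k where "k \<in> L" "b \<in> horizontal_line k" using L(3) by blast
      then show "l \<in> L" using b by (auto simp: horizontal_line_def)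
    qed
    show "L \<subseteq> snd ` B" using L(4) by (force simp: horizontal_line_def)
  qed
  then show "card (snd ` B) = n" using L by simp
next
  assume "card (snd ` B) = n"
  then show "in_horizontal_segments n B" unfolding in_horizontal_segments_def
    by (intro exI[of _ "snd ` B"]) (use assms in \<open>auto simp: horizontal_line_def\<close>)
qed

section \<open>The list of pairs\<close>

definition unit_square :: "(int \<times> int) set" where
  "unit_square = {(0, 0), (1, 0), (0, 1), (1, 1)}"

definition wide_triangle :: "(int \<times> int) set" where
  "wide_triangle = {(0, 0), (1, 0), (0, 1), (2, 0)}"

definition normal_form :: "(int \<times> int) set \<Rightarrow> (int \<times> int) set \<Rightarrow> bool" where
  "normal_form A B \<longleftrightarrow> A = {(0, 0)} \<or>
     (A = {(0, 0), (1, 0)} \<and> card (snd ` B) \<le> 3 \<or> A = {(0, 0), (1, 0), (2, 0)} \<and> card (snd ` B) \<le> 2) \<or>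
     (A = B \<and> (A = unit_square \<or> A = wide_triangle)) \<or> (A = standard_simplex \<and> B \<subseteq> simplex2)"

definition listed :: "(int \<times> int) set \<Rightarrow> (int \<times> int) set \<Rightarrow> bool" where
  "listed A B \<longleftrightarrow> (\<exists>e e' u v A' B'. unimodular e e' \<and> A = aff e e' u ` A' \<and> B = aff e e' v ` B'
      \<and> normal_form A' B')"

lemma listedI: "unimodular e e' \<Longrightarrow> normal_form A' B' \<Longrightarrow> listed (aff e e' u ` A') (aff e e' v ` B')"
  unfolding listed_def by blast

lemma listed_aff:
  assumes "unimodular e e'" "listed A B"
  shows "listed (aff e e' u ` A) (aff e e' v ` B)"
proof -
  obtain f f' w w' A' B' where l: "unimodular f f'" "A = aff f f' w ` A'" "B = aff f f' w' ` B'"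
      "normal_form A' B'"
    using assms(2) unfolding listed_def by blast
  show ?thesis unfolding l(2,3) image_image aff_comp
    by (rule listedI[OF unimodular_comp[OF assms(1) l(1)] l(4)])
qed

lemma normal_form_no_high_multiplicity:
  assumes "unimodular e e'" "normal_form A B" "finite B"
  shows "\<not> has_root_of_high_multiplicity (aff e e' u ` A) (aff e e' v ` B)"
proof -
  have sq: "unit_square = insert (1, 1) standard_simplex"
      "wide_triangle = insert (2, 0) standard_simplex"
    by (auto simp: unit_square_def wide_triangle_def standard_simplex_def)
  have k: "(1, 1) \<in> simplex2" "(1, 1) \<notin> standard_simplex" "(2, 0) \<in> simplex2"
      "(2, 0) \<notin> standard_simplex"
    by (auto simp: simplex2_def standard_simplex_def)
  show ?thesis
    using assms(2) unfolding normal_form_def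
  proof (elim disjE)
    assume "A = {(0, 0)}"
    then show ?thesis using point_no_high_multiplicity[OF assms(1,3)] by simp
  next
    assume "A = {(0, 0), (1, 0)} \<and> card (snd ` B) \<le> 3"
    then show ?thesis by (intro rows_no_high_multiplicity[OF assms(1,3)] disjI1)
  next
    assume "A = {(0, 0), (1, 0), (2, 0)} \<and> card (snd ` B) \<le> 2"
    then show ?thesis by (intro rows_no_high_multiplicity[OF assms(1,3)] disjI2)
  next
    assume "A = B \<and> (A = unit_square \<or> A = wide_triangle)"
    then consider "A = unit_square" "B = unit_square" | "A = wide_triangle" "B = wide_triangle" by auto
    then show ?thesis
    proof cases
      case 1
      show ?thesis unfolding 1 sq by (rule equal_pair_no_high_multiplicity[OF assms(1) k(1,2)])
    next
      case 2
      show ?thesis unfolding 2 sq by (rule equal_pair_no_high_multiplicity[OF assms(1) k(3,4)])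
    qed
  next
    assume "A = standard_simplex \<and> B \<subseteq> simplex2"
    then show ?thesis using simplex2_no_high_multiplicity[OF assms(1)] by simp
  qed
qed

lemma listed_no_high_multiplicity:
  assumes "listed A B" "finite B"
  shows "\<not> has_root_of_high_multiplicity A B"
proof -
  obtain e e' u v A' B' where l: "unimodular e e'" "A = aff e e' u ` A'" "B = aff e e' v ` B'"
      "normal_form A' B'"
    using assms(1) unfolding listed_def by blast
  have "inj_on (aff e e' v) B'" using inj_aff[OF l(1)] inj_on_subset by blast
  then have "finite B'" using assms(2) finite_imageD unfolding l(3) by blast
  then show ?thesis unfolding l(2,3) by (rule normal_form_no_high_multiplicity[OF l(1,4)])
qed

section \<open>Segments\<close>

definition segment :: "nat \<Rightarrow> (int \<times> int) set" where
  "segment n = (\<lambda>i. (i, 0)) ` {0..<int n}"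

lemma small_segments:
  "segment 1 = {(0, 0)}" "segment 2 = {(0, 0), (1, 0)}" "segment 3 = {(0, 0), (1, 0), (2, 0)}"
  "4 \<le> n \<Longrightarrow> {(0, 0), (1, 0), (2, 0), (3, 0)} \<subseteq> segment n"
proof -
  have "{0..<int 1} = {0}" "{0..<int 2} = {0, 1}" "{0..<int 3} = {0, 1, 2}" by auto
  then show "segment 1 = {(0, 0)}" "segment 2 = {(0, 0), (1, 0)}" "segment 3 = {(0, 0), (1, 0), (2, 0)}"
    unfolding segment_def by simp_all
qed (auto simp: segment_def)

text \<open>Convexity fills in all points between the leftmost and the rightmost one.\<close>

lemma row_is_segment:
  assumes X: "lconv X" "finite X" "X \<noteq> {}" and row: "\<And>x. x \<in> X \<Longrightarrow> snd x = y"
  shows "\<exists>l. X = (\<lambda>x. x + (l, y)) ` segment (card X)"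
proof -
  define l h where "l = Min (fst ` X)" and "h = Max (fst ` X)"
  have "l \<in> fst ` X" "h \<in> fst ` X" unfolding l_def h_def using X by (intro Min_in Max_in; simp)+
  then obtain xl xh where "xl \<in> X" "fst xl = l" "xh \<in> X" "fst xh = h" by blast
  moreover from this have "xl = (l, y)" "xh = (h, y)" using row by (auto simp: prod_eq_iff)
  ultimately have lh: "(l, y) \<in> X" "(h, y) \<in> X" by simp_all
  have bounds: "l \<le> fst x \<and> fst x \<le> h" if "x \<in> X" for x unfolding l_def h_def using X that by auto
  have lh': "l \<le> h" using bounds[OF lh(1)] by simp
  have "X = (\<lambda>i. (i, y)) ` {l..h}"
  proof
    show "X \<subseteq> (\<lambda>i. (i, y)) ` {l..h}"
    proof
      fix x assume "x \<in> X"
      then have "x = (fst x, y)" "fst x \<in> {l..h}" using row bounds by (auto simp: prod_eq_iff)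
      then show "x \<in> (\<lambda>i. (i, y)) ` {l..h}" by blast
    qed
    show "(\<lambda>i. (i, y)) ` {l..h} \<subseteq> X"
    proof
      fix x assume "x \<in> (\<lambda>i. (i, y)) ` {l..h}"
      then obtain i where i: "x = (i, y)" "l \<le> i" "i \<le> h" by auto
      show "x \<in> X"
      proof (cases "l = h")
        case True then show ?thesis using i lh by simp
      next
        case False
        show ?thesis
          by (rule lconv_segment[OF X(1) lh, of "h - i"
              "i - l"]) (use i False lh' in \<open>auto simp: algebra_simps\<close>)
      qed
    qed
  qed
  moreover have "{l..h} = (\<lambda>i. i + l) ` {0..<h - l + 1}" by auto
  ultimately have eq: "X = (\<lambda>x. x + (l, y)) ` (\<lambda>i. (i, 0)) ` {0..<h - l + 1}"
    by (simp only: image_image add_Pair add_0)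
  then have "card X = card {0..<h - l + 1}"
    by (simp add: image_image) (subst card_image, auto simp: inj_on_def)
  then have "int (card X) = h - l + 1" using lh' by simp
  then show ?thesis using eq unfolding segment_def by metis
qed

text \<open>A vector divided by the greatest common divisor of its coordinates is the first vector of
  a unimodular frame, by Bezout's identity.\<close>

lemma primitive_frame:
  fixes u1 u2 :: int
  assumes "(u1, u2) \<noteq> (0, 0)"
  obtains g w e' where "g > 0" "u1 = g * fst w" "u2 = g * snd w" "cross w e' = 1"
proof -
  define g where "g = gcd u1 u2"
  have g: "g > 0" using assms by (auto simp: g_def)
  obtain a b where ab: "a * u1 + b * u2 = g" using bezout_int unfolding g_def by blast
  obtain w1 w2 where w: "u1 = g * w1" "u2 = g * w2"
    by (metis dvdE g_def gcd_dvd1 gcd_dvd2)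
  have "g * (a * w1 + b * w2) = g * 1" using ab unfolding w(1) w(2) by (simp add: algebra_simps)
  then have "a * w1 + b * w2 = 1" using g by (simp only: mult_cancel_left) auto
  then have "cross (w1, w2) (- b, a) = 1" by (simp add: cross_def algebra_simps)
  then show ?thesis using that[of g "(w1, w2)" "(- b, a)"] g w by simp
qed

lemma collinear_is_segment:
  assumes X: "lconv X" "finite X" "X \<noteq> {}" "collinear_set X"
  shows "\<exists>e e' u. unimodular e e' \<and> X = aff e e' u ` segment (card X)"
proof (cases "\<exists>p\<in>X. \<exists>q\<in>X. p \<noteq> q")
  case False
  obtain p where "p \<in> X" using X by blast
  then have "X = {p}" using False by blast
  moreover from this have "segment (card X) = {(0, 0)}" using small_segments(1) by simp
  ultimately have "X = aff (1, 0) (0, 1) p ` segment (card X)" by (simp add: aff_def)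
  then show ?thesis using unimodular_id by blast
next
  case True
  then obtain p q where pq: "p \<in> X" "q \<in> X" "p \<noteq> q" by blast
  have "(fst q - fst p, snd q - snd p) \<noteq> (0, 0)" using pq(3) by (auto simp: prod_eq_iff)
  then obtain g e e' where g: "g > 0" "fst q - fst p = g * fst e" "snd q - snd p = g * snd e"
      "cross e e' = 1"
    by (rule primitive_frame)
  have uni: "unimodular e e'" using g(4) by (simp add: unimodular_def)
  obtain Y where Y: "X = aff e e' p ` Y" "lconv X \<Longrightarrow> lconv Y" using frame_preimage[OF uni] by blast
  have inj: "inj (aff e e' p)" by (rule inj_aff[OF uni])
  have "aff e e' p (0, 0) = p" "aff e e' p (g, 0) = q"
    using g(2,3) by (simp_all add: aff_def prod_eq_iff algebra_simps)
  then have mem: "(0, 0) \<in> Y" "(g, 0) \<in> Y" using pq(1,2) unfolding Y(1)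
      by (metis inj inj_image_mem_iff)+
  have row: "snd x = 0" if "x \<in> Y" for x
  proof -
    have "collinear_set Y" using X(4) collinear_aff[OF uni] unfolding Y(1) by blast
    then have "cross ((g, 0) - (0, 0)) (x - (0, 0)) = 0" using mem that unfolding collinear_set_def
        by blast
    then show ?thesis using g(1) by (simp add: cross_def)
  qed
  have fin: "finite Y" using X(2) finite_imageD[OF _ inj_on_subset[OF inj]] unfolding Y(1) by blast
  have card: "card X = card Y" unfolding Y(1) by (rule card_image[OF inj_on_subset[OF inj]]) simp
  obtain l where l: "Y = (\<lambda>x. x + (l, 0)) ` segment (card Y)"
    using row_is_segment[OF Y(2)[OF X(1)] fin _ row] mem by blast
  have "X = aff e e' p ` (\<lambda>x. x + (l, 0)) ` segment (card Y)" using Y(1) l by metis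
  also have "\<dots> = aff e e' (aff e e' p (l, 0)) ` segment (card X)" unfolding aff_add card ..
  finally show ?thesis using uni by blast
qed

text \<open>The three families of systems with an equation in one variable, for arbitrary positions of
  the points.\<close>

lemma bad_rows:
  shows "\<lbrakk>snd b1 \<noteq> snd b2; snd b1 \<noteq> snd b3; snd b1 \<noteq> snd b4; snd b2 \<noteq> snd b3; snd b2 \<noteq> snd b4; snd b3 \<noteq>
      snd b4\<rbrakk>
     \<Longrightarrow> bad {(0, 0), (1, 0)} {b1, b2, b3, b4}"
    and "\<lbrakk>snd b1 \<noteq> snd b2; snd b1 \<noteq> snd b3; snd b2 \<noteq> snd b3\<rbrakk>
        \<Longrightarrow> bad {(0, 0), (1, 0), (2, 0)} {b1, b2, b3}"
    and "snd b1 \<noteq> snd b2 \<Longrightarrow> bad {(0, 0), (1, 0), (2, 0), (3, 0)} {b1, b2}"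
proof -
  assume ne: "snd b1 \<noteq> snd b2" "snd b1 \<noteq> snd b3" "snd b1 \<noteq> snd b4" "snd b2 \<noteq> snd b3" "snd b2 \<noteq> snd b4"
      "snd b3 \<noteq> snd b4"
  let ?f = "aff (0, 1) (1, 0) 0"
  have f: "?f x = (snd x, fst x)" for x by (simp add: aff_def)
  obtain w where w: "nonneg ((\<lambda>x. x + w) ` ?f ` {b1, b2, b3, b4})" using shift_to_nonneg
      by (metis finite.emptyI finite.insertI finite_imageI)
  have "bad {(0, 0), (0, 1)} {?f b1 + w, ?f b2 + w, ?f b3 + w, ?f b4 + w}"
    by (rule bad_four_columns) (use w ne in \<open>simp_all add: f\<close>)
  then have "bad {(0, 0), (0, 1)} ((\<lambda>x. x + w) ` ?f ` {b1, b2, b3, b4})" by simp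
  then have "bad {(0, 0), (0, 1)} (?f ` {b1, b2, b3, b4})" unfolding bad_shift .
  moreover have "{(0, 0), (0, 1)} = ?f ` {(0, 0), (1, 0)}" by (simp add: f)
  ultimately have "bad (?f ` {(0, 0), (1, 0)}) (?f ` {b1, b2, b3, b4})" by metis
  then show "bad {(0, 0), (1, 0)} {b1, b2, b3, b4}" using bad_aff_iff unimodular_symmetries(2) by blast
next
  assume ne: "snd b1 \<noteq> snd b2" "snd b1 \<noteq> snd b3" "snd b2 \<noteq> snd b3"
  obtain w where w: "nonneg ((\<lambda>x. x + w) ` {b1, b2, b3})" using shift_to_nonneg[of "{b1, b2, b3}"]
      by auto
  have "bad {(0, 0), (1, 0), (2, 0)} {b1 + w, b2 + w, b3 + w}"
    by (rule bad_three_rows) (use w ne in auto)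
  then show "bad {(0, 0), (1, 0), (2, 0)} {b1, b2, b3}"
    using bad_shift[of _ w "{b1, b2, b3}"] by simp
next
  assume ne: "snd b1 \<noteq> snd b2"
  obtain w where w: "nonneg ((\<lambda>x. x + w) ` {b1, b2})" using shift_to_nonneg[of "{b1, b2}"] by auto
  have "bad {(0, 0), (1, 0), (2, 0), (3, 0)} {b1 + w, b2 + w}"
    by (rule bad_segment4) (use w ne in auto)
  then show "bad {(0, 0), (1, 0), (2, 0), (3, 0)} {b1, b2}"
    using bad_shift[of _ w "{b1, b2}"] by simp
qed

text \<open>Systems supported at two such segments have no isolated solutions at all, which is why
  this case is set apart in the classification.\<close>

lemma segment_on_parallel_lines: "on_parallel_lines (aff e e' u ` segment k) (aff e e' v ` segment n)"
    if "unimodular e e'"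
proof -
  have "e \<noteq> (0, 0)" using that by (auto simp: unimodular_def cross_def)
  moreover have "(\<forall>(i, j)\<in>aff e e' w ` segment r. \<forall>(k, l)\<in>aff e e' w ` segment r. (k - i) * snd e
      = (l - j) * fst e)" for w r
    by (auto simp: segment_def aff_def algebra_simps)
  ultimately show ?thesis unfolding on_parallel_lines_def
    by (intro exI[of _ "fst e"] exI[of _ "snd e"]) auto
qed

lemma distinct_list_in_large_set:
  assumes "n \<le> card Y"
  shows "\<exists>xs. set xs \<subseteq> Y \<and> distinct xs \<and> length xs = n"
proof -
  obtain T where T: "T \<subseteq> Y" "card T = n" "finite T" using obtain_subset_with_card_n[OF assms] by blast
  obtain xs where xs: "set xs = T" "distinct xs" using finite_distinct_list[OF T(3)] by blast
  then have "length xs = n" using T(2) distinct_card[OF xs(2)] by simp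
  then show ?thesis using xs T(1) by auto
qed

text \<open>In the frame in which \<open>A\<close> is a horizontal segment, only the number of points of \<open>A\<close> and
  the number of rows of \<open>B\<close> matter. If \<open>A\<close> has at least four points, then \<open>B\<close> has a single row,
  and it is a short segment that takes the first place after transposition.\<close>

lemma listed_of_collinear:
  assumes A: "lconv A" "finite A" "A \<noteq> {}" "collinear_set A" and B: "lconv B" "finite B" "B \<noteq> {}"
    and nb: "\<not> bad A B" and exc: "\<not> (on_parallel_lines A B \<and> card A \<ge> 4 \<and> card B \<ge> 4)"
  shows "listed A B \<or> listed B A"
proof -
  define c where "c = card A"
  obtain e e' u where e: "unimodular e e'" "A = aff e e' u ` segment c"
    using collinear_is_segment[OF A] unfolding c_def by blast
  obtain B' where B': "B = aff e e' 0 ` B'" "lconv B \<Longrightarrow> lconv B'" using frame_preimage[OF e(1)] by blast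
  have inj: "inj_on (aff e e' 0) B'" using inj_aff[OF e(1)] inj_on_subset by blast
  have B2: "finite B'" "B' \<noteq> {}" "card B' = card B"
    using B finite_imageD[OF _ inj] card_image[OF inj] unfolding B'(1) by auto
  have nb': "\<not> bad (segment c) B'" using nb bad_aff_iff[OF e(1)] unfolding e(2) B'(1) by blast
  have c1: "c \<ge> 1" using A by (simp add: c_def Suc_le_eq card_gt_0_iff)
  have list: "listed A B" if "normal_form (segment c) B'" unfolding e(2) B'(1)
      by (rule listedI[OF e(1) that])
  have fin: "finite (snd ` B')" using B2 by simp
  consider "c = 1" | "c = 2" | "c = 3" | "c \<ge> 4" using c1 by linarith
  then show ?thesis
  proof cases
    case 1
    then have "normal_form (segment c) B'" unfolding normal_form_def
        by (simp only: small_segments simp_thms)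
    then show ?thesis using list by blast
  next
    case 2
    have "card (snd ` B') \<le> 3"
    proof (rule ccontr)
      assume "\<not> ?thesis"
      then obtain xs where xs: "set xs \<subseteq> snd ` B'" "distinct xs" "length xs = 4"
        using distinct_list_in_large_set[of 4 "snd ` B'"] by auto
      obtain h1 h2 h3 h4 where "xs = [h1, h2, h3, h4]" using xs(3)
          by (auto simp: length_Suc_conv numeral_eq_Suc)
      then have h: "{h1, h2, h3, h4} \<subseteq> snd ` B'" "h1 \<noteq> h2" "h1 \<noteq> h3" "h1 \<noteq> h4" "h2 \<noteq> h3" "h2 \<noteq> h4"
          "h3 \<noteq> h4"
        using xs by auto
      then obtain b1 b2 b3 b4 where b: "b1 \<in> B'" "b2 \<in> B'" "b3 \<in> B'" "b4 \<in> B'" "h1 = snd b1"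
          "h2 = snd b2" "h3 = snd b3" "h4 = snd b4"
        by auto
      have "bad (segment c) {b1, b2, b3, b4}" unfolding 2 small_segments
          by (rule bad_rows(1)) (use h b in auto)
      then have "bad (segment c) B'" by (rule bad_mono) (use b in auto)
      then show False using nb' by blast
    qed
    then have "normal_form (segment c) B'" unfolding normal_form_def 2 small_segments by simp
    then show ?thesis using list by blast
  next
    case 3
    have "card (snd ` B') \<le> 2"
    proof (rule ccontr)
      assume "\<not> ?thesis"
      then obtain xs where xs: "set xs \<subseteq> snd ` B'" "distinct xs" "length xs = 3"
        using distinct_list_in_large_set[of 3 "snd ` B'"] by auto
      obtain h1 h2 h3 where "xs = [h1, h2, h3]" using xs(3)
          by (auto simp: length_Suc_conv numeral_eq_Suc)
      then have h: "{h1, h2, h3} \<subseteq> snd ` B'" "h1 \<noteq> h2" "h1 \<noteq> h3" "h2 \<noteq> h3"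
        using xs by auto
      then obtain b1 b2 b3 where b: "b1 \<in> B'" "b2 \<in> B'" "b3 \<in> B'" "h1 = snd b1" "h2 = snd b2"
          "h3 = snd b3"
        by auto
      have "bad (segment c) {b1, b2, b3}" unfolding 3 small_segments
          by (rule bad_rows(2)) (use h b in auto)
      then have "bad (segment c) B'" by (rule bad_mono) (use b in auto)
      then show False using nb' by blast
    qed
    then have "normal_form (segment c) B'" unfolding normal_form_def 3 small_segments by simp
    then show ?thesis using list by blast
  next
    case 4
    obtain b0 where b0: "b0 \<in> B'" using B2 by blast
    have row: "snd b = snd b0" if b: "b \<in> B'" for b
    proof (rule ccontr)
      assume "snd b \<noteq> snd b0"
      then have "bad {(0, 0), (1, 0), (2, 0), (3, 0)} {b, b0}" by (rule bad_rows(3))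
      then have "bad (segment c) B'" by (rule bad_mono) (use small_segments(4)[OF 4] b b0 in auto)
      then show False using nb' by blast
    qed
    obtain l where l: "B' = (\<lambda>x. x + (l, snd b0)) ` segment (card B')"
      using row_is_segment[OF B'(2)[OF B(1)] B2(1,2) row] by blast
    have Beq: "B = aff e e' (aff e e' 0 (l, snd b0)) ` segment (card B)"
      using B'(1) l unfolding B2(3) by (metis aff_add)
    have "on_parallel_lines A B" unfolding e(2) by (subst Beq) (rule segment_on_parallel_lines[OF e(1)])
    then have "card B \<le> 3" using exc 4 unfolding c_def by linarith
    moreover have "card B \<ge> 1" using B by (simp add: Suc_le_eq card_gt_0_iff)
    moreover have one: "card (snd ` segment c) \<le> 1"
    proof -
      have "snd ` segment c \<subseteq> {0}" by (auto simp: segment_def)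
      from card_mono[OF _ this] show ?thesis by simp
    qed
    ultimately consider "card B = 1" | "card B = 2" | "card B = 3" by linarith
    then have "normal_form (segment (card B)) (segment c)"
    proof cases
      case 1 then show ?thesis unfolding normal_form_def by (simp only: small_segments simp_thms)
    next
      case 2
      have "card (snd ` segment c) \<le> 3" using one by simp
      then show ?thesis unfolding normal_form_def 2 small_segments by simp
    next
      case 3
      have "card (snd ` segment c) \<le> 2" using one by simp
      then show ?thesis unfolding normal_form_def 3 small_segments by simp
    qed
    then have "listed B A" unfolding e(2) by (subst Beq) (rule listedI[OF e(1)])
    then show ?thesis by blast
  qed
qed

section \<open>Two polygons of dimension two\<close>

text \<open>The triangle has an edge \<open>w\<close> that is primitive. The lattice points at height 1 above this
  edge are \<open>p + e\<^sub>0 - k w\<close>, and for a suitable \<open>k\<close> one of them lies in the triangle.\<close>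

lemma unimodular_triangle_from_primitive:
  assumes X: "lconv X" "p \<in> X" "p + w \<in> X" "r \<in> X" and w: "cross w e0 = 1" and D: "cross w (r - p) > 0"
  shows "\<exists>e e' u. unimodular e e' \<and> aff e e' u ` standard_simplex \<subseteq> X"
proof -
  define v D where "v = r - p" and "D = cross w v"
  have Dpos: "D > 0" using D by (simp add: D_def v_def)
  \<comment> \<open>Remainder modulo \<open>D\<close> puts the barycentric coordinate \<open>a / D\<close> of the new point into the
    unit interval.\<close>
  define k a where "k = cross e0 v div D" and "a = cross e0 v mod D"
  define e' where "e' = (fst e0 - k * fst w, snd e0 - k * snd w)"
  have a: "0 \<le> a" "a < D" using Dpos by (simp_all add: a_def)
  have ea: "cross e' v = a"
  proof -
    have "cross e' v = cross e0 v - k * D" by (simp add: e'_def D_def cross_def algebra_simps)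
    then show ?thesis by (simp add: k_def a_def minus_div_mult_eq_mod)
  qed
  have we: "cross w e' = 1" using w by (simp add: e'_def cross_def algebra_simps)
  have "D * fst e' = cross e' v * fst w + cross w e' * fst v"
      "D * snd e' = cross e' v * snd w + cross w e' * snd v"
    by (simp_all add: D_def cross_def algebra_simps)
  then have e': "D * fst e' = a * fst w + fst v" "D * snd e' = a * snd w + snd v"
    unfolding ea we by simp_all
  \<comment> \<open>The weights of \<open>p\<close>, \<open>p + w\<close> and \<open>r\<close>; they sum to \<open>D\<close>.\<close>
  have "p + e' \<in> X"
    by (rule lconvD[OF X, of "D - a - 1" a 1]) (use a e' in \<open>simp_all add: v_def algebra_simps\<close>)
  then have "aff w e' p ` standard_simplex \<subseteq> X"
    using X by (auto simp: standard_simplex_def aff_def plus_prod_def)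
  moreover have "unimodular w e'" using we by (simp add: unimodular_def)
  ultimately show ?thesis by blast
qed

lemma unimodular_triangle_exists:
  assumes X: "lconv X" "\<not> collinear_set X"
  shows "\<exists>e e' u. unimodular e e' \<and> aff e e' u ` standard_simplex \<subseteq> X"
proof -
  obtain p q r where pqr: "p \<in> X" "q \<in> X" "r \<in> X" "cross (q - p) (r - p) \<noteq> 0"
    using X(2) unfolding collinear_set_def by blast
  have "(fst q - fst p, snd q - snd p) \<noteq> (0, 0)"
  proof
    assume "(fst q - fst p, snd q - snd p) = (0, 0)"
    then have "q = p" by (simp add: prod_eq_iff)
    then show False using pqr(4) by (simp add: cross_def)
  qed
  then obtain g w e0 where g: "g > 0" "fst q - fst p = g * fst w" "snd q - snd p = g * snd w"
      "cross w e0 = 1"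
    by (rule primitive_frame)
  have pw: "p + w \<in> X"
    by (rule lconv_segment[OF X(1) pqr(1,2), of "g - 1" 1]) (use g in \<open>auto simp: algebra_simps\<close>)
  have "cross (q - p) (r - p) = g * cross w (r - p)" using g(2,3) by (simp add: cross_def algebra_simps)
  then have "cross w (r - p) \<noteq> 0" using pqr(4) by auto
  then consider "cross w (r - p) > 0" | "cross (- w) (r - (p + w)) > 0"
    by (force simp: cross_def algebra_simps)
  then show ?thesis
  proof cases
    case 1
    then show ?thesis by (rule unimodular_triangle_from_primitive[OF X(1) pqr(1) pw pqr(3) g(4)])
  next
    case 2
    have "cross (- w) (- e0) = 1" using g(4) by (simp add: cross_def)
    moreover have "(p + w) + (- w) \<in> X" using pqr(1) by simp
    ultimately show ?thesis using unimodular_triangle_from_primitive[OF X(1) pw _ pqr(3)] 2 by blast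
  qed
qed

text \<open>Otherwise the triangle and \<open>A\<close> would already be a bad pair, by \<open>bad_not_fitting\<close> applied
  in the frame of the triangle.\<close>

lemma fits_in_frame:
  assumes A: "lconv A" "\<not> collinear_set A" and nb: "\<not> bad A B" and uni: "unimodular e e'"
    and tri: "aff e e' u ` standard_simplex \<subseteq> B" and A': "A = aff e e' w ` A'"
  shows "fits A'"
proof (rule ccontr)
  assume nf: "\<not> fits A'"
  obtain A'' where A'': "A = aff e e' w ` A''" "lconv A \<Longrightarrow> lconv A''" using frame_preimage[OF uni]
      by blast
  have eq: "A'' = A'" using A' A''(1) inj_aff[OF uni] by (simp add: inj_image_eq_iff)
  have "\<not> collinear_set A'" using A(2) collinear_aff[OF uni] unfolding A' by blast
  then have "bad standard_simplex A'" using bad_not_fitting[OF _ _ nf] A''(2)[OF A(1)] eq by blast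
  then have "bad (aff e e' w ` A') (aff e e' u ` standard_simplex)"
      using bad_aff_iff[OF uni] bad_commute by blast
  then show False using nb bad_mono[OF _ _ tri] A' by blast
qed

lemma fits_in_shift:
  assumes "fits B" "finite B" "B \<noteq> {}"
  shows "\<exists>t. (\<lambda>x. x + t) ` B \<subseteq> simplex2"
proof -
  define a b where "a = Min (fst ` B)" and "b = Min (snd ` B)"
  have "a \<in> fst ` B" "b \<in> snd ` B" unfolding a_def b_def using assms by (intro Min_in; simp)+
  then obtain p q where pq: "p \<in> B" "fst p = a" "q \<in> B" "snd q = b" by blast
  have "x + (- a, - b) \<in> simplex2" if x: "x \<in> B" for x
  proof -
    have "a \<le> fst x" "b \<le> snd x" unfolding a_def b_def using assms x by auto
    moreover have "fst x + snd x - a - b \<le> 2" using assms(1) pq x unfolding fits_def by blast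
    ultimately have "0 \<le> fst x - a" "0 \<le> snd x - b" "(fst x - a) + (snd x - b) \<le> 2" by simp_all
    then have "(fst x - a, snd x - b) \<in> simplex2" unfolding simplex2_def by auto
    then show ?thesis by (simp add: plus_prod_def)
  qed
  then show ?thesis by blast
qed

lemma shift_eqI:
  fixes A T :: "(int \<times> int) set"
  assumes "finite T" "card A \<ge> card T" "\<And>x. x \<in> A \<Longrightarrow> x - t \<in> T"
  shows "A = (\<lambda>x. x + t) ` T"
proof -
  have sub: "A \<subseteq> (\<lambda>x. x + t) ` T"
  proof
    fix x assume "x \<in> A"
    then have "x - t \<in> T" by (rule assms(3))
    then show "x \<in> (\<lambda>x. x + t) ` T" by (intro image_eqI[of _ _ "x - t"]) (simp_all add: prod_eq_iff)
  qed
  have "card ((\<lambda>x. x + t) ` T) \<le> card T" using assms(1) by (rule card_image_le)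
  then show ?thesis using card_seteq[OF _ sub] assms(1,2) by simp
qed

lemma card_four: "card unit_square = 4" "card wide_triangle = 4"
    "card {(1, 0), (2, 0), (0, 1), (1, 1) :: int \<times> int} = 4"
  "finite unit_square" "finite wide_triangle"
  by (simp_all add: unit_square_def wide_triangle_def)

text \<open>The four unimodular triangles of the square give the four inequalities \<open>f\<close>. If \<open>A\<close> had
  horizontal width at least 2, two of them would force all its points to the same height.\<close>

lemma partner_of_unit_square:
  assumes A: "lconv A" "\<not> collinear_set A" "finite A" "card A \<ge> 4" and nb: "\<not> bad A B"
      and B: "unit_square \<subseteq> B"
  shows "\<exists>t. A = (\<lambda>x. x + t) ` unit_square"
proof -
  have F: "fits (aff (i, 0) (0, j) 0 ` A)" if ij: "i \<in> {1, -1}" "j \<in> {1, -1}" for i j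
  proof (rule fits_in_frame[OF A(1,2) nb])
    show "unimodular (i, 0) (0, j)" using ij by (auto simp: unimodular_def cross_def)
    show "A = aff (i, 0) (0, j) 0 ` aff (i, 0) (0, j) 0 ` A" using ij
        by (auto simp: image_image aff_def)
    show "aff (i, 0) (0, j) ((1 - i) div 2, (1 - j) div 2) ` standard_simplex \<subseteq> B"
      using ij B by (auto simp: standard_simplex_def unit_square_def aff_def)
  qed
  have f: "(i * fst r + j * snd r) - i * fst p - j * snd q \<le> 2"
    if "i \<in> {1, -1}" "j \<in> {1, -1}" "p \<in> A" "q \<in> A" "r \<in> A" for i j p q r
    using F[OF that(1,2)] that(3-5) unfolding fits_def ball_simps by (auto simp: aff_def mult.commute)
  have cx: "\<not> (\<forall>s\<in>A. fst s = k)" for k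
  proof
    assume k: "\<forall>s\<in>A. fst s = k"
    have "collinear_set A" unfolding collinear_set_def
    proof (intro ballI)
      fix p q r assume "p \<in> A" "q \<in> A" "r \<in> A"
      then have "fst p = k" "fst q = k" "fst r = k" using k by simp_all
      then show "cross (q - p) (r - p) = 0" by (simp add: cross_def)
    qed
    then show False using A(2) by simp
  qed
  have cy: "\<not> (\<forall>s\<in>A. snd s = k)" for k
  proof
    assume k: "\<forall>s\<in>A. snd s = k"
    have "collinear_set A" unfolding collinear_set_def
    proof (intro ballI)
      fix p q r assume "p \<in> A" "q \<in> A" "r \<in> A"
      then have "snd p = k" "snd q = k" "snd r = k" using k by simp_all
      then show "cross (q - p) (r - p) = 0" by (simp add: cross_def)
    qed
    then show False using A(2) by simp
  qed
  have wx: "fst p - fst q \<le> 1" if pq: "p \<in> A" "q \<in> A" for p q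
  proof (rule ccontr)
    assume big: "\<not> ?thesis"
    have "snd b = snd p" if b: "b \<in> A" for b
      using f[of 1 1 q b p] f[of 1 "-1" q b p] pq b big by auto
    then show False using cy by blast
  qed
  have wy: "snd p - snd q \<le> 1" if pq: "p \<in> A" "q \<in> A" for p q
  proof (rule ccontr)
    assume big: "\<not> ?thesis"
    have "fst b = fst p" if b: "b \<in> A" for b
      using f[of 1 1 b q p] f[of "-1" 1 b q p] pq b big by auto
    then show False using cx by blast
  qed
  have ne: "A \<noteq> {}" using A(4) by auto
  define a b where "a = Min (fst ` A)" and "b = Min (snd ` A)"
  have "a \<in> fst ` A" "b \<in> snd ` A" unfolding a_def b_def using A(3) ne by (intro Min_in; simp)+
  then obtain p q where pq: "p \<in> A" "fst p = a" "q \<in> A" "snd q = b" by blast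
  have "A = (\<lambda>x. x + (a, b)) ` unit_square"
  proof (rule shift_eqI)
    fix x assume x: "x \<in> A"
    have "a \<le> fst x" "b \<le> snd x" unfolding a_def b_def using A(3) x by auto
    moreover have "fst x - a \<le> 1" "snd x - b \<le> 1" using wx[OF x pq(1)] wy[OF x pq(3)] pq by simp_all
    ultimately have "fst x - a = 0 \<or> fst x - a = 1" "snd x - b = 0 \<or> snd x - b = 1" by linarith+
    then show "x - (a, b) \<in> unit_square" by (auto simp: unit_square_def minus_prod_def)
  qed (use A(4) card_four in auto)
  then show ?thesis by blast
qed

text \<open>The two unimodular triangles of the wide triangle leave, after a translation, one of three
  sets according to the least value of \<open>x + y\<close>.\<close>

lemma partner_of_wide_triangle:
  assumes A: "lconv A" "\<not> collinear_set A" "finite A" "card A \<ge> 4" and nb: "\<not> bad A B"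
      and B: "wide_triangle \<subseteq> B"
  shows "\<exists>t. A = (\<lambda>x. x + t) ` wide_triangle \<or> A = (\<lambda>x. x + t) ` {(1, 0), (2, 0), (0, 1), (1, 1)}"
proof -
  have F1: "fits A"
  proof (rule fits_in_frame[OF A(1,2) nb unimodular_id])
    show "aff (1, 0) (0, 1) 0 ` standard_simplex \<subseteq> B"
      using B by (auto simp: aff_id standard_simplex_def wide_triangle_def)
    show "A = aff (1, 0) (0, 1) 0 ` A" by (simp add: aff_id)
  qed
  have F2: "fits ((\<lambda>x. (fst x + snd x, snd x)) ` A)"
  proof (rule fits_in_frame[OF A(1,2) nb])
    show "unimodular (1, 0) (-1, 1)" by (simp add: unimodular_def cross_def)
    show "aff (1, 0) (-1, 1) (1, 0) ` standard_simplex \<subseteq> B"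
      using B by (auto simp: aff_def standard_simplex_def wide_triangle_def)
    show "A = aff (1, 0) (-1, 1) 0 ` (\<lambda>x. (fst x + snd x, snd x)) ` A"
        by (simp add: image_image aff_def)
  qed
  have f1: "fst r + snd r - fst p - snd q \<le> 2" if "p \<in> A" "q \<in> A" "r \<in> A" for p q r
    using F1 that unfolding fits_def by blast
  have f2: "fst r + 2 * snd r - (fst p + snd p) - snd q \<le> 2" if "p \<in> A" "q \<in> A" "r \<in> A" for p q r
    using F2 that unfolding fits_def ball_simps by fastforce
  have ne: "A \<noteq> {}" using A(4) by auto
  define a b c where "a = Min (fst ` A)" and "b = Min (snd ` A)" and "c = Min ((\<lambda>x. fst x + snd x) ` A)"
  have "a \<in> fst ` A" "b \<in> snd ` A" "c \<in> (\<lambda>x. fst x + snd x) ` A"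
    unfolding a_def b_def c_def using A(3) ne by (intro Min_in; simp)+
  then obtain p q r where pqr: "p \<in> A" "fst p = a" "q \<in> A" "snd q = b" "r \<in> A" "fst r + snd r = c"
      by blast
  have low: "a \<le> fst x" "b \<le> snd x" "c \<le> fst x + snd x" if "x \<in> A" for x
    unfolding a_def b_def c_def using A(3) that by auto
  have X: "0 \<le> fst x - a \<and> 0 \<le> snd x - b \<and> (fst x - a) + (snd x - b) \<le> 2 \<and>
    c - a - b \<le> (fst x - a) + (snd x - b) \<and> (fst x - a) + 2 * (snd x - b) \<le> (c - a - b) + 2"
        if x: "x \<in> A" for x
    using low[OF x] f1[OF pqr(1,3) x] f2[OF pqr(5,3) x] pqr by auto
  have "0 \<le> c - a - b" "c - a - b \<le> 2" using X[OF pqr(5)] pqr(6) by auto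
  then consider "c - a - b = 0" | "c - a - b = 1" | "c - a - b = 2" by linarith
  then show ?thesis
  proof cases
    case 1
    have "A = (\<lambda>x. x + (a, b)) ` wide_triangle"
    proof (rule shift_eqI)
      fix x assume x: "x \<in> A"
      define i j where "i = fst x - a" and "j = snd x - b"
      have ij: "0 \<le> i" "0 \<le> j" "i + 2 * j \<le> 2" using X[OF x] 1 by (simp_all add: i_def j_def)
      then have "j = 0 \<and> (i = 0 \<or> i = 1 \<or> i = 2) \<or> j = 1 \<and> i = 0" by presburger
      then have "(i, j) \<in> wide_triangle" by (auto simp: wide_triangle_def)
      then show "x - (a, b) \<in> wide_triangle" by (simp add: minus_prod_def i_def j_def)
    qed (use A(4) card_four in auto)
    then show ?thesis by blast
  next
    case 2
    have "A = (\<lambda>x. x + (a, b)) ` {(1, 0), (2, 0), (0, 1), (1, 1)}"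
    proof (rule shift_eqI)
      fix x assume x: "x \<in> A"
      define i j where "i = fst x - a" and "j = snd x - b"
      have ij: "0 \<le> i" "0 \<le> j" "i + j \<le> 2" "1 \<le> i + j" "i + 2 * j \<le> 3" using X[OF x] 2
          by (simp_all add: i_def j_def)
      then have "j = 0 \<and> (i = 1 \<or> i = 2) \<or> j = 1 \<and> (i = 0 \<or> i = 1)" by presburger
      then have "(i, j) \<in> {(1, 0), (2, 0), (0, 1), (1, 1)}" by auto
      then show "x - (a, b) \<in> {(1, 0), (2, 0), (0, 1), (1, 1)}"
          by (simp add: minus_prod_def i_def j_def)
    qed (use A(4) card_four in auto)
    then show ?thesis by blast
  next
    case 3
    have "A \<subseteq> {(a + 2, b), (a + 1, b + 1), (a, b + 2)}"
    proof
      fix x assume x: "x \<in> A"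
      define i j where "i = fst x - a" and "j = snd x - b"
      have ij: "0 \<le> i" "0 \<le> j" "i + j = 2" using X[OF x] 3 by (simp_all add: i_def j_def)
      then have "i = 2 \<and> j = 0 \<or> i = 1 \<and> j = 1 \<or> i = 0 \<and> j = 2" by presburger
      then show "x \<in> {(a + 2, b), (a + 1, b + 1), (a, b + 2)}" by (auto simp: i_def j_def prod_eq_iff)
    qed
    then have "card A \<le> card {(a + 2, b), (a + 1, b + 1), (a, b + 2)}" by (intro card_mono) auto
    then show ?thesis using A(4) by simp
  qed
qed

lemma wide_triangle_not_in_parallelogram:
  "\<not> wide_triangle \<subseteq> (\<lambda>x. x + t) ` {(1, 0), (2, 0), (0, 1), (1, 1)}"
proof
  assume "wide_triangle \<subseteq> (\<lambda>x. x + t) ` {(1, 0), (2, 0), (0, 1), (1, 1)}"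
  then have "(0, 0) \<in> (\<lambda>x. x + t) ` {(1, 0), (2, 0), (0, 1), (1, 1)}"
      "(1, 0) \<in> (\<lambda>x. x + t) ` {(1, 0), (2, 0), (0, 1), (1, 1)}"
    "(2, 0) \<in> (\<lambda>x. x + t) ` {(1, 0), (2, 0), (0, 1), (1, 1)}"
    by (auto simp: wide_triangle_def)
  then show False by (cases t) auto
qed

lemma listed_shifts:
  assumes "normal_form S S"
  shows "listed ((\<lambda>x. x + t) ` S) ((\<lambda>x. x + t') ` S)"
  using listedI[OF unimodular_id assms, of t t'] by (simp add: aff_id)

lemma bad_unshift: "bad B ((\<lambda>x. x + t) ` T) \<longleftrightarrow> bad T B"
  using bad_shift bad_commute by blast

lemma listed_of_unit_square:
  assumes A: "lconv A" "\<not> collinear_set A" "finite A" "card A \<ge> 4"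
      and B: "lconv B" "\<not> collinear_set B" "finite B" "card B \<ge> 4"
    and nb: "\<not> bad A B" and S: "unit_square \<subseteq> B"
  shows "listed A B"
proof -
  obtain t where t: "A = (\<lambda>x. x + t) ` unit_square" using partner_of_unit_square[OF A nb S] by blast
  have "\<not> bad B unit_square" using nb bad_unshift bad_commute unfolding t by blast
  then obtain t' where t': "B = (\<lambda>x. x + t') ` unit_square"
      using partner_of_unit_square[OF B _ subset_refl] by blast
  show ?thesis unfolding t t' by (rule listed_shifts) (simp add: normal_form_def)
qed

text \<open>The second possibility for \<open>A\<close>, a parallelogram, is a unit square in another frame. Then
  \<open>B\<close> would be the same parallelogram, which has no three points in a row.\<close>

lemma listed_of_wide_triangle:
  assumes A: "lconv A" "\<not> collinear_set A" "finite A" "card A \<ge> 4"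
      and B: "lconv B" "\<not> collinear_set B" "finite B" "card B \<ge> 4"
    and nb: "\<not> bad A B" and T: "wide_triangle \<subseteq> B"
  shows "listed A B"
proof -
  let ?P = "{(1, 0), (2, 0), (0, 1), (1, 1)} :: (int \<times> int) set"
  let ?f = "aff (1, 0) (-1, 1) (1, 0)"
  have uni: "unimodular (1, 0) (-1, 1)" by (simp add: unimodular_def cross_def)
  have P: "?P = ?f ` unit_square" by (auto simp: unit_square_def aff_def)
  obtain t where "A = (\<lambda>x. x + t) ` wide_triangle \<or> A = (\<lambda>x. x + t) ` ?P"
      using partner_of_wide_triangle[OF A nb T] by blast
  then show ?thesis
  proof
    assume t: "A = (\<lambda>x. x + t) ` wide_triangle"
    have "\<not> bad B wide_triangle" using nb bad_unshift bad_commute unfolding t by blast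
    then obtain t' where "B = (\<lambda>x. x + t') ` wide_triangle \<or> B = (\<lambda>x. x + t') ` ?P"
      using partner_of_wide_triangle[OF B _ subset_refl] by blast
    then have t': "B = (\<lambda>x. x + t') ` wide_triangle" using wide_triangle_not_in_parallelogram T by blast
    show ?thesis unfolding t t' by (rule listed_shifts) (simp add: normal_form_def)
  next
    assume t: "A = (\<lambda>x. x + t) ` ?P"
    have nb2: "\<not> bad B (?f ` unit_square)" using nb bad_unshift bad_commute unfolding t P by blast
    obtain B' where B': "B = ?f ` B'" "lconv B \<Longrightarrow> lconv B'" using frame_preimage[OF uni] by blast
    have inj: "inj_on ?f B'" using inj_aff[OF uni] inj_on_subset by blast
    have "\<exists>t'. B' = (\<lambda>x. x + t') ` unit_square"
    proof (rule partner_of_unit_square[OF B'(2)[OF B(1)] _ _ _ _ subset_refl])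
      show "\<not> collinear_set B'" using B(2) collinear_aff[OF uni] unfolding B'(1) by blast
      show "finite B'" using B(3) finite_imageD[OF _ inj] unfolding B'(1) by blast
      show "card B' \<ge> 4" using B(4) card_image[OF inj] unfolding B'(1) by simp
      show "\<not> bad B' unit_square" using nb2 bad_aff_iff[OF uni] unfolding B'(1) by blast
    qed
    then obtain t' where t': "B' = (\<lambda>x. x + t') ` unit_square" by blast
    have "B = (\<lambda>x. x + aff (1, 0) (-1, 1) 0 t') ` ?P"
      unfolding B'(1) t' P image_image by (intro image_cong refl) (simp add: aff_def prod_eq_iff)
    then show ?thesis using wide_triangle_not_in_parallelogram T by blast
  qed
qed

text \<open>At most two of the six points of the 2-simplex are missing, and two corners of \<open>B\<close> bring
  with them the midpoint between them. This leaves three parallelograms and six triangles.\<close>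

lemma contains_four_point_polygon:
  assumes B: "B \<subseteq> simplex2" "lconv B" "card B \<ge> 4"
  shows "\<exists>e e' u. unimodular e e' \<and> (aff e e' u ` unit_square \<subseteq> B \<or> aff e e' u ` wide_triangle \<subseteq> B)"
proof -
  have three: "x \<in> B \<or> y \<in> B \<or> z \<in> B"
    if "x \<in> simplex2" "y \<in> simplex2" "z \<in> simplex2" "x \<noteq> y" "x \<noteq> z" "y \<noteq> z" for x y z
  proof (rule ccontr)
    assume "\<not> ?thesis"
    then have "B \<subseteq> simplex2 - {x, y, z}" using B(1) by blast
    then have "card B \<le> card (simplex2 - {x, y, z})" by (intro card_mono) (auto simp: simplex2_def)
    also have "\<dots> = card simplex2 - card {x, y, z}" using that by (intro card_Diff_subset) auto
    also have "\<dots> = 3" using that by (simp add: simplex2_def)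
    finally show False using B(3) by simp
  qed
  define a b c d f g where "a \<longleftrightarrow> (0, 0) \<in> B" and "b \<longleftrightarrow> (2, 0) \<in> B" and "c \<longleftrightarrow> (0, 2) \<in> B"
    and "d \<longleftrightarrow> (1, 0) \<in> B" and "f \<longleftrightarrow> (0, 1) \<in> B" and "g \<longleftrightarrow> (1, 1) \<in> B"
  note defs = a_def b_def c_def d_def f_def g_def
  have mid: "s \<in> B" if "p \<in> B" "q \<in> B" "2 * fst s = fst p + fst q" "2 * snd s = snd p + snd q" for p q s
    by (rule lconv_segment[OF B(2) that(1,2), of 1 1]) (use that in simp_all)
  have mids: "a \<Longrightarrow> b \<Longrightarrow> d" "a \<Longrightarrow> c \<Longrightarrow> f" "b \<Longrightarrow> c \<Longrightarrow> g"
    unfolding a_def b_def c_def d_def f_def g_def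
    using mid[of "(0, 0)" "(2, 0)" "(1, 0)"] mid[of "(0, 0)" "(0, 2)" "(0, 1)"] mid[of "(2, 0)" "(0, 2)"
        "(1, 1)"]
    by simp_all
  have s: "(0, 0) \<in> simplex2" "(2, 0) \<in> simplex2" "(0, 2) \<in> simplex2" "(1, 0) \<in> simplex2"
      "(0, 1) \<in> simplex2" "(1, 1) \<in> simplex2"
    by (simp_all add: simplex2_def)
  have t: "a \<or> b \<or> c" "a \<or> b \<or> d" "a \<or> b \<or> f" "a \<or> b \<or> g" "a \<or> c \<or> d" "a \<or> c \<or> f" "a \<or> c \<or> g"
      "a \<or> d \<or> f" "a \<or> d \<or> g" "a \<or> f \<or> g"
    "b \<or> c \<or> d" "b \<or> c \<or> f" "b \<or> c \<or> g" "b \<or> d \<or> f" "b \<or> d \<or> g" "b \<or> f \<or> g" "c \<or> d \<or> f" "c \<or> d \<or> g"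
        "c \<or> f \<or> g" "d \<or> f \<or> g"
    unfolding a_def b_def c_def d_def f_def g_def by (rule three; simp add: s)+
  have "a \<and> d \<and> f \<and> g \<or> b \<and> d \<and> g \<and> f \<or> c \<and> f \<and> g \<and> d \<or>
    a \<and> d \<and> b \<and> f \<or> a \<and> d \<and> b \<and> g \<or> a \<and> f \<and> c \<and> d \<or> a \<and> f \<and> c \<and> g \<or> b \<and> g \<and> c \<and> d \<or> b \<and> g \<and> c \<and> f"
    using mids t by argo
  then consider "a \<and> d \<and> f \<and> g" | "b \<and> d \<and> g \<and> f" | "c \<and> f \<and> g \<and> d"
    | "a \<and> d \<and> b \<and> f" | "a \<and> d \<and> b \<and> g" | "a \<and> f \<and> c \<and> d" | "a \<and> f \<and> c \<and> g" | "b \<and> g \<and> c \<and> d"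
        | "b \<and> g \<and> c \<and> f"
    by (elim disjE)
  then show ?thesis
  proof cases
    case 1
    then have "aff (1, 0) (0, 1) 0 ` unit_square \<subseteq> B" by (auto simp: unit_square_def aff_def defs)
    moreover have "unimodular (1, 0) (0, 1)" by (simp add: unimodular_def cross_def)
    ultimately show ?thesis by blast
  next
    case 2
    then have "aff (-1, 0) (-1, 1) (2, 0) ` unit_square \<subseteq> B"
        by (auto simp: unit_square_def aff_def defs)
    moreover have "unimodular (-1, 0) (-1, 1)" by (simp add: unimodular_def cross_def)
    ultimately show ?thesis by blast
  next
    case 3
    then have "aff (0, -1) (1, -1) (0, 2) ` unit_square \<subseteq> B"
        by (auto simp: unit_square_def aff_def defs)
    moreover have "unimodular (0, -1) (1, -1)" by (simp add: unimodular_def cross_def)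
    ultimately show ?thesis by blast
  next
    case 4
    then have "aff (1, 0) (0, 1) 0 ` wide_triangle \<subseteq> B" by (auto simp: wide_triangle_def aff_def defs)
    moreover have "unimodular (1, 0) (0, 1)" by (simp add: unimodular_def cross_def)
    ultimately show ?thesis by blast
  next
    case 5
    then have "aff (1, 0) (1, 1) 0 ` wide_triangle \<subseteq> B" by (auto simp: wide_triangle_def aff_def defs)
    moreover have "unimodular (1, 0) (1, 1)" by (simp add: unimodular_def cross_def)
    ultimately show ?thesis by blast
  next
    case 6
    then have "aff (0, 1) (1, 0) 0 ` wide_triangle \<subseteq> B" by (auto simp: wide_triangle_def aff_def defs)
    moreover have "unimodular (0, 1) (1, 0)" by (simp add: unimodular_def cross_def)
    ultimately show ?thesis by blast
  next
    case 7
    then have "aff (0, 1) (1, 1) 0 ` wide_triangle \<subseteq> B" by (auto simp: wide_triangle_def aff_def defs)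
    moreover have "unimodular (0, 1) (1, 1)" by (simp add: unimodular_def cross_def)
    ultimately show ?thesis by blast
  next
    case 8
    then have "aff (-1, 1) (-1, 0) (2, 0) ` wide_triangle \<subseteq> B"
        by (auto simp: wide_triangle_def aff_def defs)
    moreover have "unimodular (-1, 1) (-1, 0)" by (simp add: unimodular_def cross_def)
    ultimately show ?thesis by blast
  next
    case 9
    then have "aff (1, -1) (0, -1) (0, 2) ` wide_triangle \<subseteq> B"
        by (auto simp: wide_triangle_def aff_def defs)
    moreover have "unimodular (1, -1) (0, -1)" by (simp add: unimodular_def cross_def)
    ultimately show ?thesis by blast
  qed
qed

lemma frame_image_props:
  assumes "unimodular e e'"
  shows "finite (aff e e' u ` X) \<longleftrightarrow> finite X" "card (aff e e' u ` X) = card X"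
proof -
  have "inj_on (aff e e' u) X" using inj_aff[OF assms] inj_on_subset by blast
  then show "finite (aff e e' u ` X) \<longleftrightarrow> finite X" "card (aff e e' u ` X) = card X"
    by (rule finite_image_iff, rule card_image)
qed

lemma listed_of_large:
  assumes A: "lconv A" "\<not> collinear_set A" "finite A" "card A \<ge> 4"
      and B: "lconv B" "\<not> collinear_set B" "finite B" "card B \<ge> 4"
    and nb: "\<not> bad A B" and sub: "B \<subseteq> simplex2"
  shows "listed A B"
proof -
  obtain e e' u where e: "unimodular e e'" "aff e e' u ` unit_square \<subseteq> B
      \<or> aff e e' u ` wide_triangle \<subseteq> B"
    using contains_four_point_polygon[OF sub B(1,4)] by blast
  obtain A' where A': "A = aff e e' 0 ` A'" "lconv A \<Longrightarrow> lconv A'" using frame_preimage[OF e(1)] by blast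
  obtain B' where B': "B = aff e e' u ` B'" "lconv B \<Longrightarrow> lconv B'" using frame_preimage[OF e(1)] by blast
  have A2: "lconv A'" "\<not> collinear_set A'" "finite A'" "card A' \<ge> 4"
    using A'(2)[OF A(1)] A(2-4) unfolding A'(1) collinear_aff[OF e(1)] frame_image_props[OF e(1)] .
  have B2: "lconv B'" "\<not> collinear_set B'" "finite B'" "card B' \<ge> 4"
    using B'(2)[OF B(1)] B(2-4) unfolding B'(1) collinear_aff[OF e(1)] frame_image_props[OF e(1)] .
  have nb2: "\<not> bad A' B'" using nb bad_aff_iff[OF e(1)] unfolding A'(1) B'(1) by blast
  have "unit_square \<subseteq> B' \<or> wide_triangle \<subseteq> B'"
    using e(2) unfolding B'(1) inj_image_subset_iff[OF inj_aff[OF e(1)]] .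
  then have "listed A' B'"
    using listed_of_unit_square[OF A2 B2 nb2] listed_of_wide_triangle[OF A2 B2 nb2] by blast
  then show ?thesis unfolding A'(1) B'(1) by (rule listed_aff[OF e(1)])
qed

text \<open>In the frame of a unimodular triangle of \<open>A\<close>, the set \<open>B\<close> is contained in the 2-simplex.\<close>

lemma listed_of_two_dimensional:
  assumes A: "lconv A" "\<not> collinear_set A" "finite A" and B: "lconv B" "\<not> collinear_set B" "finite B"
    and nb: "\<not> bad A B" and B4: "card A = 3 \<or> card B \<ge> 4 \<and> card A \<ge> 4"
  shows "listed A B"
proof -
  obtain e e' u where e: "unimodular e e'" "aff e e' u ` standard_simplex \<subseteq> A"
    using unimodular_triangle_exists[OF A(1,2)] by blast
  obtain B' where B': "B = aff e e' 0 ` B'" "lconv B \<Longrightarrow> lconv B'" using frame_preimage[OF e(1)] by blast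
  have fin: "finite B'" using B(3) unfolding B'(1) frame_image_props[OF e(1)] .
  have "\<not> bad B A" using nb bad_commute by blast
  from fits_in_frame[OF B(1,2) this e B'(1)] have "fits B'" .
  moreover have "B' \<noteq> {}"
    using B(2) unfolding B'(1) by (auto simp: collinear_set_def)
  ultimately obtain t where t: "(\<lambda>x. x + t) ` B' \<subseteq> simplex2" using fits_in_shift fin by blast
  define B2 where "B2 = (\<lambda>x. x + t) ` B'"
  have Bt: "B = aff e e' (aff e e' 0 (- t)) ` B2"
    unfolding B'(1) B2_def image_image by (intro image_cong refl) (simp add: aff_def algebra_simps)
  obtain A' where A': "A = aff e e' u ` A'" "lconv A \<Longrightarrow> lconv A'" using frame_preimage[OF e(1)] by blast
  have sub: "standard_simplex \<subseteq> A'" using e(2) unfolding A'(1) inj_image_subset_iff[OF inj_aff[OF e(1)]]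
      .
  have fin': "finite A'" using A(3) unfolding A'(1) frame_image_props[OF e(1)] .
  have cards: "card A = card A'" "card B = card B2" unfolding A'(1) Bt frame_image_props[OF e(1)]
      by simp_all
  have "listed A' B2"
  proof (cases "card A = 3")
    case True
    then have "A' = standard_simplex"
      using card_subset_eq[OF fin' sub] cards by (simp add: standard_simplex_def)
    then have "normal_form A' B2" using t unfolding normal_form_def B2_def by blast
    then show ?thesis using listedI[OF unimodular_id, of A' B2 0 0] by (simp add: aff_id)
  next
    case False
    show ?thesis
    proof (rule listed_of_large)
      have "B2 = aff (1, 0) (0, 1) t ` B'" by (simp add: B2_def aff_id)
      then show "lconv B2" using lconv_aff[OF unimodular_id B'(2)[OF B(1)]] by simp
      show "\<not> collinear_set A'" "\<not> collinear_set B2"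
        using A(2) B(2) collinear_aff[OF e(1)] unfolding A'(1) Bt by blast+
      show "\<not> bad A' B2" using nb bad_aff_iff[OF e(1)] unfolding A'(1) Bt by blast
    qed (use A'(2) A(1) fin' fin B4 False cards t in \<open>auto simp: B2_def\<close>)
  qed
  then show ?thesis unfolding A'(1) Bt by (rule listed_aff[OF e(1)])
qed

lemma three_le_card:
  assumes "lconv A" "\<not> collinear_set A" "finite A"
  shows "3 \<le> card A"
proof -
  obtain e e' u where e: "unimodular e e'" "aff e e' u ` standard_simplex \<subseteq> A"
    using unimodular_triangle_exists[OF assms(1,2)] by blast
  have "card standard_simplex \<le> card A"
    using card_mono[OF assms(3) e(2)] unfolding frame_image_props(2)[OF e(1)] .
  then show ?thesis by (simp add: standard_simplex_def)
qed

lemma listed_if_not_bad: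
  assumes A: "lconv A" "finite A" "A \<noteq> {}" and B: "lconv B" "finite B" "B \<noteq> {}"
    and nb: "\<not> bad A B" and exc: "\<not> (on_parallel_lines A B \<and> card A \<ge> 4 \<and> card B \<ge> 4)"
  shows "listed A B \<or> listed B A"
proof -
  have nb': "\<not> bad B A" using nb bad_commute by blast
  have "on_parallel_lines B A \<longleftrightarrow> on_parallel_lines A B"
    unfolding on_parallel_lines_def by (simp only: insert_commute[of A B])
  then have exc': "\<not> (on_parallel_lines B A \<and> card B \<ge> 4 \<and> card A \<ge> 4)" using exc by blast
  consider "collinear_set A" | "collinear_set B" | "\<not> collinear_set A" "\<not> collinear_set B" by blast
  then show ?thesis
  proof cases
    case 1 then show ?thesis using listed_of_collinear[OF A _ B nb exc] by blast
  next
    case 2 then show ?thesis using listed_of_collinear[OF B _ A nb' exc'] by blast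
  next
    case 3
    have "3 \<le> card A" "3 \<le> card B" using three_le_card A B 3 by blast+
    then consider "card A = 3 \<or> card B \<ge> 4 \<and> card A \<ge> 4" | "card B = 3" by linarith
    then show ?thesis
    proof cases
      case 1
      then show ?thesis using listed_of_two_dimensional[OF A(1) 3(1) A(2) B(1) 3(2) B(2) nb] by blast
    next
      case 2
      then show ?thesis using listed_of_two_dimensional[OF B(1) 3(2) B(2) A(1) 3(1) A(2) nb'] by blast
    qed
  qed
qed

section \<open>The classification\<close>

theorem theorem4p3:
  fixes A B :: "(int \<times> int) set"
  assumes "newton_polygon A" and "newton_polygon B"
    and "\<not> (on_parallel_lines A B \<and> card A \<ge> 4 \<and> card B \<ge> 4)"
  shows "\<not> has_root_of_high_multiplicity A B \<longleftrightarrow>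
    (\<exists>A' B'. same_up_to_change_or_transposition A B A' B' \<and>
      (A' = {(0, 0)} \<or>
       (A' = {(0, 0), (1, 0)} \<and> (\<exists>n\<le>3. in_horizontal_segments n B') \<or>
        A' = {(0, 0), (1, 0), (2, 0)} \<and> (\<exists>n\<le>2. in_horizontal_segments n B')) \<or>
       (A' = B' \<and>
        (A' = {(0, 0), (1, 0), (0, 1), (1, 1)} \<or> A' = {(0, 0), (1, 0), (0, 1), (2, 0)})) \<or>
       (A' = standard_simplex \<and> B' \<subseteq> two_simplex)))"
    (is "_ \<longleftrightarrow> (\<exists>A' B'. _ \<and> ?normal_form A' B')")
proof -
  have fin: "finite A" "finite B" "A \<noteq> {}" "B \<noteq> {}" and conv: "lconv A" "lconv B"
    using assms(1,2) newton_polygon_lconv unfolding newton_polygon_def by auto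
  have normal_form: "?normal_form A' B' \<longleftrightarrow> normal_form A' B'" if "finite B'" for A' B'
    unfolding normal_form_def two_simplex_eq unit_square_def[symmetric] wide_triangle_def[symmetric]
    by (simp add: in_horizontal_segments_iff[OF that])
  have list: "listed X Y \<longleftrightarrow> (\<exists>A' B'. same_up_to_monomial_change X Y A' B' \<and> ?normal_form A' B')"
      if Y: "finite Y" for X Y
  proof -
    have B': "finite B'" if "Y = aff e e' v ` B'" "unimodular e e'" for e e' v B'
      using Y unfolding that(1) frame_image_props(1)[OF that(2)] .
    show ?thesis
    proof
      assume "listed X Y"
      then obtain e e' u v A' B' where l: "unimodular e e'" "X = aff e e' u ` A'" "Y = aff e e' v ` B'"
          "normal_form A' B'"
        unfolding listed_def by blast
      have "?normal_form A' B'" using l(4) unfolding normal_form[OF B'[OF l(3,1)]] .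
      moreover have "same_up_to_monomial_change X Y A' B'" unfolding same_up_to_monomial_change_iff
          using l by blast
      ultimately show "\<exists>A' B'. same_up_to_monomial_change X Y A' B' \<and> ?normal_form A' B'" by blast
    next
      assume "\<exists>A' B'. same_up_to_monomial_change X Y A' B' \<and> ?normal_form A' B'"
      then obtain A' B' where s: "same_up_to_monomial_change X Y A' B'" "?normal_form A' B'" by blast
      then obtain e e' u v where e: "unimodular e e'" "X = aff e e' u ` A'" "Y = aff e e' v ` B'"
        unfolding same_up_to_monomial_change_iff by blast
      have "normal_form A' B'" using s(2) unfolding normal_form[OF B'[OF e(3,1)]] .
      then show "listed X Y" unfolding e(2,3) by (rule listedI[OF e(1)])
    qed
  qed
  have "(\<exists>A' B'. same_up_to_change_or_transposition A B A' B' \<and> ?normal_form A' B') \<longleftrightarrow>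
     (\<exists>A' B'. same_up_to_monomial_change A B A' B' \<and> ?normal_form A' B') \<or>
     (\<exists>A' B'. same_up_to_monomial_change B A A' B' \<and> ?normal_form A' B')"
    unfolding same_up_to_change_or_transposition_def conj_disj_distribR ex_disj_distrib by (rule refl)
  also have "\<dots> \<longleftrightarrow> listed A B \<or> listed B A"
    unfolding list[OF fin(1)] list[OF fin(2)] by (rule refl)
  also have "\<dots> \<longleftrightarrow> \<not> has_root_of_high_multiplicity A B"
  proof
    assume "listed A B \<or> listed B A"
    then show "\<not> has_root_of_high_multiplicity A B"
      using listed_no_high_multiplicity fin has_root_commute by blast
  next
    assume "\<not> has_root_of_high_multiplicity A B"
    then have "\<not> bad A B" using bad_imp_has_root by blast
    then show "listed A B \<or> listed B A" by (intro listed_if_not_bad conv fin assms(3))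
  qed
  finally show ?thesis by (rule sym)
qed

end
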